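(* Let $(\mathcal{N},G)$ be a complete Riemannian manifold with norm $\|v\|:=\sqrt{G(v,v)}$ on the tangent bundle $T\mathcal{N}$, let $D\subset\mathcal{N}$ be simply connected and open, and let $F:\mathcal{N}\to T\mathcal{N}$ be a twice differentiable vector field with covariant derivative $J$, $J(x)v:=\nabla_vF_x$. For $x\in D$ let $M(x)\in\mathrm{End}(T_x\mathcal{N})$ be invertible. Assume that for all points $x,y\in D$ with $y=\exp_x(\Delta x)$, $\Delta x:=-M(x)F(x)$, and all $t\in[0,1]$, the following conditions hold along the geodesic $\gamma:[0,1]\to\mathcal{N}$, $\gamma(t):=\exp_x(-tM(x)F(x))$, with parallel transport $\mathcal{P}_{\alpha,\beta}:T_{\gamma(\alpha)}\mathcal{N}\to T_{\gamma(\beta)}\mathcal{N}$: (i) there exists $\omega<\infty$ (independent of $x,y,t$) with $\|M(y)(\mathcal{P}_{t,1}J(\gamma(t))\mathcal{P}_{0,t}-\mathcal{P}_{0,1}J(x))\Delta x\|\le\omega t\|\Delta x\|^2$; (ii) there is a constant $\kappa<1$ such that the function $\tilde\kappa(x)$ defined by $\|M(y)\mathcal{P}_{0,1}(F(x)+J(x)\Delta x)\|=:\tilde\kappa(x)\|\Delta x\|$ satisfies $\tilde\kappa(x)\le\kappa$. Let $x_0\in D$ satisfy $\delta_0:=\kappa+\frac{\omega}{2}\|M(x_0)F(x_0)\|<1$, let $x_{k+1}:=\exp_{x_k}(-M(x_k)F(x_k))$ and $\Delta x_k:=-M(x_k)F(x_k)$ for $k=0,1,\dots$, let $\hat{x}$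 be the limit of $(x_k)$, i.e. $\lim_{k\to\infty}d_G(x_k,\hat{x})=0$, and suppose that $M_k:=M(x_k)$ is chosen such that $$\frac{\|[M_k^{-1}-J(x_k)]\Delta x_k\|}{\|\Delta x_k\|}\to0,\qquad k\to\infty .$$ If there is a constant $C<\infty$ such that $\|M_k\|\le C$ for all $k$, then the iteration converges locally superlinearly to $\hat{x}$.
   Context: $\exp$ is the Riemannian exponential map, $\nabla$ the Riemannian (Levi-Civita) connection, $d_G$ the geodesic distance on $\mathcal{N}$, $\mathrm{End}(T_x\mathcal{N})$ the linear endomorphisms of $T_x\mathcal{N}$, and $\|M_k\|$ the operator norm. The existence of the limit $\hat{x}$ of the iteration under assumptions (i), (ii) and $\delta_0<1$ is part of the setting (the paper's general convergence theorem for Newton-like iterations on manifolds asserts that $(x_k)$ is well defined, stays in $D_0:=\{x\in D\mid d_G(x,x_0)\le\|M(x_0)F(x_0)\|/(1-\delta_0)\}$, and converges to some $\hat{x}\in D_0$). Local superlinear convergence means: there is a sequence $\varepsilon_k\to0$ such that $d_G(x_{k+1},\hat{x})\le\varepsilon_k\,d_G(x_k,\hat{x})$ for all sufficiently large $k$. *)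

theory Defs
  imports "HOL-Analysis.Analysis"
begin

section \<open>Smooth manifolds and tangent vectors\<close>

text \<open>
  The point set of the manifold is the type \<open>'m\<close> with its topology; charts take values in the
  Euclidean space \<open>'e\<close>. A chart is a pair of its domain and its coordinate map; only the values
  of the coordinate map on the domain are meaningful.

  Every point \<open>p\<close> has a preferred chart \<open>chart_at N p\<close>, and a tangent vector at \<open>p\<close> is
  represented by its coordinate vector in that chart. Hence each tangent space is the type
  \<open>'e\<close>, and a vector field, which picks a vector in the tangent space at \<open>p\<close> for each \<open>p\<close>, is
  a function of type \<open>'m \<Rightarrow> 'e\<close>. Nothing relates the preferred charts of neighbouring
  points, so regularity is always expressed in a fixed chart, after \<open>in_chart\<close>.
\<close>

type_synonym ('m, 'e) chart = "'m set \<times> ('m \<Rightarrow> 'e)"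

abbreviation cdom :: "('m, 'e) chart \<Rightarrow> 'm set" where "cdom \<equiv> fst"
abbreviation cmap :: "('m, 'e) chart \<Rightarrow> 'm \<Rightarrow> 'e" where "cmap \<equiv> snd"

definition cinv :: "('m, 'e) chart \<Rightarrow> 'e \<Rightarrow> 'm" where
  "cinv c = inv_into (cdom c) (cmap c)"

record ('m, 'e) riemannian =
  atlas :: "('m, 'e) chart set"
  chart_at :: "'m \<Rightarrow> ('m, 'e) chart"
  metric :: "'m \<Rightarrow> 'e \<Rightarrow> 'e \<Rightarrow> real"

primrec Ck_on :: "nat \<Rightarrow> ('a::euclidean_space \<Rightarrow> 'b::real_normed_vector) \<Rightarrow> 'a set \<Rightarrow> bool" where
  "Ck_on 0 f S \<longleftrightarrow> continuous_on S f"
| "Ck_on (Suc k) f S \<longleftrightarrow>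
     f differentiable_on S \<and> (\<forall>v. Ck_on k (\<lambda>x. frechet_derivative f (at x) v) S)"

definition smooth_on :: "('a::euclidean_space \<Rightarrow> 'b::real_normed_vector) \<Rightarrow> 'a set \<Rightarrow> bool" where
  "smooth_on f S \<longleftrightarrow> (\<forall>k. Ck_on k f S)"

definition smooth_atlas ::
  "('m::topological_space, 'e::euclidean_space) chart set \<Rightarrow> bool" where
  "smooth_atlas A \<longleftrightarrow>
     (\<forall>c\<in>A. open (cdom c) \<and> open (cmap c ` cdom c) \<and>
            homeomorphism (cdom c) (cmap c ` cdom c) (cmap c) (cinv c)) \<and>
     (\<Union>c\<in>A. cdom c) = UNIV \<and>
     (\<forall>c\<in>A. \<forall>d\<in>A. smooth_on (cmap d \<circ> cinv c) (cmap c ` (cdom c \<inter> cdom d)))"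

text \<open>The derivative at \<open>p\<close> of the transition map from \<open>c\<close> to \<open>d\<close>.\<close>

definition coord_change ::
  "('m, 'e::euclidean_space) chart \<Rightarrow> ('m, 'e) chart \<Rightarrow> 'm \<Rightarrow> 'e \<Rightarrow> 'e" where
  "coord_change c d p = frechet_derivative (cmap d \<circ> cinv c) (at (cmap c p))"

text \<open>\<open>in_chart N c p v\<close> is the coordinate vector in \<open>c\<close> of the tangent vector \<open>v\<close> at \<open>p\<close>.\<close>

definition in_chart ::
  "('m, 'e::euclidean_space) riemannian \<Rightarrow> ('m, 'e) chart \<Rightarrow> 'm \<Rightarrow> 'e \<Rightarrow> 'e" where
  "in_chart N c p = coord_change (chart_at N p) c p"

definition from_chart ::
  "('m, 'e::euclidean_space) riemannian \<Rightarrow> ('m, 'e) chart \<Rightarrow> 'm \<Rightarrow> 'e \<Rightarrow> 'e" where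
  "from_chart N c p = coord_change c (chart_at N p) p"

section \<open>Riemannian metric and Levi-Civita connection\<close>

definition metric_in ::
  "('m, 'e::euclidean_space) riemannian \<Rightarrow> ('m, 'e) chart \<Rightarrow> 'e \<Rightarrow> 'e \<Rightarrow> 'e \<Rightarrow> real" where
  "metric_in N c u a b =
     (let p = cinv c u in metric N p (from_chart N c p a) (from_chart N c p b))"

definition riemannian_manifold ::
  "('m::{t2_space, second_countable_topology}, 'e::euclidean_space) riemannian \<Rightarrow> bool" where
  "riemannian_manifold N \<longleftrightarrow>
     smooth_atlas (atlas N) \<and>
     (\<forall>p. chart_at N p \<in> atlas N \<and> p \<in> cdom (chart_at N p)) \<and>
     (\<forall>p. bilinear (metric N p) \<and> (\<forall>v w. metric N p v w = metric N p w v) \<and>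
          (\<forall>v. v \<noteq> 0 \<longrightarrow> metric N p v v > 0)) \<and>
     (\<forall>c\<in>atlas N. \<forall>a b. smooth_on (\<lambda>u. metric_in N c u a b) (cmap c ` cdom c))"

definition tnorm :: "('m, 'e) riemannian \<Rightarrow> 'm \<Rightarrow> 'e \<Rightarrow> real" where
  "tnorm N p v = sqrt (metric N p v v)"

text \<open>The operator norm on the endomorphisms of the tangent space at \<open>p\<close>, as in \<open>onorm\<close>.\<close>

definition topnorm :: "('m, 'e) riemannian \<Rightarrow> 'm \<Rightarrow> ('e \<Rightarrow> 'e) \<Rightarrow> real" where
  "topnorm N p A = (SUP v. tnorm N p (A v) / tnorm N p v)"

text \<open>
  The coefficients of the Levi-Civita connection in the chart \<open>c\<close>: in terms of coordinate
  vector fields, symmetry says that the connection is torsion-free and the last condition that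
  it is compatible with the metric.
\<close>

definition levi_civita_at ::
  "('m, 'e::euclidean_space) riemannian \<Rightarrow> ('m, 'e) chart \<Rightarrow> 'e \<Rightarrow> ('e \<Rightarrow> 'e \<Rightarrow> 'e) \<Rightarrow> bool" where
  "levi_civita_at N c u \<Gamma> \<longleftrightarrow>
     bilinear \<Gamma> \<and> (\<forall>a b. \<Gamma> a b = \<Gamma> b a) \<and>
     (\<forall>a b z. frechet_derivative (\<lambda>w. metric_in N c w b z) (at u) a =
        metric_in N c u (\<Gamma> a b) z + metric_in N c u b (\<Gamma> a z))"

definition christoffel ::
  "('m, 'e::euclidean_space) riemannian \<Rightarrow> ('m, 'e) chart \<Rightarrow> 'e \<Rightarrow> 'e \<Rightarrow> 'e \<Rightarrow> 'e" where
  "christoffel N c u = (THE \<Gamma>. levi_civita_at N c u \<Gamma>)"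

definition field_in ::
  "('m, 'e::euclidean_space) riemannian \<Rightarrow> ('m, 'e) chart \<Rightarrow> ('m \<Rightarrow> 'e) \<Rightarrow> 'e \<Rightarrow> 'e" where
  "field_in N c F u = in_chart N c (cinv c u) (F (cinv c u))"

definition twice_differentiable_field ::
  "('m, 'e::euclidean_space) riemannian \<Rightarrow> ('m \<Rightarrow> 'e) \<Rightarrow> bool" where
  "twice_differentiable_field N F \<longleftrightarrow>
     (\<forall>c\<in>atlas N. field_in N c F differentiable_on (cmap c ` cdom c) \<and>
        (\<forall>a. (\<lambda>u. frechet_derivative (field_in N c F) (at u) a)
               differentiable_on (cmap c ` cdom c)))"

text \<open>
  The covariant derivative at \<open>x\<close> of the vector field \<open>F\<close> in direction \<open>v\<close>, computed in the
  preferred chart at \<open>x\<close>.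
\<close>

definition nabla ::
  "('m, 'e::euclidean_space) riemannian \<Rightarrow> ('m \<Rightarrow> 'e) \<Rightarrow> 'm \<Rightarrow> 'e \<Rightarrow> 'e" where
  "nabla N F x v =
     (let c = chart_at N x; u = cmap c x
      in frechet_derivative (field_in N c F) (at u) v + christoffel N c u v (F x))"

section \<open>Curves: parallel transport, geodesics, exponential map\<close>

definition velocity ::
  "('m, 'e::euclidean_space) riemannian \<Rightarrow> real set \<Rightarrow> (real \<Rightarrow> 'm) \<Rightarrow> real \<Rightarrow> 'e" where
  "velocity N I \<gamma> t = vector_derivative (cmap (chart_at N (\<gamma> t)) \<circ> \<gamma>) (at t within I)"

text \<open>\<open>w\<close> is the covariant derivative at \<open>t\<close> of the vector field \<open>V\<close> along \<open>\<gamma>\<close>.\<close>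

definition has_covariant_derivative ::
  "('m, 'e::euclidean_space) riemannian \<Rightarrow> real set \<Rightarrow> (real \<Rightarrow> 'm) \<Rightarrow> (real \<Rightarrow> 'e) \<Rightarrow> real \<Rightarrow> 'e \<Rightarrow> bool"
  where
  "has_covariant_derivative N I \<gamma> V t w \<longleftrightarrow>
     (\<forall>c\<in>atlas N. \<gamma> t \<in> cdom c \<longrightarrow>
        (\<exists>a b. ((cmap c \<circ> \<gamma>) has_vector_derivative a) (at t within I) \<and>
               ((\<lambda>s. in_chart N c (\<gamma> s) (V s)) has_vector_derivative b) (at t within I) \<and>
               in_chart N c (\<gamma> t) w =
                 b + christoffel N c (cmap c (\<gamma> t)) a (in_chart N c (\<gamma> t) (V t))))"

definition parallel_along ::
  "('m::topological_space, 'e::euclidean_space) riemannian \<Rightarrow> real set \<Rightarrow> (real \<Rightarrow> 'm) \<Rightarrow> (real \<Rightarrow> 'e) \<Rightarrow> bool"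
  where
  "parallel_along N I \<gamma> V \<longleftrightarrow>
     continuous_on I \<gamma> \<and> (\<forall>t\<in>I. has_covariant_derivative N I \<gamma> V t 0)"

definition geodesic_on ::
  "('m::topological_space, 'e::euclidean_space) riemannian \<Rightarrow> real set \<Rightarrow> (real \<Rightarrow> 'm) \<Rightarrow> bool" where
  "geodesic_on N I \<gamma> \<longleftrightarrow> parallel_along N I \<gamma> (velocity N I \<gamma>)"

definition geodesically_complete ::
  "('m::topological_space, 'e::euclidean_space) riemannian \<Rightarrow> bool" where
  "geodesically_complete N \<longleftrightarrow>
     (\<forall>p v. \<exists>\<gamma>. geodesic_on N UNIV \<gamma> \<and> \<gamma> 0 = p \<and> velocity N UNIV \<gamma> 0 = v)"

definition riemannian_exp ::
  "('m::topological_space, 'e::euclidean_space) riemannian \<Rightarrow> 'm \<Rightarrow> 'e \<Rightarrow> 'm" where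
  "riemannian_exp N p v =
     (THE q. \<exists>\<gamma>. geodesic_on N {0..1} \<gamma> \<and> \<gamma> 0 = p \<and> velocity N {0..1} \<gamma> 0 = v \<and> \<gamma> 1 = q)"

text \<open>
  Parallel transport from \<open>\<gamma> \<alpha>\<close> to \<open>\<gamma> \<beta>\<close> along a curve \<open>\<gamma>\<close> with parameter interval \<open>{0..1}\<close>.
\<close>

definition parallel_transport ::
  "('m::topological_space, 'e::euclidean_space) riemannian \<Rightarrow> (real \<Rightarrow> 'm) \<Rightarrow> real \<Rightarrow> real \<Rightarrow> 'e \<Rightarrow> 'e"
  where
  "parallel_transport N \<gamma> \<alpha> \<beta> v =
     (THE w. \<exists>V. parallel_along N {0..1} \<gamma> V \<and> V \<alpha> = v \<and> V \<beta> = w)"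

section \<open>Geodesic distance\<close>

definition C1_curve_on ::
  "('m::topological_space, 'e::euclidean_space) riemannian \<Rightarrow> real set \<Rightarrow> (real \<Rightarrow> 'm) \<Rightarrow> bool" where
  "C1_curve_on N I \<gamma> \<longleftrightarrow>
     continuous_on I \<gamma> \<and>
     (\<forall>t\<in>I. (cmap (chart_at N (\<gamma> t)) \<circ> \<gamma>) differentiable (at t within I)) \<and>
     (\<forall>c\<in>atlas N. continuous_on {s\<in>I. \<gamma> s \<in> cdom c}
        (\<lambda>s. in_chart N c (\<gamma> s) (velocity N I \<gamma> s)))"

definition piecewise_C1_curve ::
  "('m::topological_space, 'e::euclidean_space) riemannian \<Rightarrow> (real \<Rightarrow> 'm) \<Rightarrow> bool" where
  "piecewise_C1_curve N \<gamma> \<longleftrightarrow>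
     (\<exists>n \<tau>. \<tau> 0 = 0 \<and> \<tau> n = 1 \<and>
        (\<forall>i<n. \<tau> i < \<tau> (Suc i) \<and> C1_curve_on N {\<tau> i..\<tau> (Suc i)} \<gamma>))"

text \<open>
  At the finitely many break points the velocity is arbitrary, which does not affect the
  integral.
\<close>

definition curve_length :: "('m, 'e::euclidean_space) riemannian \<Rightarrow> (real \<Rightarrow> 'm) \<Rightarrow> real" where
  "curve_length N \<gamma> = integral {0..1} (\<lambda>t. tnorm N (\<gamma> t) (velocity N {0..1} \<gamma> t))"

text \<open>
  The distance is \<open>\<infinity>\<close> between points that no curve joins, so connectedness of the manifold
  need not be assumed.
\<close>

definition geodesic_dist ::
  "('m::topological_space, 'e::euclidean_space) riemannian \<Rightarrow> 'm \<Rightarrow> 'm \<Rightarrow> ennreal" where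
  "geodesic_dist N p q =
     (INF \<gamma>\<in>{\<gamma>. piecewise_C1_curve N \<gamma> \<and> \<gamma> 0 = p \<and> \<gamma> 1 = q}. ennreal (curve_length N \<gamma>))"

definition superlinear_convergence ::
  "('m::topological_space, 'e::euclidean_space) riemannian \<Rightarrow> (nat \<Rightarrow> 'm) \<Rightarrow> 'm \<Rightarrow> bool" where
  "superlinear_convergence N x l \<longleftrightarrow>
     (\<exists>\<epsilon> :: nat \<Rightarrow> real. \<epsilon> \<longlonglongrightarrow> 0 \<and>
        (\<forall>\<^sub>F k in sequentially.
           geodesic_dist N (x (Suc k)) l \<le> ennreal (\<epsilon> k) * geodesic_dist N (x k) l))"

end

theory Submission
  imports Defs
begin

text \<open>
  Put \<open>d\<^sub>k = \<parallel>\<Delta>x\<^sub>k\<parallel>\<close>. Transporting the field along the geodesic from \<open>x\<^sub>k\<close> to \<open>x\<^sub>k\<^sub>+\<^sub>1\<close> and using (i)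
  gives \<open>d\<^sub>k\<^sub>+\<^sub>1 \<le> \<parallel>M\<^sub>k\<^sub>+\<^sub>1 P(F(x\<^sub>k) + J(x\<^sub>k)\<Delta>x\<^sub>k)\<parallel> + \<omega>/2 d\<^sub>k\<^sup>2\<close>. By (ii) and \<open>\<delta>\<^sub>0 < 1\<close> this contracts, so
  \<open>d\<^sub>k\<close> tends to \<open>0\<close>; since \<open>F(x\<^sub>k) = - M\<^sub>k\<^sup>-\<^sup>1 \<Delta>x\<^sub>k\<close> and parallel transport is isometric, the bound on
  \<open>M\<^sub>k\<close> and the approximation hypothesis turn it into \<open>d\<^sub>k\<^sub>+\<^sub>1 \<le> \<theta>\<^sub>k d\<^sub>k\<close> with \<open>\<theta>\<^sub>k \<rightarrow> 0\<close>.

  To pass from steps to distances, one works in a chart around the limit. There the geodesic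
  distance to the limit is comparable with the Euclidean one, and a short geodesic of length \<open>d\<close>
  has Euclidean displacement comparable with \<open>d\<close>, because it deviates from a straight line only
  by \<open>O(d\<^sup>2)\<close>. Constants do not matter for superlinear convergence, so neither minimality of short
  geodesics nor the triangle inequality for the geodesic distance is needed.
\<close>

section \<open>Linear algebra of inner products on a Euclidean space\<close>

text \<open>The connection, the exponential map and parallel transport are given by definite
  descriptions, so existence and uniqueness must be settled before the conditions along the
  geodesics say anything. The Levi-Civita coefficients come from the Koszul formula. Parallel fields
  are unique because their pairings are constant, and exist by solving a linear equation locally and
  gluing. For geodesics only uniqueness is proved, by a Gronwall argument; completeness provides
  their existence on the whole line.

  Preferred charts of neighbouring points are unrelated, so derivatives along a curve are taken in a
  fixed chart, and the transformation law of the connection makes a check in a single chart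
  sufficient.

  The delicate comparison is the lower bound for the geodesic distance, an infimum that also runs
  over curves leaving the chart. A curve too short to cross a coordinate ball cannot leave it, and
  longer ones are compared with a short one.\<close>

lemma linear_expand:
  fixes f :: "'a::euclidean_space \<Rightarrow> 'b::real_vector"
  assumes "linear f"
  shows "f x = (\<Sum>b\<in>Basis. (x \<bullet> b) *\<^sub>R f b)"
proof -
  have "f x = f (\<Sum>b\<in>Basis. (x \<bullet> b) *\<^sub>R b)"
    by (simp add: euclidean_representation)
  also have "\<dots> = (\<Sum>b\<in>Basis. (x \<bullet> b) *\<^sub>R f b)"
    using assms by (simp add: linear_sum linear_scale)
  finally show ?thesis .
qed

lemma bilinear_expand:
  fixes g :: "'a::euclidean_space \<Rightarrow> 'a \<Rightarrow> real"
  assumes "bilinear g"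
  shows "g v w = (\<Sum>a\<in>Basis. \<Sum>b\<in>Basis. (v \<bullet> a) * (w \<bullet> b) * g a b)"
proof -
  have "g v w = (\<Sum>a\<in>Basis. (v \<bullet> a) *\<^sub>R g a w)"
    using assms by (intro linear_expand) (simp add: bilinear_def)
  also have "\<dots> = (\<Sum>a\<in>Basis. (v \<bullet> a) *\<^sub>R (\<Sum>b\<in>Basis. (w \<bullet> b) *\<^sub>R g a b))"
    using assms by (intro sum.cong refl arg_cong[where f = "scaleR _"] linear_expand)
      (simp add: bilinear_def)
  finally show ?thesis
    by (simp add: sum_distrib_left mult.assoc)
qed

text \<open>Smoothness of the metric is known entry by entry, so compactness yields bounds on basis
  vectors; the factor counts pairs of basis vectors.\<close>

lemma bilinear_abs_le:
  fixes g :: "'a::euclidean_space \<Rightarrow> 'a \<Rightarrow> real"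
  assumes "bilinear g" and le: "\<And>a b. a \<in> Basis \<Longrightarrow> b \<in> Basis \<Longrightarrow> \<bar>g a b\<bar> \<le> K"
  shows "\<bar>g v w\<bar> \<le> K * (real (card (Basis :: 'a set)))\<^sup>2 * norm v * norm w"
proof -
  have "\<bar>g v w\<bar> \<le> (\<Sum>a\<in>Basis. \<Sum>b\<in>Basis. \<bar>(v \<bullet> a) * (w \<bullet> b) * g a b\<bar>)"
    unfolding bilinear_expand[OF assms(1), of v w] by (intro order_trans[OF sum_abs] sum_mono)
      (rule order_refl sum_abs)+
  also have "\<dots> \<le> (\<Sum>a\<in>(Basis::'a set). \<Sum>b\<in>(Basis::'a set). norm v * norm w * K)"
    using Basis_le_norm le by (intro sum_mono) (auto simp: abs_mult intro!: mult_mono)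
  finally show ?thesis
    by (simp add: power2_eq_square mult_ac)
qed

lemma trilinear_abs_le:
  fixes h :: "'a::euclidean_space \<Rightarrow> 'a \<Rightarrow> 'a \<Rightarrow> real"
  assumes lin: "\<And>b z. linear (\<lambda>a. h a b z)" and bil: "\<And>a. bilinear (h a)"
    and le: "\<And>a b z. a \<in> Basis \<Longrightarrow> b \<in> Basis \<Longrightarrow> z \<in> Basis \<Longrightarrow> \<bar>h a b z\<bar> \<le> K"
  shows "\<bar>h a b z\<bar> \<le> K * (real (card (Basis :: 'a set)))^3 * norm a * norm b * norm z"
proof -
  let ?n = "real (card (Basis :: 'a set))"
  have "\<bar>h a b z\<bar> \<le> (\<Sum>i\<in>Basis. \<bar>(a \<bullet> i) * h i b z\<bar>)"
    using linear_expand[OF lin, of a b z] by (simp add: sum_abs)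
  also have "\<dots> \<le> (\<Sum>i\<in>(Basis::'a set). norm a * (K * ?n\<^sup>2 * norm b * norm z))"
    unfolding abs_mult using Basis_le_norm bilinear_abs_le[OF bil le]
    by (intro sum_mono mult_mono) auto
  finally show ?thesis
    by (simp add: power3_eq_cube power2_eq_square mult_ac)
qed

text \<open>Covers both the metric on a tangent space and its coordinate expression
  \<open>metric_in\<close>. Neither is the inner product of the type \<open>'e\<close>, so the
  standard facts are derived for such forms.\<close>

definition inner_form :: "('a::euclidean_space \<Rightarrow> 'a \<Rightarrow> real) \<Rightarrow> bool" where
  "inner_form g \<longleftrightarrow> bilinear g \<and> (\<forall>a b. g a b = g b a) \<and> (\<forall>a. a \<noteq> 0 \<longrightarrow> g a a > 0)"

context
  fixes g :: "'a::euclidean_space \<Rightarrow> 'a \<Rightarrow> real"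
  assumes g: "inner_form g"
begin

lemma inner_form_linear: "linear (g a)" "linear (\<lambda>a. g a b)"
  using g by (auto simp: inner_form_def bilinear_def)

lemma inner_form_commute: "g a b = g b a"
  using g by (auto simp: inner_form_def)

lemma inner_form_simps:
  "g (a + b) c = g a c + g b c" "g c (a + b) = g c a + g c b"
  "g (a - b) c = g a c - g b c" "g c (a - b) = g c a - g c b"
  "g (r *\<^sub>R a) b = r * g a b" "g a (r *\<^sub>R b) = r * g a b"
  "g 0 a = 0" "g a 0 = 0" "g (- a) b = - g a b" "g a (- b) = - g a b"
  using linear_add[OF inner_form_linear(1)] linear_add[OF inner_form_linear(2)]
    linear_diff[OF inner_form_linear(1)] linear_diff[OF inner_form_linear(2)]
    linear_scale[OF inner_form_linear(1)] linear_scale[OF inner_form_linear(2)]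
    linear_0[OF inner_form_linear(1)] linear_0[OF inner_form_linear(2)]
    linear_neg[OF inner_form_linear(1)] linear_neg[OF inner_form_linear(2)]
  by simp_all

lemma inner_form_nonneg: "g a a \<ge> 0"
  using g by (cases "a = 0") (auto simp: inner_form_def inner_form_simps less_imp_le)

lemma inner_form_eq_0: "g a a = 0 \<longleftrightarrow> a = 0"
  using g by (cases "a = 0") (auto simp: inner_form_def inner_form_simps)

text \<open>Nondegeneracy: vectors are identified by pairing them with all \<open>z\<close>. This
  replaces index computations for the connection and gives additivity of parallel transport.\<close>

lemma inner_form_eqI:
  assumes "\<And>z. g a z = g b z"
  shows "a = b"
proof -
  have "g (a - b) (a - b) = 0"
    by (simp add: inner_form_simps assms)
  then show ?thesis
    using inner_form_eq_0 by simp
qed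

lemma inner_form_cauchy_schwarz: "g a b \<le> sqrt (g a a) * sqrt (g b b)"
proof (cases "b = 0")
  case True
  then show ?thesis by (simp add: inner_form_simps)
next
  case False
  then have pos: "g b b > 0"
    using g by (simp add: inner_form_def)
  let ?t = "g a b / g b b"
  have "0 \<le> g (a - ?t *\<^sub>R b) (a - ?t *\<^sub>R b)"
    by (rule inner_form_nonneg)
  also have "\<dots> = g a a - (g a b)\<^sup>2 / g b b"
    using pos by (simp add: inner_form_simps inner_form_commute[of b a] power2_eq_square field_simps)
  finally have "(g a b)\<^sup>2 \<le> g a a * g b b"
    using pos by (simp add: field_simps)
  then have "\<bar>g a b\<bar> \<le> sqrt (g a a * g b b)"
    using real_le_rsqrt by (metis real_sqrt_abs real_sqrt_le_iff)
  then show ?thesis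
    by (simp add: real_sqrt_mult)
qed

lemma inner_form_triangle: "sqrt (g (a + b) (a + b)) \<le> sqrt (g a a) + sqrt (g b b)"
proof (rule real_le_lsqrt)
  have "g (a + b) (a + b) = g a a + g b b + 2 * g a b"
    by (simp add: inner_form_simps inner_form_commute[of b a])
  also have "\<dots> \<le> g a a + g b b + 2 * (sqrt (g a a) * sqrt (g b b))"
    using inner_form_cauchy_schwarz by simp
  also have "\<dots> = (sqrt (g a a) + sqrt (g b b))\<^sup>2"
    by (simp add: power2_sum inner_form_nonneg)
  finally show "g (a + b) (a + b) \<le> (sqrt (g a a) + sqrt (g b b))\<^sup>2" .
qed (simp add: inner_form_nonneg)

text \<open>\<open>A\<close> represents the form through the Euclidean inner product. Definiteness
  makes it injective, hence surjective in finite dimension. The lemma yields the Levi-Civita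
  coefficients and adjoints.\<close>

lemma inner_form_riesz:
  fixes L :: "'a \<Rightarrow> real"
  assumes L: "linear L"
  shows "\<exists>w. \<forall>z. g w z = L z"
proof -
  define A where "A w = (\<Sum>b\<in>Basis. g w b *\<^sub>R b)" for w
  have lin: "linear A"
    unfolding A_def by (intro linear_compose_sum ballI linear_compose[unfolded o_def, OF inner_form_linear(2)])
      (auto intro!: linearI simp: scaleR_add_left)
  have A_inner: "A w \<bullet> b = g w b" if "b \<in> Basis" for w b
    using that by (simp add: A_def inner_sum_left inner_Basis sum.delta if_distrib cong: if_cong)
  have gA: "g w z = A w \<bullet> z" for w z
  proof -
    have "g w z = (\<Sum>b\<in>Basis. (z \<bullet> b) *\<^sub>R g w b)"
      by (rule linear_expand[OF inner_form_linear(1)])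
    also have "\<dots> = (\<Sum>b\<in>Basis. (A w \<bullet> b) * (z \<bullet> b))"
      by (intro sum.cong refl) (simp add: A_inner)
    finally show ?thesis
      by (simp add: euclidean_inner[of "A w" z])
  qed
  have "w = 0" if "A w = 0" for w
    using gA[of w w] that inner_form_eq_0 by simp
  then have "inj A"
    using linear_injective_0[OF lin] by blast
  then have "surj A"
    using lin by (simp add: linear_injective_imp_surjective)
  then obtain w where w: "A w = (\<Sum>b\<in>Basis. L b *\<^sub>R b)"
    by (metis surjD)
  have "g w z = L z" for z
    unfolding gA w linear_expand[OF L, of z]
    by (simp add: inner_sum_left inner_commute[of z] mult.commute)
  then show ?thesis by blast
qed

end

section \<open>Calculus\<close>

text \<open>Product rule for a moving linear map applied to a moving vector. Expanding the vector in
  the basis leaves products of a scalar with a vector. Linearity is asked for only near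
  \<open>t\<close>, because a chart covers only part of a curve.\<close>

lemma has_vector_derivative_linear_family:
  fixes f :: "real \<Rightarrow> 'a::euclidean_space \<Rightarrow> 'b::real_normed_vector"
  assumes lin: "\<forall>\<^sub>F s in nhds t. s \<in> I \<longrightarrow> linear (f s)" and "linear f'" and t: "t \<in> I"
    and f: "\<And>b. b \<in> Basis \<Longrightarrow> ((\<lambda>s. f s b) has_vector_derivative f' b) (at t within I)"
    and V: "(V has_vector_derivative V') (at t within I)"
  shows "((\<lambda>s. f s (V s)) has_vector_derivative f' (V t) + f t V') (at t within I)"
proof -
  have [simp]: "linear (f t)"
    using eventually_nhds_x_imp_x[OF lin] t by blast
  have Vb: "((\<lambda>s. V s \<bullet> b) has_field_derivative V' \<bullet> b) (at t within I)" for b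
    using bounded_linear.has_vector_derivative[OF bounded_linear_inner_left V]
    by (simp add: has_real_derivative_iff_has_vector_derivative)
  have "((\<lambda>s. \<Sum>b\<in>Basis. (V s \<bullet> b) *\<^sub>R f s b) has_vector_derivative
      (\<Sum>b\<in>Basis. (V t \<bullet> b) *\<^sub>R f' b + (V' \<bullet> b) *\<^sub>R f t b)) (at t within I)"
    by (intro has_vector_derivative_sum has_vector_derivative_scaleR Vb f)
  also have "(\<Sum>b\<in>Basis. (V t \<bullet> b) *\<^sub>R f' b + (V' \<bullet> b) *\<^sub>R f t b) = f' (V t) + f t V'"
    using linear_expand[OF \<open>linear f'\<close>, of "V t"] linear_expand[of "f t" V'] by (simp add: sum.distrib)
  finally show ?thesis
  proof (rule has_vector_derivative_cong_ev[THEN iffD1, rotated -1])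
    show "\<forall>\<^sub>F s in nhds t. s \<in> I \<longrightarrow> (\<Sum>b\<in>Basis. (V s \<bullet> b) *\<^sub>R f s b) = f s (V s)"
      using lin by eventually_elim (metis linear_expand)
    show "(\<Sum>b\<in>Basis. (V t \<bullet> b) *\<^sub>R f t b) = f t (V t)"
      by (rule linear_expand[symmetric]) simp
  qed
qed

lemma has_vector_derivative_compose_derivative:
  assumes "(u has_vector_derivative u') (at t within I)" and "(f has_derivative f') (at (u t))"
  shows "((\<lambda>s. f (u s)) has_vector_derivative f' u') (at t within I)"
  using has_derivative_compose[OF assms(1)[unfolded has_vector_derivative_def] assms(2)]
    linear_scale[OF has_derivative_linear[OF assms(2)]]
  by (simp add: has_vector_derivative_def)

text \<open>The identities for sums and multiples are differentiated in the parameter, and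
  derivatives are unique. Used for the linearity of \<open>dmetric\<close> and \<open>hess\<close>
  in the arguments that are not differentiated.\<close>

lemma linear_family_derivative_linear:
  fixes f :: "'c::euclidean_space \<Rightarrow> 'a::real_vector \<Rightarrow> 'b::real_normed_vector"
  assumes S: "open S" "x \<in> S" and lin: "\<And>y. y \<in> S \<Longrightarrow> linear (f y)"
    and der: "\<And>v. ((\<lambda>y. f y v) has_derivative (\<lambda>a. f' a v)) (at x)"
  shows "linear (f' a)"
proof (rule linearI)
  fix v w
  have "((\<lambda>y. f y (v + w)) has_derivative (\<lambda>a. f' a v + f' a w)) (at x)"
    using has_derivative_add[OF der[of v] der[of w]] S
    by (rule has_derivative_transform_within_open) (simp add: linear_add[OF lin])
  from has_derivative_unique[OF der this] show "f' a (v + w) = f' a v + f' a w"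
    by (rule fun_cong)
next
  fix r v
  have "((\<lambda>y. f y (r *\<^sub>R v)) has_derivative (\<lambda>a. r *\<^sub>R f' a v)) (at x)"
    using has_derivative_scaleR_right[OF der[of v]] S
    by (rule has_derivative_transform_within_open) (simp add: linear_scale[OF lin])
  from has_derivative_unique[OF der this] show "f' a (r *\<^sub>R v) = r *\<^sub>R f' a v"
    by (rule fun_cong)
qed

text \<open>Stated with \<open>nhds t\<close> and an implication instead of
  \<open>at t within I\<close>, so that \<open>t\<close> itself is included and the result fits
  \<open>has_vector_derivative_cong_ev\<close>.\<close>

lemma eventually_nhds_within_preimage:
  assumes "continuous (at t within I) u" "open S" "u t \<in> S"
  shows "\<forall>\<^sub>F s in nhds t. s \<in> I \<longrightarrow> u s \<in> S"
proof -
  have "\<forall>\<^sub>F s in at t within I. u s \<in> S"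
    using assms by (auto simp: continuous_within intro: topological_tendstoD)
  then show ?thesis
    unfolding eventually_at_filter by eventually_elim (use assms(3) in auto)
qed

lemma has_vector_derivative_linear_family_along:
  fixes f :: "'c::euclidean_space \<Rightarrow> 'a::euclidean_space \<Rightarrow> 'b::real_normed_vector"
  assumes S: "open S" "u t \<in> S" and t: "t \<in> I" and lin: "\<And>y. y \<in> S \<Longrightarrow> linear (f y)"
    and der: "\<And>v. ((\<lambda>y. f y v) has_derivative (\<lambda>a. f' a v)) (at (u t))"
    and u: "(u has_vector_derivative u') (at t within I)"
    and V: "(V has_vector_derivative V') (at t within I)"
  shows "((\<lambda>s. f (u s) (V s)) has_vector_derivative f' u' (V t) + f (u t) V') (at t within I)"
proof (rule has_vector_derivative_linear_family[OF _ _ t _ V])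
  have "\<forall>\<^sub>F s in nhds t. s \<in> I \<longrightarrow> u s \<in> S"
    using S has_vector_derivative_continuous[OF u] by (intro eventually_nhds_within_preimage)
  then show "\<forall>\<^sub>F s in nhds t. s \<in> I \<longrightarrow> linear (f (u s))"
    by eventually_elim (use lin in blast)
  show "linear (f' u')"
    using S lin der by (rule linear_family_derivative_linear)
  show "((\<lambda>s. f (u s) b) has_vector_derivative f' u' b) (at t within I)" for b
    by (rule has_vector_derivative_compose_derivative[OF u der])
qed

lemma continuous_on_linear_family:
  fixes f :: "'c::topological_space \<Rightarrow> 'a::euclidean_space \<Rightarrow> 'b::real_normed_vector"
  assumes "\<And>s. s \<in> I \<Longrightarrow> linear (f s)"
    and "\<And>b. b \<in> Basis \<Longrightarrow> continuous_on I (\<lambda>s. f s b)"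
    and "continuous_on I V"
  shows "continuous_on I (\<lambda>s. f s (V s))"
proof -
  have "continuous_on I (\<lambda>s. \<Sum>b\<in>Basis. (V s \<bullet> b) *\<^sub>R f s b)"
    by (intro continuous_intros assms)
  then show ?thesis
    using assms(1) by (simp add: linear_expand[symmetric] cong: continuous_on_cong_simp)
qed

lemma Ck_on_derivD:
  fixes f :: "'a::euclidean_space \<Rightarrow> 'b::real_normed_vector"
  assumes "Ck_on (Suc k) f S" "open S" "x \<in> S"
  shows "(f has_derivative frechet_derivative f (at x)) (at x)"
  using assms by (metis Ck_on.simps(2) differentiable_on_def at_within_open frechet_derivative_works)

lemma Ck_on_imp_continuous:
  "Ck_on k f S \<Longrightarrow> continuous_on S f"
  by (cases k) (auto intro: differentiable_imp_continuous_on)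

text \<open>The sum of the norms of the partial derivatives is bounded on the compact ball and
  dominates the operator norm; the ball is convex, so the mean value inequality applies.\<close>

lemma C1_lipschitz_on_cball:
  fixes f :: "'a::euclidean_space \<Rightarrow> 'b::real_normed_vector"
  assumes f: "Ck_on 1 f S" and S: "open S" "cball u r \<subseteq> S"
  shows "\<exists>L\<ge>0. \<forall>x\<in>cball u r. \<forall>y\<in>cball u r. norm (f x - f y) \<le> L * norm (x - y)"
proof -
  let ?D = "\<lambda>x. frechet_derivative f (at x)"
  have der: "(f has_derivative ?D x) (at x)" if "x \<in> S" for x
    using Ck_on_derivD[of 0 f S x] f S that by simp
  have "continuous_on (cball u r) (\<lambda>x. \<Sum>b\<in>Basis. norm (?D x b))"
    using f S by (intro continuous_intros) (auto intro: continuous_on_subset)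
  then have "bounded ((\<lambda>x. \<Sum>b\<in>Basis. norm (?D x b)) ` cball u r)"
    by (intro compact_imp_bounded compact_continuous_image) auto
  then obtain L where L: "L > 0" "\<And>x. x \<in> cball u r \<Longrightarrow> (\<Sum>b\<in>Basis. norm (?D x b)) \<le> L"
    unfolding bounded_pos by (auto simp: abs_le_iff)
  have onorm: "onorm (?D x) \<le> L" if "x \<in> cball u r" for x
  proof (rule onorm_le)
    fix v
    have "norm (?D x v) = norm (\<Sum>b\<in>Basis. (v \<bullet> b) *\<^sub>R ?D x b)"
      using der[of x] that S(2)
      by (intro arg_cong[where f = norm] linear_expand has_derivative_linear[OF der]) auto
    also have "\<dots> \<le> (\<Sum>b\<in>Basis. norm v * norm (?D x b))"
      by (intro order_trans[OF norm_sum] sum_mono) (simp add: Basis_le_norm mult_right_mono)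
    also have "\<dots> \<le> L * norm v"
      using mult_left_mono[OF L(2)[OF that] norm_ge_zero[of v]]
      by (simp add: sum_distrib_left[symmetric] mult.commute)
    finally show "norm (?D x v) \<le> L * norm v" .
  qed
  have "norm (f x - f y) \<le> L * norm (x - y)" if "x \<in> cball u r" "y \<in> cball u r" for x y
  proof (rule differentiable_bound[of "cball u r" f ?D])
    show "(f has_derivative ?D x) (at x within cball u r)" if "x \<in> cball u r" for x
      using that S(2) by (intro has_derivative_at_withinI[OF der]) auto
  qed (use that onorm in auto)
  with L(1) show ?thesis
    by (intro exI[of _ L] conjI ballI) (auto intro: less_imp_le)
qed

lemma finite_family_bound:
  fixes f :: "'i \<Rightarrow> 'a::euclidean_space \<Rightarrow> real"
  assumes A: "finite A" and f: "\<And>i. i \<in> A \<Longrightarrow> Ck_on 1 (f i) S" and S: "open S" "cball u r \<subseteq> S"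
  shows "\<exists>K\<ge>0. \<forall>i\<in>A. \<forall>x\<in>cball u r. \<bar>f i x\<bar> \<le> K \<and> (\<forall>y\<in>cball u r. \<bar>f i x - f i y\<bar> \<le> K * norm (x - y))"
proof -
  let ?B = "cball u r"
  have "\<exists>K\<ge>0. \<forall>x\<in>?B. \<bar>f i x\<bar> \<le> K \<and> (\<forall>y\<in>?B. \<bar>f i x - f i y\<bar> \<le> K * norm (x - y))" if i: "i \<in> A" for i
  proof -
    obtain L where L: "L \<ge> 0" "\<And>x y. x \<in> ?B \<Longrightarrow> y \<in> ?B \<Longrightarrow> \<bar>f i x - f i y\<bar> \<le> L * norm (x - y)"
      using C1_lipschitz_on_cball[OF f[OF i] S] by auto
    have "bounded (f i ` ?B)"
      using continuous_on_subset[OF Ck_on_imp_continuous[OF f[OF i]] S(2)]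
      by (intro compact_imp_bounded compact_continuous_image) auto
    then obtain K where K: "K > 0" "\<And>x. x \<in> ?B \<Longrightarrow> \<bar>f i x\<bar> \<le> K"
      unfolding bounded_pos by auto
    have "\<bar>f i x\<bar> \<le> K + L \<and> (\<forall>y\<in>?B. \<bar>f i x - f i y\<bar> \<le> (K + L) * norm (x - y))" if x: "x \<in> ?B" for x
    proof (intro conjI ballI)
      show "\<bar>f i x\<bar> \<le> K + L"
        using K(2)[OF x] L(1) by linarith
      fix y assume y: "y \<in> ?B"
      show "\<bar>f i x - f i y\<bar> \<le> (K + L) * norm (x - y)"
        using L(2)[OF x y] mult_nonneg_nonneg[OF less_imp_le[OF K(1)] norm_ge_zero[of "x - y"]]
        by (simp add: distrib_right)
    qed
    then show ?thesis
      using K(1) L(1) by (intro exI[of _ "K + L"]) auto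
  qed
  then obtain K where K: "\<And>i. i \<in> A \<Longrightarrow> K i \<ge> 0"
    "\<And>i x. i \<in> A \<Longrightarrow> x \<in> ?B \<Longrightarrow> \<bar>f i x\<bar> \<le> K i \<and> (\<forall>y\<in>?B. \<bar>f i x - f i y\<bar> \<le> K i * norm (x - y))"
    by metis
  have le: "K i \<le> sum K A" if "i \<in> A" for i
    using member_le_sum[OF that _ A, of K] K(1) by auto
  show ?thesis
  proof (intro exI[of _ "sum K A"] conjI ballI)
    show "sum K A \<ge> 0"
      using K(1) by (intro sum_nonneg) auto
    fix i x assume i: "i \<in> A" and x: "x \<in> ?B"
    show "\<bar>f i x\<bar> \<le> sum K A"
      using K(2)[OF i x] le[OF i] by linarith
    fix y assume "y \<in> ?B"
    then show "\<bar>f i x - f i y\<bar> \<le> sum K A * norm (x - y)"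
      using K(2)[OF i x] mult_right_mono[OF le[OF i] norm_ge_zero[of "x - y"]] by fastforce
  qed
qed

lemma at_within_unit_interval: "t \<in> {0..1::real} \<Longrightarrow> at t within {0..1} \<noteq> bot"
  using connected_imp_perfect[of "{0..1::real}" t]
  by (auto simp: trivial_limit_within)

text \<open>By connectedness. Letting \<open>P\<close> pass between any two parameters near
  \<open>t\<close> makes the set where it holds both open and closed, so no separate limit argument
  is needed.\<close>

lemma unit_interval_induction:
  assumes "P a" and ab: "a \<in> {0..1}" "b \<in> {0..1::real}"
    and step: "\<And>t. t \<in> {0..1} \<Longrightarrow>
      \<exists>\<epsilon>>0. \<forall>x\<in>{0..1} \<inter> ball t \<epsilon>. \<forall>y\<in>{0..1} \<inter> ball t \<epsilon>. P x \<longrightarrow> P y"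
  shows "P b"
proof (rule connected_induction_simple[of "{0..1}" a b P])
  fix t :: real assume t: "t \<in> {0..1}"
  obtain \<epsilon> where \<epsilon>: "\<epsilon> > 0" "\<forall>x\<in>{0..1} \<inter> ball t \<epsilon>. \<forall>y\<in>{0..1} \<inter> ball t \<epsilon>. P x \<longrightarrow> P y"
    using step[OF t] by blast
  have "openin (top_of_set {0..1}) ({0..1} \<inter> ball t \<epsilon>)" "t \<in> {0..1} \<inter> ball t \<epsilon>"
    using t \<epsilon>(1) by (simp_all add: openin_open_Int)
  with \<epsilon>(2) show "\<exists>T. openin (top_of_set {0..1}) T \<and> t \<in> T \<and> (\<forall>x\<in>T. \<forall>y\<in>T. P x \<longrightarrow> P y)"
    by blast
qed (use assms in simp_all)

lemma convex_Un_real: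
  fixes A B :: "real set"
  assumes "convex A" "convex B" "t \<in> A" "t \<in> B"
  shows "convex (A \<union> B)"
  using assms by (auto simp: is_interval_convex_1[symmetric] is_interval_connected_1 intro!: connected_Un)

subsection \<open>Symmetry of second derivatives\<close>

text \<open>The mean value theorem is applied twice to the mixed second difference, along
  \<open>a\<close> and then along \<open>b\<close>, which leaves \<open>f''\<close> at a nearby
  point. The difference itself is symmetric in \<open>a\<close> and \<open>b\<close>; this is the
  point of the lemma.\<close>

lemma second_difference_quotient:
  fixes f :: "'a::real_normed_vector \<Rightarrow> real"
  assumes S: "open S" "u \<in> S"
    and f: "\<And>x. x \<in> S \<Longrightarrow> (f has_derivative f' x) (at x)"
    and f': "\<And>x. x \<in> S \<Longrightarrow> ((\<lambda>x. f' x a) has_derivative f'' x) (at x)"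
    and cont: "continuous_on S (\<lambda>x. f'' x b)"
  shows "((\<lambda>h. (f (u + h *\<^sub>R a + h *\<^sub>R b) - f (u + h *\<^sub>R a) - f (u + h *\<^sub>R b) + f u) / h\<^sup>2)
    \<longlongrightarrow> f'' u b) (at_right 0)"
proof (rule tendstoI)
  fix e :: real assume "e > 0"
  have "isCont (\<lambda>x. f'' x b) u"
    using cont S by (simp add: continuous_on_eq_continuous_at)
  then have "\<forall>\<^sub>F x in nhds u. dist (f'' x b) (f'' u b) < e"
    using \<open>e > 0\<close> by (simp add: isCont_def tendsto_iff eventually_at_filter eventually_mono)
      (auto simp: eventually_at_filter elim!: eventually_mono)
  moreover have "\<forall>\<^sub>F x in nhds u. x \<in> S"
    using S by (simp add: eventually_nhds_in_open)
  ultimately have "\<forall>\<^sub>F x in nhds u. x \<in> S \<and> dist (f'' x b) (f'' u b) < e"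
    by eventually_elim simp
  then obtain d where d: "d > 0" "\<And>x. dist x u < d \<Longrightarrow> x \<in> S \<and> dist (f'' x b) (f'' u b) < e"
    by (auto simp: eventually_nhds_metric)
  let ?q = "\<lambda>h. f (u + h *\<^sub>R a + h *\<^sub>R b) - f (u + h *\<^sub>R a) - f (u + h *\<^sub>R b) + f u"
  have *: "dist (?q h / h\<^sup>2) (f'' u b) < e" if h: "h > 0" "h * (norm a + norm b) < d" for h
  proof -
    \<comment> \<open>Keeps the parallelogram spanned by \<open>h *\<^sub>R a\<close> and
      \<open>h *\<^sub>R b\<close> inside the ball where \<open>f''\<close> in direction
      \<open>b\<close> varies by less than \<open>e\<close>.\<close>
    have near: "dist (u + s *\<^sub>R a + t *\<^sub>R b) u < d" if "0 \<le> s" "s \<le> h" "0 \<le> t" "t \<le> h" for s t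
    proof -
      have "norm (s *\<^sub>R a + t *\<^sub>R b) \<le> s * norm a + t * norm b"
        using that norm_triangle_ineq[of "s *\<^sub>R a" "t *\<^sub>R b"] by simp
      also have "\<dots> \<le> h * (norm a + norm b)"
        using that by (simp add: distrib_left add_mono mult_right_mono)
      finally show ?thesis
        using h by (simp add: dist_norm add.assoc)
    qed
    have "\<exists>s\<in>{0<..<h}. (f (u + h *\<^sub>R a + h *\<^sub>R b) - f (u + h *\<^sub>R a)) - (f (u + 0 *\<^sub>R a + h *\<^sub>R b) - f (u + 0 *\<^sub>R a))
      = (h - 0) * (f' (u + s *\<^sub>R a + h *\<^sub>R b) a - f' (u + s *\<^sub>R a) a)"
    proof -
      have "((\<lambda>s. f (u + s *\<^sub>R a + h *\<^sub>R b) - f (u + s *\<^sub>R a)) has_derivative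
          (\<lambda>k. k * (f' (u + s *\<^sub>R a + h *\<^sub>R b) a - f' (u + s *\<^sub>R a) a))) (at s within {0..h})"
        if "0 \<le> s" "s \<le> h" for s
      proof -
        have 1: "u + s *\<^sub>R a + h *\<^sub>R b \<in> S" "u + s *\<^sub>R a \<in> S"
          using d(2)[OF near[of s h]] d(2)[OF near[of s 0]] that h by auto
        have lin: "linear (f' (u + s *\<^sub>R a + h *\<^sub>R b))" "linear (f' (u + s *\<^sub>R a))"
          using f[OF 1(1)] f[OF 1(2)] by (auto intro: has_derivative_linear)
        have "((\<lambda>s. f (u + s *\<^sub>R a + h *\<^sub>R b)) has_derivative
          (\<lambda>k. f' (u + s *\<^sub>R a + h *\<^sub>R b) (k *\<^sub>R a))) (at s within {0..h})"
          by (rule has_derivative_compose[where f = "\<lambda>s. u + s *\<^sub>R a + h *\<^sub>R b", OF _ f[OF 1(1)]])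
            (auto intro!: derivative_eq_intros)
        moreover have "((\<lambda>s. f (u + s *\<^sub>R a)) has_derivative
          (\<lambda>k. f' (u + s *\<^sub>R a) (k *\<^sub>R a))) (at s within {0..h})"
          by (rule has_derivative_compose[where f = "\<lambda>s. u + s *\<^sub>R a", OF _ f[OF 1(2)]])
            (auto intro!: derivative_eq_intros)
        ultimately show ?thesis
          using lin by (auto intro!: derivative_eq_intros simp: linear_scale algebra_simps)
      qed
      from mvt_simple[OF h(1) this] show ?thesis by auto
    qed
    then obtain s where s: "0 < s" "s < h"
      and qs: "?q h = h * (f' (u + s *\<^sub>R a + h *\<^sub>R b) a - f' (u + s *\<^sub>R a) a)"
      by auto
    have "\<exists>t\<in>{0<..<h}. f' (u + s *\<^sub>R a + h *\<^sub>R b) a - f' (u + s *\<^sub>R a + 0 *\<^sub>R b) a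
        = (h - 0) * f'' (u + s *\<^sub>R a + t *\<^sub>R b) b"
    proof (rule mvt_simple[OF h(1)])
      fix t assume "0 \<le> t" "t \<le> h"
      then have 1: "u + s *\<^sub>R a + t *\<^sub>R b \<in> S"
        using d(2)[OF near[of s t]] s by auto
      have "((\<lambda>t. f' (u + s *\<^sub>R a + t *\<^sub>R b) a) has_derivative
          (\<lambda>k. f'' (u + s *\<^sub>R a + t *\<^sub>R b) (k *\<^sub>R b))) (at t within {0..h})"
        by (rule has_derivative_compose[where f = "\<lambda>t. u + s *\<^sub>R a + t *\<^sub>R b", OF _ f'[OF 1]])
          (auto intro!: derivative_eq_intros)
      moreover have "linear (f'' (u + s *\<^sub>R a + t *\<^sub>R b))"
        using f'[OF 1] by (rule has_derivative_linear)
      ultimately show "((\<lambda>t. f' (u + s *\<^sub>R a + t *\<^sub>R b) a) has_derivative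
          (\<lambda>k. k * f'' (u + s *\<^sub>R a + t *\<^sub>R b) b)) (at t within {0..h})"
        by (simp add: linear_scale)
    qed
    then obtain t where t: "0 < t" "t < h"
      and "f' (u + s *\<^sub>R a + h *\<^sub>R b) a - f' (u + s *\<^sub>R a) a = h * f'' (u + s *\<^sub>R a + t *\<^sub>R b) b"
      by auto
    with qs h have "?q h / h\<^sup>2 = f'' (u + s *\<^sub>R a + t *\<^sub>R b) b"
      by (simp add: power2_eq_square)
    moreover have "dist (f'' (u + s *\<^sub>R a + t *\<^sub>R b) b) (f'' u b) < e"
      using d(2)[OF near[of s t]] s t by auto
    ultimately show ?thesis by simp
  qed
  have "((\<lambda>h. h * (norm a + norm b)) \<longlongrightarrow> 0 * (norm a + norm b)) (at_right 0)"
    by (intro tendsto_intros)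
  then have "\<forall>\<^sub>F h in at_right 0. h * (norm a + norm b) < d"
    using d(1) order_tendstoD(2) by fastforce
  then show "\<forall>\<^sub>F h in at_right 0. dist (?q h / h\<^sup>2) (f'' u b) < e"
    using eventually_at_right_less[of 0] by eventually_elim (rule *)
qed

text \<open>Both iterated derivatives are limits of one and the same difference quotient. Components
  are taken because the mean value theorem needs real values.\<close>

lemma second_derivative_symmetric:
  fixes f :: "'a::euclidean_space \<Rightarrow> 'b::euclidean_space"
  assumes S: "open S" "u \<in> S" and f: "Ck_on 2 f S"
  shows "frechet_derivative (\<lambda>x. frechet_derivative f (at x) a) (at u) b =
    frechet_derivative (\<lambda>x. frechet_derivative f (at x) b) (at u) a"
proof (rule euclidean_eqI)
  fix k :: 'b assume "k \<in> Basis"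
  let ?D = "\<lambda>x. frechet_derivative f (at x)"
  let ?DD = "\<lambda>a x. frechet_derivative (\<lambda>x. ?D x a) (at x)"
  have C: "Ck_on (Suc 1) f S" "Ck_on (Suc 0) (\<lambda>x. ?D x a) S" for a
    using f by (simp_all add: numeral_2_eq_2)
  have 1: "((\<lambda>x. f x \<bullet> k) has_derivative (\<lambda>v. ?D x v \<bullet> k)) (at x)" if "x \<in> S" for x
    by (rule bounded_linear.has_derivative[OF bounded_linear_inner_left Ck_on_derivD[OF C(1) S(1) that]])
  have 2: "((\<lambda>x. ?D x a \<bullet> k) has_derivative (\<lambda>v. ?DD a x v \<bullet> k)) (at x)" if "x \<in> S" for x a
    by (rule bounded_linear.has_derivative[OF bounded_linear_inner_left Ck_on_derivD[OF C(2) S(1) that]])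
  have 3: "continuous_on S (\<lambda>x. ?DD a x b \<bullet> k)" for a b
    using C(2)[of a] by (intro continuous_intros) simp
  have "?DD a u b \<bullet> k = ?DD b u a \<bullet> k"
  proof (rule tendsto_unique[OF trivial_limit_at_right_real])
    show "((\<lambda>h. (f (u + h *\<^sub>R a + h *\<^sub>R b) \<bullet> k - f (u + h *\<^sub>R a) \<bullet> k - f (u + h *\<^sub>R b) \<bullet> k + f u \<bullet> k) / h\<^sup>2)
      \<longlongrightarrow> ?DD a u b \<bullet> k) (at_right 0)"
      by (rule second_difference_quotient[OF S 1 2 3])
    have "((\<lambda>h. (f (u + h *\<^sub>R b + h *\<^sub>R a) \<bullet> k - f (u + h *\<^sub>R b) \<bullet> k - f (u + h *\<^sub>R a) \<bullet> k + f u \<bullet> k) / h\<^sup>2)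
      \<longlongrightarrow> ?DD b u a \<bullet> k) (at_right 0)"
      by (rule second_difference_quotient[OF S 1 2 3])
    then show "((\<lambda>h. (f (u + h *\<^sub>R a + h *\<^sub>R b) \<bullet> k - f (u + h *\<^sub>R a) \<bullet> k - f (u + h *\<^sub>R b) \<bullet> k + f u \<bullet> k) / h\<^sup>2)
      \<longlongrightarrow> ?DD b u a \<bullet> k) (at_right 0)"
      by (simp add: algebra_simps)
  qed
  then show "?DD a u b \<bullet> k = ?DD b u a \<bullet> k" .
qed

subsection \<open>Ordinary differential equations\<close>

text \<open>Multiplying by \<open>exp (- L * t)\<close> to the right of \<open>t0\<close> and by
  \<open>exp (L * t)\<close> to the left of it gives monotone functions that vanish at
  \<open>t0\<close>.\<close>

lemma gronwall_zero:
  fixes \<phi> :: "real \<Rightarrow> real"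
  assumes J: "convex J" "t0 \<in> J" "t \<in> J"
    and der: "\<And>s. s \<in> J \<Longrightarrow> (\<phi> has_real_derivative \<phi>' s) (at s within J)"
    and bnd: "\<And>s. s \<in> J \<Longrightarrow> \<bar>\<phi>' s\<bar> \<le> L * \<phi> s"
    and nonneg: "\<And>s. s \<in> J \<Longrightarrow> \<phi> s \<ge> 0" and "\<phi> t0 = 0"
  shows "\<phi> t = 0"
proof -
  have mono: "f y \<le> f x" if "x \<le> y" "x \<in> J" "y \<in> J"
    and f: "\<And>s. s \<in> J \<Longrightarrow> (f has_real_derivative f' s) (at s within J)" and f': "\<And>s. s \<in> J \<Longrightarrow> f' s \<le> 0"
    for f f' :: "real \<Rightarrow> real" and x y
  proof (cases "x = y")
    case False
    have sub: "{x..y} \<subseteq> J"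
      using J(1) that by (metis convex_contains_segment closed_segment_eq_real_ivl1)
    have "\<exists>s\<in>{x<..<y}. f y - f x = f' s * (y - x)"
    proof (rule mvt_simple)
      show "(f has_derivative (*) (f' s)) (at s within {x..y})" if "x \<le> s" "s \<le> y" for s
        using f[of s, unfolded has_field_derivative_def] sub that
        by (intro has_derivative_subset[where s = J and t = "{x..y}"]) auto
    qed (use False that in auto)
    then obtain s where "s \<in> {x<..<y}" "f y - f x = f' s * (y - x)" by blast
    moreover have "f' s \<le> 0"
      using \<open>s \<in> _\<close> sub by (intro f') auto
    ultimately show ?thesis
      using mult_nonpos_nonneg[of "f' s" "y - x"] that by simp
  qed simp
  have "\<phi> t \<le> 0"
  proof (cases "t0 \<le> t")
    case True
    have "exp (- L * t) * \<phi> t \<le> exp (- L * t0) * \<phi> t0"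
    proof (rule mono[OF True J(2,3)])
      fix s assume s: "s \<in> J"
      show "((\<lambda>s. exp (- L * s) * \<phi> s) has_real_derivative exp (- L * s) * (\<phi>' s - L * \<phi> s)) (at s within J)"
        by (rule derivative_eq_intros der[OF s] refl | simp add: algebra_simps)+
      show "exp (- L * s) * (\<phi>' s - L * \<phi> s) \<le> 0"
        using bnd[OF s] by (intro mult_nonneg_nonpos) auto
    qed
    then show ?thesis
      using \<open>\<phi> t0 = 0\<close> by (simp add: mult_le_0_iff not_le[symmetric])
  next
    case False
    then have le: "t \<le> t0" by simp
    have "- (exp (L * t0) * \<phi> t0) \<le> - (exp (L * t) * \<phi> t)"
    proof (rule mono[OF le J(3,2)])
      fix s assume s: "s \<in> J"
      show "((\<lambda>s. - (exp (L * s) * \<phi> s)) has_real_derivative - (exp (L * s) * (\<phi>' s + L * \<phi> s))) (at s within J)"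
        by (rule derivative_eq_intros der[OF s] refl | simp add: algebra_simps)+
      have "\<phi>' s + L * \<phi> s \<ge> 0"
        using bnd[OF s] by linarith
      then show "- (exp (L * s) * (\<phi>' s + L * \<phi> s)) \<le> 0"
        by simp
    qed
    then show ?thesis
      using \<open>\<phi> t0 = 0\<close> by (simp add: mult_le_0_iff not_le[symmetric])
  qed
  then show ?thesis
    using nonneg[OF J(3)] by simp
qed

text \<open>Picard iteration: the integral operator contracts with constant
  \<open>K * (b - a)\<close>, hence the short interval. Longer solutions are obtained by
  gluing.\<close>

lemma linear_ode_solution:
  fixes A :: "real \<Rightarrow> 'a::euclidean_space \<Rightarrow> 'a"
  assumes ab: "a \<le> b" and t0: "t0 \<in> {a..b}"
    and lin: "\<And>t. t \<in> {a..b} \<Longrightarrow> linear (A t)"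
    and bnd: "\<And>t v. t \<in> {a..b} \<Longrightarrow> norm (A t v) \<le> K * norm v"
    and cont: "\<And>v. continuous_on {a..b} (\<lambda>t. A t v)"
    and small: "K \<ge> 0" "K * (b - a) < 1"
  shows "\<exists>V. V t0 = v \<and> (\<forall>t\<in>{a..b}. (V has_vector_derivative A t (V t)) (at t within {a..b}))"
proof -
  \<comment> \<open>A difference of integrals from \<open>a\<close>, so that the initial time
    \<open>t0\<close> may lie anywhere in the interval.\<close>
  define \<Phi> where "\<Phi> \<phi> t = v + (integral {a..t} (\<lambda>s. A s (\<phi> s)) - integral {a..t0} (\<lambda>s. A s (\<phi> s)))"
    for \<phi> t
  \<comment> \<open>Clamping the argument extends functions on \<open>{a..b}\<close> to the line, so
    that the fixed point can be sought in the complete space of bounded continuous functions on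
    \<open>real\<close>.\<close>
  define cl where "cl t = max a (min b t)" for t :: real
  have cl: "cl t \<in> {a..b}" "t \<in> {a..b} \<Longrightarrow> cl t = t" for t
    using ab by (auto simp: cl_def)
  have contA: "continuous_on {a..b} (\<lambda>s. A s (\<phi> s))" if "continuous_on {a..b} \<phi>" for \<phi>
    by (rule continuous_on_linear_family[OF lin cont that])
  have der: "(\<Phi> \<phi> has_vector_derivative A t (\<phi> t)) (at t within {a..b})"
    if "continuous_on {a..b} \<phi>" "t \<in> {a..b}" for \<phi> t
    using has_vector_derivative_add[OF has_vector_derivative_const
        has_vector_derivative_diff[OF integral_has_vector_derivative[OF contA[OF that(1)] that(2)]
          has_vector_derivative_const]]
    by (simp add: \<Phi>_def[abs_def])
  have \<Phi>t0: "\<Phi> \<phi> t0 = v" for \<phi>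
    by (simp add: \<Phi>_def)
  have contcl: "continuous_on UNIV (\<lambda>t. \<Phi> \<phi> (cl t))" if "continuous_on {a..b} \<phi>" for \<phi>
  proof (rule continuous_on_compose2[of "{a..b}" "\<Phi> \<phi>"])
    show "continuous_on {a..b} (\<Phi> \<phi>)"
      using has_vector_derivative_continuous[OF der[OF that]] by (simp add: continuous_on_eq_continuous_within)
    show "continuous_on UNIV cl"
      unfolding cl_def by (intro continuous_intros)
  qed (use cl in auto)
  have bc: "(\<lambda>t. \<Phi> \<phi> (cl t)) \<in> bcontfun" if "continuous_on {a..b} \<phi>" for \<phi>
  proof -
    have "bounded ((\<lambda>t. \<Phi> \<phi> (cl t)) ` {a..b})"
      by (intro compact_imp_bounded compact_continuous_image continuous_on_subset[OF contcl[OF that]]) auto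
    moreover have "range (\<lambda>t. \<Phi> \<phi> (cl t)) \<subseteq> (\<lambda>t. \<Phi> \<phi> (cl t)) ` {a..b}"
    proof clarify
      fix t
      have "\<Phi> \<phi> (cl t) = \<Phi> \<phi> (cl (cl t))"
        using cl by simp
      then show "\<Phi> \<phi> (cl t) \<in> (\<lambda>t. \<Phi> \<phi> (cl t)) ` {a..b}"
        using cl(1) by blast
    qed
    ultimately show ?thesis
      using contcl[OF that] by (auto simp: bcontfun_def intro: bounded_subset)
  qed
  define T :: "(real \<Rightarrow>\<^sub>C 'a) \<Rightarrow> (real \<Rightarrow>\<^sub>C 'a)" where "T \<phi> = Bcontfun (\<lambda>t. \<Phi> (apply_bcontfun \<phi>) (cl t))" for \<phi>
  have T: "apply_bcontfun (T \<phi>) t = \<Phi> \<phi> (cl t)" for \<phi> t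
    by (simp add: T_def Bcontfun_inverse bc)
  have lip: "dist (T \<phi>) (T \<psi>) \<le> (K * (b - a)) * dist \<phi> \<psi>" for \<phi> \<psi>
  proof (rule dist_bound)
    fix t
    let ?d = "\<lambda>s. \<Phi> \<phi> s - \<Phi> \<psi> s"
    \<comment> \<open>The two images agree at \<open>t0\<close>, so the mean value inequality for
      their difference yields the contraction constant.\<close>
    have "norm (?d (cl t) - ?d t0) \<le> (K * dist \<phi> \<psi>) * norm (cl t - t0)"
    proof (rule differentiable_bound[where S = "{a..b}" and f' = "\<lambda>s h. h *\<^sub>R (A s (\<phi> s) - A s (\<psi> s))"])
      fix s assume s: "s \<in> {a..b}"
      have "(?d has_vector_derivative A s (\<phi> s) - A s (\<psi> s)) (at s within {a..b})"
        by (intro has_vector_derivative_diff der s) auto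
      then show "(?d has_derivative (\<lambda>h. h *\<^sub>R (A s (\<phi> s) - A s (\<psi> s)))) (at s within {a..b})"
        by (simp add: has_vector_derivative_def)
      have "norm (A s (\<phi> s) - A s (\<psi> s)) = norm (A s (\<phi> s - \<psi> s))"
        using lin[OF s] by (simp add: linear_diff)
      also have "\<dots> \<le> K * dist \<phi> \<psi>"
        using bnd[OF s, of "\<phi> s - \<psi> s"] dist_bounded[of \<phi> s \<psi>] small(1)
        by (smt (verit) dist_norm mult_left_mono)
      finally show "onorm (\<lambda>h. h *\<^sub>R (A s (\<phi> s) - A s (\<psi> s))) \<le> K * dist \<phi> \<psi>"
        by (intro onorm_le) (simp add: mult.commute mult_left_mono)
    qed (use cl t0 in auto)
    moreover have "norm (cl t - t0) \<le> b - a"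
      using cl(1)[of t] t0 by (simp add: abs_le_iff)
    then have "(K * dist \<phi> \<psi>) * norm (cl t - t0) \<le> (K * dist \<phi> \<psi>) * (b - a)"
      using small(1) by (intro mult_left_mono) auto
    ultimately have "norm (?d (cl t)) \<le> (K * dist \<phi> \<psi>) * (b - a)"
      unfolding \<Phi>t0 by (simp only: diff_self diff_0_right)
    then show "dist (apply_bcontfun (T \<phi>) t) (apply_bcontfun (T \<psi>) t) \<le> (K * (b - a)) * dist \<phi> \<psi>"
      by (simp add: T dist_norm mult_ac)
  qed
  obtain \<phi> where \<phi>: "T \<phi> = \<phi>"
    using ex1_implies_ex[OF banach_fix_type[of "K * (b - a)" T]] small ab lip
    by (metis diff_ge_0_iff_ge mult_nonneg_nonneg)
  have eq: "apply_bcontfun \<phi> t = \<Phi> \<phi> t" if "t \<in> {a..b}" for t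
    using T[of \<phi> t] cl(2)[OF that] \<phi> by simp
  show ?thesis
  proof (intro exI conjI ballI)
    show "apply_bcontfun \<phi> t0 = v"
      using eq[OF t0] \<Phi>t0 by simp
    fix t assume t: "t \<in> {a..b}"
    show "(apply_bcontfun \<phi> has_vector_derivative A t (apply_bcontfun \<phi> t)) (at t within {a..b})"
      by (rule has_vector_derivative_transform[OF t eq der[OF _ t]]) auto
  qed
qed

section \<open>Charts\<close>

abbreviation (input) img :: "('m, 'e) chart \<Rightarrow> 'e set" where
  "img c \<equiv> cmap c ` cdom c"

locale riemannian_mfd =
  fixes N :: "('m::{t2_space, second_countable_topology}, 'e::euclidean_space) riemannian"
  assumes manifold: "riemannian_manifold N"
begin

lemma chart_at_atlas [simp]: "chart_at N p \<in> atlas N" "p \<in> cdom (chart_at N p)"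
  using manifold by (auto simp: riemannian_manifold_def)

context
  fixes c
  assumes c: "c \<in> atlas N"
begin

lemma chart_homeomorphism:
  "open (cdom c)" "open (img c)" "homeomorphism (cdom c) (img c) (cmap c) (cinv c)"
  using manifold c by (auto simp: riemannian_manifold_def smooth_atlas_def)

lemma cinv_cmap: "p \<in> cdom c \<Longrightarrow> cinv c (cmap c p) = p"
  using chart_homeomorphism(3) by (rule homeomorphism_apply1)

lemma cmap_cinv: "u \<in> img c \<Longrightarrow> cmap c (cinv c u) = u"
  using chart_homeomorphism(3) by (rule homeomorphism_apply2)

lemma cinv_in: "u \<in> img c \<Longrightarrow> cinv c u \<in> cdom c"
  using homeomorphism_image2[OF chart_homeomorphism(3)] by blast

lemma continuous_on_cmap: "continuous_on (cdom c) (cmap c)"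
  and continuous_on_cinv: "continuous_on (img c) (cinv c)"
  using chart_homeomorphism(3) by (auto simp: homeomorphism_def)

lemma open_chart_image:
  assumes "open U"
  shows "open (cmap c ` (cdom c \<inter> U))"
proof -
  have "cmap c ` (cdom c \<inter> U) = img c \<inter> cinv c -` U"
    using cinv_cmap cmap_cinv cinv_in by (force simp: image_iff)
  then show ?thesis
    using continuous_open_preimage[OF continuous_on_cinv chart_homeomorphism(2) assms] by simp
qed

end

lemma transition_smooth:
  assumes "c \<in> atlas N" "d \<in> atlas N"
  shows "Ck_on k (cmap d \<circ> cinv c) (cmap c ` (cdom c \<inter> cdom d))"
  using manifold assms by (auto simp: riemannian_manifold_def smooth_atlas_def smooth_on_def)

lemma open_overlap: "c \<in> atlas N \<Longrightarrow> d \<in> atlas N \<Longrightarrow> open (cmap c ` (cdom c \<inter> cdom d))"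
  by (intro open_chart_image chart_homeomorphism)

lemma transition_derivative:
  assumes "c \<in> atlas N" "d \<in> atlas N" "p \<in> cdom c" "p \<in> cdom d"
  shows "((cmap d \<circ> cinv c) has_derivative coord_change c d p) (at (cmap c p))"
  unfolding coord_change_def
  using Ck_on_derivD[OF transition_smooth[OF assms(1,2), of "Suc 0"] open_overlap[OF assms(1,2)]] assms
  by blast

lemma coord_change_linear:
  "c \<in> atlas N \<Longrightarrow> d \<in> atlas N \<Longrightarrow> p \<in> cdom c \<Longrightarrow> p \<in> cdom d \<Longrightarrow> linear (coord_change c d p)"
  using transition_derivative by (rule has_derivative_linear)

text \<open>Chain rule; the composition coincides with the transition map from \<open>c\<close> to
  \<open>e\<close> only near the point, on an open overlap.\<close>

lemma coord_change_cocycle: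
  assumes "c \<in> atlas N" "d \<in> atlas N" "e \<in> atlas N" "p \<in> cdom c" "p \<in> cdom d" "p \<in> cdom e"
  shows "coord_change d e p (coord_change c d p v) = coord_change c e p v"
proof -
  have "((cmap e \<circ> cinv d) \<circ> (cmap d \<circ> cinv c) has_derivative coord_change d e p \<circ> coord_change c d p)
      (at (cmap c p))"
    using transition_derivative[of d e p] assms
    by (intro diff_chain_at transition_derivative) (simp_all add: cinv_cmap)
  then have "(cmap e \<circ> cinv c has_derivative coord_change d e p \<circ> coord_change c d p) (at (cmap c p))"
  proof (rule has_derivative_transform_within_open)
    show "open (cmap c ` (cdom c \<inter> cdom d))"
      using assms by (intro open_overlap)
  qed (use assms in \<open>auto simp: cinv_cmap\<close>)
  from has_derivative_unique[OF transition_derivative this, OF assms(1,3,4,6)] show ?thesis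
    by (simp add: fun_eq_iff)
qed

lemma coord_change_self:
  assumes "c \<in> atlas N" "p \<in> cdom c"
  shows "coord_change c c p v = v"
proof -
  have "((\<lambda>u. u) has_derivative (\<lambda>v. v)) (at (cmap c p))"
    by (rule has_derivative_ident)
  then have "(cmap c \<circ> cinv c has_derivative (\<lambda>v. v)) (at (cmap c p))"
    by (rule has_derivative_transform_within_open[OF _ chart_homeomorphism(2)[OF assms(1)]])
      (use assms in \<open>auto simp: cmap_cinv\<close>)
  from has_derivative_unique[OF transition_derivative this, OF assms(1,1,2,2)] show ?thesis
    by simp
qed

context
  fixes c p
  assumes c: "c \<in> atlas N" and p: "p \<in> cdom c"
begin

lemma in_chart_linear: "linear (in_chart N c p)"
  unfolding in_chart_def using c p by (intro coord_change_linear) auto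

lemma from_chart_linear: "linear (from_chart N c p)"
  unfolding from_chart_def using c p by (intro coord_change_linear) auto

lemma in_from_chart: "in_chart N c p (from_chart N c p v) = v"
  unfolding in_chart_def from_chart_def using c p by (simp add: coord_change_cocycle coord_change_self)

lemma from_in_chart: "from_chart N c p (in_chart N c p v) = v"
  unfolding in_chart_def from_chart_def using c p by (simp add: coord_change_cocycle coord_change_self)

lemma in_chart_change: "d \<in> atlas N \<Longrightarrow> p \<in> cdom d \<Longrightarrow> coord_change c d p (in_chart N c p v) = in_chart N d p v"
  unfolding in_chart_def using c p by (simp add: coord_change_cocycle)

lemma from_chart_change:
  "d \<in> atlas N \<Longrightarrow> p \<in> cdom d \<Longrightarrow> from_chart N d p (coord_change c d p v) = from_chart N c p v"
  unfolding from_chart_def using c p by (simp add: coord_change_cocycle)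

lemma coord_change_inverse:
  "d \<in> atlas N \<Longrightarrow> p \<in> cdom d \<Longrightarrow> coord_change c d p (coord_change d c p v) = v"
  using c p by (simp add: coord_change_cocycle coord_change_self)

end

lemma in_chart_at: "in_chart N (chart_at N p) p v = v"
  unfolding in_chart_def by (simp add: coord_change_self)

section \<open>Metric and Levi-Civita connection\<close>

lemma inner_form_metric: "inner_form (metric N p)"
  using manifold by (auto simp: riemannian_manifold_def inner_form_def)

lemma metric_in_cmap:
  "c \<in> atlas N \<Longrightarrow> p \<in> cdom c \<Longrightarrow>
    metric_in N c (cmap c p) a b = metric N p (from_chart N c p a) (from_chart N c p b)"
  by (simp add: metric_in_def cinv_cmap Let_def)

lemma metric_conv_chart:
  "c \<in> atlas N \<Longrightarrow> p \<in> cdom c \<Longrightarrow>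
    metric N p v w = metric_in N c (cmap c p) (in_chart N c p v) (in_chart N c p w)"
  by (simp add: metric_in_cmap from_in_chart)

lemma metric_in_change:
  "c \<in> atlas N \<Longrightarrow> d \<in> atlas N \<Longrightarrow> p \<in> cdom c \<Longrightarrow> p \<in> cdom d \<Longrightarrow>
    metric_in N d (cmap d p) (coord_change c d p a) (coord_change c d p b) = metric_in N c (cmap c p) a b"
  by (simp add: metric_in_cmap from_chart_change)

lemma inner_form_metric_in:
  assumes c: "c \<in> atlas N" and u: "u \<in> img c"
  shows "inner_form (metric_in N c u)"
proof -
  define p where "p = cinv c u"
  have p: "p \<in> cdom c" "u = cmap c p"
    using c u by (auto simp: p_def cinv_in cmap_cinv)
  note lin = from_chart_linear[OF c p(1)]
  have inj: "a = 0" if "from_chart N c p a = 0" for a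
    using in_from_chart[OF c p(1), of a] that linear_0[OF in_chart_linear[OF c p(1)]] by simp
  have "bilinear (metric_in N c u)"
    using inner_form_linear[OF inner_form_metric[of p]]
    unfolding bilinear_def p(2) metric_in_cmap[OF c p(1)]
    by (auto intro: linear_compose[unfolded o_def, OF lin])
  moreover have "metric_in N c u a b = metric_in N c u b a" for a b
    unfolding p(2) metric_in_cmap[OF c p(1)] by (rule inner_form_commute[OF inner_form_metric])
  moreover have "metric_in N c u a a > 0" if "a \<noteq> 0" for a
    using inner_form_metric[of p] inj[of a] that unfolding p(2) metric_in_cmap[OF c p(1)]
    by (auto simp: inner_form_def)
  ultimately show ?thesis
    by (auto simp: inner_form_def)
qed

abbreviation dmetric :: "('m, 'e) chart \<Rightarrow> 'e \<Rightarrow> 'e \<Rightarrow> 'e \<Rightarrow> 'e \<Rightarrow> real" where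
  "dmetric c u a b z \<equiv> frechet_derivative (\<lambda>w. metric_in N c w b z) (at u) a"

lemma metric_in_smooth: "c \<in> atlas N \<Longrightarrow> Ck_on k (\<lambda>u. metric_in N c u a b) (img c)"
  using manifold by (auto simp: riemannian_manifold_def smooth_on_def)

context
  fixes c
  assumes c: "c \<in> atlas N"
begin

lemma metric_in_derivative:
  "u \<in> img c \<Longrightarrow> ((\<lambda>w. metric_in N c w b z) has_derivative (\<lambda>a. dmetric c u a b z)) (at u)"
  using Ck_on_derivD[OF metric_in_smooth[OF c, of "Suc 0"] chart_homeomorphism(2)[OF c]] by simp

lemma dmetric_linear:
  assumes u: "u \<in> img c"
  shows "linear (\<lambda>a. dmetric c u a b z)" "linear (\<lambda>b. dmetric c u a b z)" "linear (\<lambda>z. dmetric c u a b z)"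
proof -
  note O = chart_homeomorphism(2)[OF c] u
  show "linear (\<lambda>a. dmetric c u a b z)"
    using metric_in_derivative[OF u] by (rule has_derivative_linear)
  show "linear (\<lambda>b. dmetric c u a b z)"
    by (rule linear_family_derivative_linear[OF O, where f = "\<lambda>u b. metric_in N c u b z"])
      (use metric_in_derivative[OF u] inner_form_linear[OF inner_form_metric_in[OF c]] in auto)
  show "linear (\<lambda>z. dmetric c u a b z)"
    by (rule linear_family_derivative_linear[OF O, where f = "\<lambda>u z. metric_in N c u b z"])
      (use metric_in_derivative[OF u] inner_form_linear[OF inner_form_metric_in[OF c]] in auto)
qed

lemmas dmetric_simps =
  dmetric_linear(1)[THEN linear_add] dmetric_linear(1)[THEN linear_scale]
  dmetric_linear(2)[THEN linear_add] dmetric_linear(2)[THEN linear_scale]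
  dmetric_linear(3)[THEN linear_add] dmetric_linear(3)[THEN linear_scale]

lemma dmetric_commute:
  assumes u: "u \<in> img c"
  shows "dmetric c u a b z = dmetric c u a z b"
proof -
  have "((\<lambda>w. metric_in N c w b z) has_derivative (\<lambda>a. dmetric c u a z b)) (at u)"
    by (rule has_derivative_transform_within_open[OF metric_in_derivative[OF u, of z b]
          chart_homeomorphism(2)[OF c] u])
      (rule inner_form_commute[OF inner_form_metric_in[OF c]])
  from has_derivative_unique[OF metric_in_derivative[OF u] this] show ?thesis
    by (rule fun_cong)
qed

text \<open>The Koszul formula. Forward, three instances of metric compatibility are combined.
  Backward, the right-hand side is linear and symmetric in \<open>a\<close> and \<open>b\<close>,
  and nondegeneracy carries this over to \<Gamma>.\<close>

lemma levi_civita_iff: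
  assumes u: "u \<in> img c"
  shows "levi_civita_at N c u \<Gamma> \<longleftrightarrow>
    (\<forall>a b z. metric_in N c u (\<Gamma> a b) z = (dmetric c u a b z + dmetric c u b a z - dmetric c u z a b) / 2)"
    (is "_ \<longleftrightarrow> ?koszul")
proof
  note g = inner_form_metric_in[OF c u]
  {
    assume "levi_civita_at N c u \<Gamma>"
    then have D: "dmetric c u a b z = metric_in N c u (\<Gamma> a b) z + metric_in N c u b (\<Gamma> a z)"
      and comm: "\<Gamma> a b = \<Gamma> b a" for a b z
      by (auto simp: levi_civita_at_def)
    show ?koszul
    proof (intro allI)
      fix a b z
      show "metric_in N c u (\<Gamma> a b) z = (dmetric c u a b z + dmetric c u b a z - dmetric c u z a b) / 2"
        unfolding D using comm[of b a] comm[of z a] comm[of z b]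
        by (simp add: inner_form_commute[OF g, of _ "\<Gamma> a z"] inner_form_commute[OF g, of _ "\<Gamma> b z"])
    qed
  }
  assume K: ?koszul
  have lin1: "metric_in N c u (\<Gamma> (r *\<^sub>R a + a') b) z = metric_in N c u (r *\<^sub>R \<Gamma> a b + \<Gamma> a' b) z" for r a a' b z
    by (simp add: inner_form_simps[OF g] K dmetric_simps[OF u] algebra_simps add_divide_distrib diff_divide_distrib)
  have lin2: "metric_in N c u (\<Gamma> b (r *\<^sub>R a + a')) z = metric_in N c u (r *\<^sub>R \<Gamma> b a + \<Gamma> b a') z" for r a a' b z
    by (simp add: inner_form_simps[OF g] K dmetric_simps[OF u] algebra_simps add_divide_distrib diff_divide_distrib)
  have L: "\<Gamma> (r *\<^sub>R a + a') b = r *\<^sub>R \<Gamma> a b + \<Gamma> a' b" "\<Gamma> b (r *\<^sub>R a + a') = r *\<^sub>R \<Gamma> b a + \<Gamma> b a'" for r a a' b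
    using inner_form_eqI[OF g lin1] inner_form_eqI[OF g lin2] by auto
  have Z: "\<Gamma> 0 b = 0" "\<Gamma> b 0 = 0" for b
    using L(1)[of 1 0 0 b] L(2)[of b 1 0 0] by auto
  have "bilinear \<Gamma>"
    unfolding bilinear_def
  proof (intro conjI allI linearI)
    show "\<Gamma> b (a + a') = \<Gamma> b a + \<Gamma> b a'" "\<Gamma> (a + a') b = \<Gamma> a b + \<Gamma> a' b" for a a' b
      using L(1)[of 1 a a' b] L(2)[of b 1 a a'] by auto
    show "\<Gamma> b (r *\<^sub>R a) = r *\<^sub>R \<Gamma> b a" "\<Gamma> (r *\<^sub>R a) b = r *\<^sub>R \<Gamma> a b" for r a b
      using L(1)[of r a 0 b] L(2)[of b r a 0] Z by auto
  qed
  moreover have "\<Gamma> a b = \<Gamma> b a" for a b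
    by (rule inner_form_eqI[OF g]) (simp add: K dmetric_commute[OF u])
  moreover have "dmetric c u a b z = metric_in N c u (\<Gamma> a b) z + metric_in N c u b (\<Gamma> a z)" for a b z
  proof -
    \<comment> \<open>Adds the Koszul formulas for \<open>a\<close>, \<open>b\<close>,
      \<open>z\<close> and for \<open>a\<close>, \<open>z\<close>, \<open>b\<close>: the terms
      \<open>y\<close> and \<open>w\<close> cancel.\<close>
    have arith: "x = p + r" if "p = (x + y - w) / 2" "q = (x' + w' - y') / 2" "r = q" "x' = x" "y' = y" "w' = w"
      for p q r x y w x' y' w' :: real
      using that by simp
    show ?thesis
      by (rule arith[OF K[rule_format] K[rule_format]]) (rule refl inner_form_commute[OF g] dmetric_commute[OF u])+
  qed
  ultimately show "levi_civita_at N c u \<Gamma>"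
    by (auto simp: levi_civita_at_def)
qed

text \<open>Each value is the Riesz vector of the right-hand side of the Koszul formula, which also
  determines it; hence the description defining \<open>christoffel\<close> denotes.\<close>

lemma levi_civita_christoffel:
  assumes u: "u \<in> img c"
  shows "levi_civita_at N c u (christoffel N c u)"
proof -
  note g = inner_form_metric_in[OF c u]
  have "\<exists>w. \<forall>z. metric_in N c u w z = (dmetric c u a b z + dmetric c u b a z - dmetric c u z a b) / 2" for a b
    by (intro inner_form_riesz[OF g] linearI)
      (simp_all add: dmetric_simps[OF u] algebra_simps add_divide_distrib diff_divide_distrib)
  then have "\<forall>a. \<exists>\<Gamma>a. \<forall>b z. metric_in N c u (\<Gamma>a b) z =
      (dmetric c u a b z + dmetric c u b a z - dmetric c u z a b) / 2"
    by (intro allI choice) blast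
  from choice[OF this] have "\<exists>\<Gamma>. levi_civita_at N c u \<Gamma>"
    unfolding levi_civita_iff[OF u] .
  moreover have "\<Gamma> = \<Gamma>'" if "levi_civita_at N c u \<Gamma>" "levi_civita_at N c u \<Gamma>'" for \<Gamma> \<Gamma>'
  proof (intro ext)
    fix a b
    show "\<Gamma> a b = \<Gamma>' a b"
      by (rule inner_form_eqI[OF g]) (simp only: that[unfolded levi_civita_iff[OF u], rule_format])
  qed
  ultimately have "\<exists>!\<Gamma>. levi_civita_at N c u \<Gamma>"
    by (auto intro: ex_ex1I)
  then show ?thesis
    unfolding christoffel_def by (rule theI')
qed

lemma christoffel_unique:
  assumes u: "u \<in> img c" and "levi_civita_at N c u \<Gamma>"
  shows "christoffel N c u = \<Gamma>"
proof (intro ext)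
  fix a b
  show "christoffel N c u a b = \<Gamma> a b"
    by (rule inner_form_eqI[OF inner_form_metric_in[OF c u]])
      (simp only: levi_civita_christoffel[OF u, unfolded levi_civita_iff[OF u], rule_format]
        assms(2)[unfolded levi_civita_iff[OF u], rule_format])
qed

lemma christoffel_linear:
  assumes "u \<in> img c"
  shows "linear (christoffel N c u a)" "linear (\<lambda>a. christoffel N c u a b)"
  using levi_civita_christoffel[OF assms] by (auto simp: levi_civita_at_def bilinear_def)

lemma christoffel_commute: "u \<in> img c \<Longrightarrow> christoffel N c u a b = christoffel N c u b a"
  using levi_civita_christoffel by (auto simp: levi_civita_at_def)

lemma dmetric_christoffel:
  "u \<in> img c \<Longrightarrow> dmetric c u a b z =
    metric_in N c u (christoffel N c u a b) z + metric_in N c u b (christoffel N c u a z)"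
  using levi_civita_christoffel by (auto simp: levi_civita_at_def)

text \<open>Metric compatibility along a curve in one chart: the derivative of the coefficients
  splits by \<open>dmetric_christoffel\<close> into the two connection terms.\<close>

lemma metric_in_along:
  assumes u: "u t \<in> img c" and t: "t \<in> I"
    and d: "(u has_vector_derivative u') (at t within I)" "(V has_vector_derivative V') (at t within I)"
      "(W has_vector_derivative W') (at t within I)"
  shows "((\<lambda>s. metric_in N c (u s) (V s) (W s)) has_real_derivative
    metric_in N c (u t) (V' + christoffel N c (u t) u' (V t)) (W t) +
    metric_in N c (u t) (V t) (W' + christoffel N c (u t) u' (W t))) (at t within I)"
proof -
  note O = chart_homeomorphism(2)[OF c]
  note g = inner_form_metric_in[OF c]
  have W: "((\<lambda>s. metric_in N c (u s) v (W s)) has_vector_derivative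
      dmetric c (u t) u' v (W t) + metric_in N c (u t) v W') (at t within I)" for v
    by (rule has_vector_derivative_linear_family_along[OF O u t inner_form_linear(1)[OF g]
          metric_in_derivative[OF u] d(1,3)])
  have ev: "\<forall>\<^sub>F s in nhds t. s \<in> I \<longrightarrow> linear (\<lambda>v. metric_in N c (u s) v (W s))"
    using eventually_nhds_within_preimage[OF has_vector_derivative_continuous[OF d(1)] O u]
    by eventually_elim (use inner_form_linear(2)[OF g] in blast)
  have lin: "linear (\<lambda>v. dmetric c (u t) u' v (W t) + metric_in N c (u t) v W')"
    by (rule linear_compose_add[OF dmetric_linear(2)[OF u] inner_form_linear(2)[OF g[OF u]]])
  have "((\<lambda>s. metric_in N c (u s) (V s) (W s)) has_vector_derivative
      dmetric c (u t) u' (V t) (W t) + metric_in N c (u t) (V t) W' + metric_in N c (u t) V' (W t)) (at t within I)"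
    by (rule has_vector_derivative_linear_family[OF ev lin t W d(2)])
  then show ?thesis
    by (simp add: has_real_derivative_iff_has_vector_derivative dmetric_christoffel[OF u]
        inner_form_simps[OF g[OF u]] algebra_simps)
qed

end

subsection \<open>Transformation of the connection under a change of charts\<close>

text \<open>Second derivative of the transition map from \<open>c\<close> to \<open>d\<close>;
  \<open>v\<close> is the direction of the inner derivative, \<open>a\<close> that of the outer
  one.\<close>

abbreviation hess :: "('m, 'e) chart \<Rightarrow> ('m, 'e) chart \<Rightarrow> 'e \<Rightarrow> 'e \<Rightarrow> 'e \<Rightarrow> 'e" where
  "hess c d u a v \<equiv>
    frechet_derivative (\<lambda>w. frechet_derivative (cmap d \<circ> cinv c) (at w) v) (at u) a"

context
  fixes c d
  assumes c: "c \<in> atlas N" and d: "d \<in> atlas N"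
begin

lemma transition_second_derivative:
  assumes "u \<in> cmap c ` (cdom c \<inter> cdom d)"
  shows "((\<lambda>w. frechet_derivative (cmap d \<circ> cinv c) (at w) v) has_derivative (\<lambda>a. hess c d u a v)) (at u)"
proof -
  have "Ck_on (Suc 0) (\<lambda>w. frechet_derivative (cmap d \<circ> cinv c) (at w) v) (cmap c ` (cdom c \<inter> cdom d))"
    using transition_smooth[OF c d, of "Suc (Suc 0)"] by simp
  from Ck_on_derivD[OF this open_overlap[OF c d] assms] show ?thesis
    by simp
qed

lemma transition_linear:
  "w \<in> cmap c ` (cdom c \<inter> cdom d) \<Longrightarrow> linear (frechet_derivative (cmap d \<circ> cinv c) (at w))"
  using coord_change_linear[OF c d] by (auto simp: coord_change_def)

lemma hess_commute:
  assumes "u \<in> cmap c ` (cdom c \<inter> cdom d)"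
  shows "hess c d u a v = hess c d u v a"
  by (rule second_derivative_symmetric[OF open_overlap[OF c d] assms transition_smooth[OF c d]])

text \<open>The product rule creates a second-derivative term, so derivatives of coordinate vectors
  do not transform like vectors; the inhomogeneous term in \<open>christoffel_change\<close>
  compensates for it.\<close>

lemma coord_change_along:
  assumes p: "p \<in> cdom c" "p \<in> cdom d" and t: "t \<in> I" "u t = cmap c p"
    and u: "(u has_vector_derivative u') (at t within I)" and V: "(V has_vector_derivative V') (at t within I)"
  shows "((\<lambda>s. frechet_derivative (cmap d \<circ> cinv c) (at (u s)) (V s)) has_vector_derivative
    hess c d (cmap c p) u' (V t) + coord_change c d p V') (at t within I)"
proof -
  have "((\<lambda>s. frechet_derivative (cmap d \<circ> cinv c) (at (u s)) (V s)) has_vector_derivative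
    hess c d (u t) u' (V t) + frechet_derivative (cmap d \<circ> cinv c) (at (u t)) V') (at t within I)"
  proof (rule has_vector_derivative_linear_family_along[OF open_overlap[OF c d] _ t(1) transition_linear _ u V])
    show 1: "u t \<in> cmap c ` (cdom c \<inter> cdom d)"
      using p t by auto
    show "((\<lambda>y. frechet_derivative (cmap d \<circ> cinv c) (at y) v) has_derivative (\<lambda>a. hess c d (u t) a v)) (at (u t))" for v
      by (rule transition_second_derivative[OF 1])
  qed
  then show ?thesis
    by (simp add: t coord_change_def)
qed

text \<open>
  The transformed coefficients satisfy the conditions that characterise the Levi-Civita
  connection; symmetry uses that the second derivative of the transition map is symmetric.
\<close>

lemma christoffel_change:
  assumes p: "p \<in> cdom c" "p \<in> cdom d"
  shows "coord_change c d p (christoffel N c (cmap c p) a b) =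
    christoffel N d (cmap d p) (coord_change c d p a) (coord_change c d p b) + hess c d (cmap c p) a b"
proof -
  let ?T = "coord_change c d p" and ?S = "coord_change d c p"
  let ?u = "cmap c p" and ?w = "cmap d p"
  have u: "?u \<in> img c" "?w \<in> img d" and u': "?u \<in> cmap c ` (cdom c \<inter> cdom d)"
    using p by auto
  \<comment> \<open>The connection of \<open>d\<close> pulled back to \<open>c\<close>;
    \<open>christoffel_unique\<close> will identify it with that of \<open>c\<close>.\<close>
  define \<Gamma> where "\<Gamma> a b = ?S (christoffel N d ?w (?T a) (?T b) + hess c d ?u a b)" for a b
  have T\<Gamma>: "?T (\<Gamma> a b) = christoffel N d ?w (?T a) (?T b) + hess c d ?u a b" for a b
    unfolding \<Gamma>_def by (rule coord_change_inverse[OF c p(1) d p(2)])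
  have linT: "linear ?T" and linS: "linear ?S"
    using c d p by (auto intro: coord_change_linear)
  have lin: "linear (\<Gamma> a)" for a
  proof -
    have "linear (\<lambda>b. christoffel N d ?w (?T a) (?T b) + hess c d ?u a b)"
    proof (rule linear_compose_add)
      show "linear (\<lambda>b. christoffel N d ?w (?T a) (?T b))"
        using linear_compose[OF linT christoffel_linear(1)[OF d u(2)]] by (simp add: o_def)
      show "linear (hess c d ?u a)"
        by (rule linear_family_derivative_linear[OF open_overlap[OF c d] u' transition_linear
              transition_second_derivative[OF u']])
    qed
    from linear_compose[OF this linS] show ?thesis
      by (simp add: \<Gamma>_def[abs_def] o_def)
  qed
  have comm: "\<Gamma> a b = \<Gamma> b a" for a b
    unfolding \<Gamma>_def christoffel_commute[OF d u(2), of "?T a"] hess_commute[OF u', of a] ..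
  have "levi_civita_at N c ?u \<Gamma>"
    unfolding levi_civita_at_def
  proof (intro conjI allI)
    show "bilinear \<Gamma>"
    proof -
      have "(\<lambda>a. \<Gamma> a b) = \<Gamma> b" for b
        by (intro ext comm)
      then show ?thesis
        using lin by (simp add: bilinear_def)
    qed
    show "\<Gamma> a b = \<Gamma> b a" for a b by (rule comm)
    fix a b z
    \<comment> \<open>Metric compatibility is tested along the coordinate line in direction
      \<open>a\<close>: the constant fields \<open>b\<close> and \<open>z\<close> are carried over
      to \<open>d\<close>, where compatibility is known.\<close>
    let ?c = "\<lambda>s::real. ?u + s *\<^sub>R a"
    let ?D = "\<lambda>s v. frechet_derivative (cmap d \<circ> cinv c) (at (?c s)) v"
    have dc: "(?c has_vector_derivative a) (at 0)"
      by (auto intro!: derivative_eq_intros)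
    have dc': "((\<lambda>s. (cmap d \<circ> cinv c) (?c s)) has_vector_derivative ?T a) (at 0)"
      using transition_derivative[OF c d p]
      by (intro has_vector_derivative_compose_derivative[OF dc]) (simp add: o_def)
    have D: "((\<lambda>s. ?D s v) has_vector_derivative hess c d ?u a v) (at 0)" for v
      using coord_change_along[OF p, of 0 UNIV ?c a "\<lambda>_. v" 0] dc linear_0[OF linT] by simp
    have at0: "(cmap d \<circ> cinv c) (?c 0) = ?w" "?D 0 v = ?T v" for v
      using cinv_cmap[OF c p(1)] by (simp_all add: coord_change_def)
    have "((\<lambda>s. metric_in N d ((cmap d \<circ> cinv c) (?c s)) (?D s b) (?D s z)) has_real_derivative
      metric_in N d ((cmap d \<circ> cinv c) (?c 0)) (hess c d ?u a b + christoffel N d ((cmap d \<circ> cinv c) (?c 0)) (?T a) (?D 0 b)) (?D 0 z) +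
      metric_in N d ((cmap d \<circ> cinv c) (?c 0)) (?D 0 b) (hess c d ?u a z + christoffel N d ((cmap d \<circ> cinv c) (?c 0)) (?T a) (?D 0 z))) (at 0)"
      by (rule metric_in_along[OF d _ UNIV_I dc' D D]) (use at0 u in simp)
    then have "((\<lambda>s. metric_in N d ((cmap d \<circ> cinv c) (?c s)) (?D s b) (?D s z)) has_vector_derivative
      metric_in N d ?w (?T (\<Gamma> a b)) (?T z) + metric_in N d ?w (?T b) (?T (\<Gamma> a z))) (at 0)"
      unfolding at0 T\<Gamma> has_real_derivative_iff_has_vector_derivative by (simp add: add.commute)
    then have 1: "((\<lambda>s. metric_in N c (?c s) b z) has_vector_derivative
      metric_in N c ?u (\<Gamma> a b) z + metric_in N c ?u b (\<Gamma> a z)) (at 0)"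
      unfolding metric_in_change[OF c d p]
    proof (rule has_vector_derivative_transform_within_open)
      show "open (?c -` (cmap c ` (cdom c \<inter> cdom d)))"
        by (intro open_vimage open_overlap c d continuous_intros)
      show "(0::real) \<in> ?c -` (cmap c ` (cdom c \<inter> cdom d))"
        using u' by simp
      fix s assume "s \<in> ?c -` (cmap c ` (cdom c \<inter> cdom d))"
      then obtain q where q: "q \<in> cdom c" "q \<in> cdom d" "?c s = cmap c q"
        by auto
      show "metric_in N d ((cmap d \<circ> cinv c) (?c s)) (?D s b) (?D s z) = metric_in N c (?c s) b z"
        using metric_in_change[OF c d q(1,2), of b z] by (simp add: q cinv_cmap[OF c] coord_change_def)
    qed
    have "((\<lambda>s. metric_in N c (?c s) b z) has_vector_derivative dmetric c ?u a b z) (at 0)"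
      by (rule has_vector_derivative_compose_derivative[OF dc]) (simp add: metric_in_derivative[OF c] p)
    from vector_derivative_unique_at[OF this 1]
    show "dmetric c ?u a b z = metric_in N c ?u (\<Gamma> a b) z + metric_in N c ?u b (\<Gamma> a z)" .
  qed
  from christoffel_unique[OF c u(1) this] show ?thesis
    using T\<Gamma> by simp
qed

end

subsection \<open>Local bounds for the metric and the connection\<close>

text \<open>On a compact ball the metric coefficients and their derivatives up to order two are
  bounded. The bounds for the connection follow from the Koszul formula, paired with the very vector
  to be estimated, and from definiteness of the metric.\<close>

lemma local_bounds:
  assumes c: "c \<in> atlas N" and u0: "u0 \<in> img c"
  obtains r \<mu> K L where "r > 0" "\<mu> > 0" "K > 0" "L \<ge> 0" "cball u0 r \<subseteq> img c"
    and "\<And>u a. u \<in> cball u0 r \<Longrightarrow> \<mu> * (norm a)\<^sup>2 \<le> metric_in N c u a a"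
    and "\<And>u a. u \<in> cball u0 r \<Longrightarrow> metric_in N c u a a \<le> K * (norm a)\<^sup>2"
    and "\<And>u a b. u \<in> cball u0 r \<Longrightarrow> norm (christoffel N c u a b) \<le> K * norm a * norm b"
    and "\<And>u v a b. u \<in> cball u0 r \<Longrightarrow> v \<in> cball u0 r \<Longrightarrow>
      norm (christoffel N c u a b - christoffel N c v a b) \<le> L * norm (u - v) * norm a * norm b"
proof -
  let ?n = "real (card (Basis :: 'e set))"
  note O = chart_homeomorphism(2)[OF c]
  obtain r where r: "r > 0" "cball u0 r \<subseteq> img c"
    using open_contains_cball_eq[OF O] u0 by blast
  let ?B = "cball u0 r"
  have inB: "u \<in> img c" if "u \<in> ?B" for u using r that by blast
  note g = inner_form_metric_in[OF c inB]
  have bil: "bilinear (metric_in N c u)" if "u \<in> ?B" for u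
    using g[OF that] by (simp add: inner_form_def)
  have "\<exists>K\<ge>0. \<forall>ij\<in>Basis \<times> Basis. \<forall>u\<in>?B. \<bar>metric_in N c u (fst ij) (snd ij)\<bar> \<le> K \<and>
      (\<forall>v\<in>?B. \<bar>metric_in N c u (fst ij) (snd ij) - metric_in N c v (fst ij) (snd ij)\<bar> \<le> K * norm (u - v))"
    by (rule finite_family_bound[OF _ metric_in_smooth[OF c] O r(2)]) simp
  then obtain Kg where Kg: "Kg \<ge> 0" "\<And>i j u. i \<in> Basis \<Longrightarrow> j \<in> Basis \<Longrightarrow> u \<in> ?B \<Longrightarrow> \<bar>metric_in N c u i j\<bar> \<le> Kg"
    "\<And>i j u v. i \<in> Basis \<Longrightarrow> j \<in> Basis \<Longrightarrow> u \<in> ?B \<Longrightarrow> v \<in> ?B \<Longrightarrow>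
      \<bar>metric_in N c u i j - metric_in N c v i j\<bar> \<le> Kg * norm (u - v)"
    by fastforce
  let ?dm = "\<lambda>ijk u. dmetric c u (fst ijk) (fst (snd ijk)) (snd (snd ijk))"
  have "\<exists>K\<ge>0. \<forall>ijk\<in>Basis \<times> Basis \<times> Basis. \<forall>u\<in>?B. \<bar>?dm ijk u\<bar> \<le> K \<and>
      (\<forall>v\<in>?B. \<bar>?dm ijk u - ?dm ijk v\<bar> \<le> K * norm (u - v))"
  proof (rule finite_family_bound[OF _ _ O r(2)])
    show "Ck_on 1 (?dm ijk) (img c)" for ijk
      using metric_in_smooth[OF c, of "Suc (Suc 0)" "fst (snd ijk)" "snd (snd ijk)"] by simp
  qed simp
  then obtain Kd where Kd: "Kd \<ge> 0"
    "\<And>i j k u. i \<in> Basis \<Longrightarrow> j \<in> Basis \<Longrightarrow> k \<in> Basis \<Longrightarrow> u \<in> ?B \<Longrightarrow> \<bar>dmetric c u i j k\<bar> \<le> Kd"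
    "\<And>i j k u v. i \<in> Basis \<Longrightarrow> j \<in> Basis \<Longrightarrow> k \<in> Basis \<Longrightarrow> u \<in> ?B \<Longrightarrow> v \<in> ?B \<Longrightarrow>
      \<bar>dmetric c u i j k - dmetric c v i j k\<bar> \<le> Kd * norm (u - v)"
    by fastforce

  \<comment> \<open>The minimum of the quadratic form over the compact product of the ball and the
    unit sphere, extended to all vectors by homogeneity.\<close>
  obtain \<mu> where \<mu>: "\<mu> > 0" "\<And>u a. u \<in> ?B \<Longrightarrow> \<mu> * (norm a)\<^sup>2 \<le> metric_in N c u a a"
  proof -
    let ?f = "\<lambda>(u, a). \<Sum>i\<in>Basis. \<Sum>j\<in>Basis. (a \<bullet> i) * (a \<bullet> j) * metric_in N c u i j"
    let ?S = "sphere (0::'e) 1"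
    have "continuous_on (?B \<times> ?S) (\<lambda>z. metric_in N c (fst z) i j)" for i j
      by (rule continuous_on_compose2[OF continuous_on_subset[OF Ck_on_imp_continuous[OF metric_in_smooth[OF c, of 0]] r(2)]])
        (auto intro: continuous_intros)
    then have "continuous_on (?B \<times> ?S) ?f"
      unfolding case_prod_beta by (intro continuous_intros)
    moreover have "compact (?B \<times> ?S)"
      by (intro compact_Times compact_cball compact_sphere)
    moreover have "?B \<times> ?S \<noteq> {}"
      using r(1) SOME_Basis norm_Basis by force
    ultimately obtain u1 a1 where 1: "u1 \<in> ?B" "a1 \<in> ?S" "\<And>u a. u \<in> ?B \<Longrightarrow> a \<in> ?S \<Longrightarrow> ?f (u1, a1) \<le> ?f (u, a)"
      using continuous_attains_inf[of "?B \<times> ?S" ?f] by fastforce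
    have f: "?f (u, a) = metric_in N c u a a" if "u \<in> ?B" for u a
      using bilinear_expand[OF bil[OF that], of a a] by simp
    show thesis
    proof
      show "?f (u1, a1) > 0"
      proof -
        have "a1 \<noteq> 0"
          using 1(2) by auto
        then show ?thesis
          using g[OF 1(1)] unfolding f[OF 1(1)] inner_form_def by blast
      qed
      fix u a assume u: "u \<in> ?B"
      show "?f (u1, a1) * (norm a)\<^sup>2 \<le> metric_in N c u a a"
      proof (cases "a = 0")
        case False
        then have "a /\<^sub>R norm a \<in> ?S"
          by simp
        from 1(3)[OF u this] have "?f (u1, a1) \<le> metric_in N c u (a /\<^sub>R norm a) (a /\<^sub>R norm a)"
          unfolding f[OF u] .
        also have "\<dots> = metric_in N c u a a / (norm a)\<^sup>2"
          by (simp add: inner_form_simps[OF g[OF u]] power2_eq_square divide_inverse mult_ac)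
        finally show ?thesis
          using False by (simp add: field_simps)
      qed (simp add: inner_form_simps[OF g[OF u]])
    qed
  qed

  define K1 where "K1 = Kg * ?n\<^sup>2"
  define K2 where "K2 = Kd * ?n^3"
  have nonneg: "K1 \<ge> 0" "K2 \<ge> 0"
    using Kg(1) Kd(1) by (auto simp: K1_def K2_def)
  have K1: "\<bar>metric_in N c u a b\<bar> \<le> K1 * norm a * norm b" if "u \<in> ?B" for u a b
    unfolding K1_def by (rule bilinear_abs_le[OF bil[OF that] Kg(2)[OF _ _ that]])
  have L1: "\<bar>metric_in N c u a b - metric_in N c v a b\<bar> \<le> K1 * norm (u - v) * norm a * norm b"
    if "u \<in> ?B" "v \<in> ?B" for u v a b
  proof -
    have "bilinear (\<lambda>a b. metric_in N c u a b - metric_in N c v a b)"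
      using bil[OF that(1)] bil[OF that(2)] by (auto simp: bilinear_def intro: linear_compose_sub)
    from bilinear_abs_le[OF this Kg(3)[OF _ _ that]] show ?thesis
      by (simp add: K1_def mult_ac)
  qed
  have dbil: "bilinear (dmetric c u a)" if "u \<in> ?B" for u a
    using dmetric_linear[OF c inB[OF that]] by (auto simp: bilinear_def)
  have K2: "\<bar>dmetric c u a b z\<bar> \<le> K2 * norm a * norm b * norm z" if "u \<in> ?B" for u a b z
    unfolding K2_def
    by (rule trilinear_abs_le[OF dmetric_linear(1)[OF c inB[OF that]] dbil[OF that] Kd(2)[OF _ _ _ that]])
  have L2: "\<bar>dmetric c u a b z - dmetric c v a b z\<bar> \<le> K2 * norm (u - v) * norm a * norm b * norm z"
    if "u \<in> ?B" "v \<in> ?B" for u v a b z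
  proof -
    have "\<bar>dmetric c u a b z - dmetric c v a b z\<bar> \<le> Kd * norm (u - v) * ?n^3 * norm a * norm b * norm z"
    proof (rule trilinear_abs_le[where h = "\<lambda>a b z. dmetric c u a b z - dmetric c v a b z"])
      show "linear (\<lambda>a. dmetric c u a b z - dmetric c v a b z)" for b z
        by (intro linear_compose_sub dmetric_linear c inB that)
      show "bilinear (\<lambda>b z. dmetric c u a b z - dmetric c v a b z)" for a
        using dbil[OF that(1)] dbil[OF that(2)] by (auto simp: bilinear_def intro: linear_compose_sub)
    qed (rule Kd(3)[OF _ _ _ that])
    then show ?thesis
      by (simp add: K2_def mult_ac)
  qed
  have kos: "2 * metric_in N c u (christoffel N c u a b) z = dmetric c u a b z + dmetric c u b a z - dmetric c u z a b"
    if "u \<in> ?B" for u a b z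
    using levi_civita_christoffel[OF c inB[OF that], unfolded levi_civita_iff[OF c inB[OF that]], rule_format, of a b z]
    by simp
  \<comment> \<open>The pairing of \<open>w\<close> with itself is at least
    \<open>\<mu> * (norm w)\<^sup>2\<close>, so one factor \<open>norm w\<close> cancels.\<close>
  have cancel: "norm w \<le> k / \<mu>" if u: "u \<in> ?B" and "metric_in N c u w w \<le> k * norm w" "k \<ge> 0" for u w k
  proof (cases "w = 0")
    case False
    have "\<mu> * norm w * norm w \<le> k * norm w"
      using \<mu>(2)[OF u, of w] that by (simp add: power2_eq_square mult_ac)
    then have "\<mu> * norm w \<le> k"
      using False by simp
    then show ?thesis
      using \<mu>(1) by (simp add: field_simps)
  qed (use \<mu> that in simp)
  define K3 where "K3 = (3 * K2) / \<mu>"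
  have K3: "norm (christoffel N c u a b) \<le> K3 * norm a * norm b" if u: "u \<in> ?B" for u a b
  proof -
    let ?z = "christoffel N c u a b"
    have "2 * metric_in N c u ?z ?z \<le> 3 * (K2 * norm a * norm b * norm ?z)"
      using kos[OF u, of a b ?z] K2[OF u, where a = a and b = b and z = ?z]
        K2[OF u, where a = b and b = a and z = ?z] K2[OF u, where a = ?z and b = a and z = b]
      by (simp add: mult_ac)
    moreover have "0 \<le> metric_in N c u ?z ?z"
      by (rule inner_form_nonneg[OF g[OF u]])
    ultimately have "metric_in N c u ?z ?z \<le> (3 * K2 * norm a * norm b) * norm ?z"
      by (simp add: mult_ac)
    from cancel[OF u this] show ?thesis
      using nonneg by (simp add: K3_def mult_ac)
  qed
  define L where "L = (3 * K2 + K1 * K3) / \<mu>"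
  have K3_nonneg: "K3 \<ge> 0"
    using nonneg \<mu> by (simp add: K3_def)
  have L: "norm (christoffel N c u a b - christoffel N c v a b) \<le> L * norm (u - v) * norm a * norm b"
    if u: "u \<in> ?B" and v: "v \<in> ?B" for u v a b
  proof -
    let ?G = "christoffel N c u a b" and ?H = "christoffel N c v a b"
    let ?z = "?G - ?H"
    let ?e = "norm (u - v) * norm a * norm b * norm ?z"
    \<comment> \<open>The Koszul formula at \<open>v\<close> involves the metric at
      \<open>v\<close>; exchanging it for the metric at \<open>u\<close> costs the last difference,
      which the Lipschitz bound for the metric controls.\<close>
    have "metric_in N c u ?z ?z = metric_in N c u ?G ?z - metric_in N c v ?H ?z + (metric_in N c v ?H ?z - metric_in N c u ?H ?z)"
      by (simp add: inner_form_simps(3)[OF g[OF u]])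
    moreover have "2 * (metric_in N c u ?G ?z - metric_in N c v ?H ?z) \<le> 3 * (K2 * ?e)"
      using kos[OF u, of a b ?z] kos[OF v, of a b ?z] L2[OF u v, where a = a and b = b and z = ?z]
        L2[OF u v, where a = b and b = a and z = ?z] L2[OF u v, where a = ?z and b = a and z = b]
      by (simp add: mult_ac)
    moreover have "metric_in N c v ?H ?z - metric_in N c u ?H ?z \<le> K1 * K3 * ?e"
    proof -
      have "metric_in N c v ?H ?z - metric_in N c u ?H ?z \<le> K1 * norm (v - u) * norm ?H * norm ?z"
        using L1[OF v u, of ?H ?z] by simp
      also have "\<dots> \<le> K1 * norm (v - u) * (K3 * norm a * norm b) * norm ?z"
        using nonneg K3[OF v] by (intro mult_right_mono mult_left_mono) auto
      finally show ?thesis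
        by (simp add: mult_ac norm_minus_commute)
    qed
    moreover have "0 \<le> K2 * ?e"
      using nonneg by simp
    ultimately have "metric_in N c u ?z ?z \<le> 3 * (K2 * ?e) + K1 * K3 * ?e"
      by argo
    then have "metric_in N c u ?z ?z \<le> ((3 * K2 + K1 * K3) * norm (u - v) * norm a * norm b) * norm ?z"
      by (simp add: algebra_simps)
    from cancel[OF u this] show ?thesis
      using nonneg K3_nonneg by (simp add: L_def mult_ac)
  qed
  \<comment> \<open>One constant serves the metric and the connection; the 1 makes it
    positive.\<close>
  define K where "K = max 1 (max K1 K3)"
  show thesis
  proof (rule that[of r \<mu> K L])
    show "metric_in N c u a a \<le> K * (norm a)\<^sup>2" if "u \<in> ?B" for u a
    proof -
      have "metric_in N c u a a \<le> K1 * (norm a)\<^sup>2"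
        using K1[OF that, of a a] by (simp add: power2_eq_square mult_ac)
      also have "\<dots> \<le> K * (norm a)\<^sup>2"
        by (intro mult_right_mono) (auto simp: K_def)
      finally show ?thesis .
    qed
    show "norm (christoffel N c u a b) \<le> K * norm a * norm b" if "u \<in> ?B" for u a b
    proof -
      have "K3 * norm a * norm b \<le> K * norm a * norm b"
        by (intro mult_right_mono) (auto simp: K_def)
      with K3[OF that, of a b] show ?thesis by linarith
    qed
    show "L \<ge> 0"
      using nonneg K3_nonneg \<mu> by (simp add: L_def)
  qed (use r \<mu> L in \<open>auto simp: K_def\<close>)
qed

text \<open>The connection is known only through its description, so continuity in the base point is
  read off the Lipschitz bound; the moving first argument is handled by linearity.\<close>

lemma continuous_on_christoffel:
  assumes c: "c \<in> atlas N" and V: "continuous_on I V" and u: "continuous_on I u"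
    and img: "u ` I \<subseteq> cball u0 r" "cball u0 r \<subseteq> img c"
    and lip: "\<And>u v a b. u \<in> cball u0 r \<Longrightarrow> v \<in> cball u0 r \<Longrightarrow>
      norm (christoffel N c u a b - christoffel N c v a b) \<le> L * norm (u - v) * norm a * norm b"
  shows "continuous_on I (\<lambda>s. christoffel N c (u s) (V s) b)"
proof (rule continuous_on_linear_family[OF _ _ V])
  have inB: "u s \<in> img c" if "s \<in> I" for s
    using img that by blast
  then show "linear (\<lambda>a. christoffel N c (u s) a b)" if "s \<in> I" for s
    using that by (intro christoffel_linear c)
  fix a :: 'e
  show "continuous_on I (\<lambda>s. christoffel N c (u s) a b)"
    unfolding continuous_on_def
  proof
    fix t assume t: "t \<in> I"
    show "((\<lambda>s. christoffel N c (u s) a b) \<longlongrightarrow> christoffel N c (u t) a b) (at t within I)"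
    proof (rule Lim_transform_bound[THEN Lim_null[THEN iffD2], rotated])
      have "((\<lambda>s. L * norm (u s - u t) * norm a * norm b) \<longlongrightarrow> L * norm (u t - u t) * norm a * norm b) (at t within I)"
        using u t by (intro tendsto_intros) (auto simp: continuous_on_def)
      then show "((\<lambda>s. L * norm (u s - u t) * norm a * norm b) \<longlongrightarrow> 0) (at t within I)"
        by simp
      show "\<forall>\<^sub>F s in at t within I. norm (christoffel N c (u s) a b - christoffel N c (u t) a b)
          \<le> norm (L * norm (u s - u t) * norm a * norm b)"
        unfolding eventually_at_filter
      proof (rule always_eventually, intro allI impI)
        fix s assume "s \<in> I"
        then show "norm (christoffel N c (u s) a b - christoffel N c (u t) a b)
          \<le> norm (L * norm (u s - u t) * norm a * norm b)"
          using lip[of "u s" "u t" a b] img(1) t by fastforce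
      qed
    qed
  qed
qed

section \<open>Covariant derivatives along curves\<close>

lemma curve_eventually_in_chart:
  assumes "continuous (at t within I) \<gamma>" "c \<in> atlas N" "\<gamma> t \<in> cdom c"
  shows "\<forall>\<^sub>F s in nhds t. s \<in> I \<longrightarrow> \<gamma> s \<in> cdom c"
  using assms chart_homeomorphism(1) by (intro eventually_nhds_within_preimage)

lemma chart_derivative_change:
  assumes cont: "continuous (at t within I) \<gamma>" and c: "c \<in> atlas N" and d: "d \<in> atlas N"
    and \<gamma>t: "\<gamma> t \<in> cdom c" "\<gamma> t \<in> cdom d" and t: "t \<in> I"
    and a: "((cmap c \<circ> \<gamma>) has_vector_derivative a) (at t within I)"
  shows "((cmap d \<circ> \<gamma>) has_vector_derivative coord_change c d (\<gamma> t) a) (at t within I)"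
proof -
  have "((\<lambda>s. (cmap d \<circ> cinv c) ((cmap c \<circ> \<gamma>) s)) has_vector_derivative coord_change c d (\<gamma> t) a) (at t within I)"
    using transition_derivative[OF c d \<gamma>t]
    by (intro has_vector_derivative_compose_derivative[OF a]) (simp add: o_def)
  then show ?thesis
  proof (rule has_vector_derivative_cong_ev[THEN iffD1, rotated -1])
    show "\<forall>\<^sub>F s in nhds t. s \<in> I \<longrightarrow> (cmap d \<circ> cinv c) ((cmap c \<circ> \<gamma>) s) = (cmap d \<circ> \<gamma>) s"
      using curve_eventually_in_chart[OF cont c \<gamma>t(1)] by eventually_elim (simp add: cinv_cmap[OF c])
    show "(cmap d \<circ> cinv c) ((cmap c \<circ> \<gamma>) t) = (cmap d \<circ> \<gamma>) t"
      using \<gamma>t by (simp add: cinv_cmap[OF c])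
  qed
qed

text \<open>The definition asks for all charts. In passing to another chart, the second derivative
  of the transition map enters the derivative of the components and the connection term with
  opposite signs and cancels.\<close>

lemma has_covariant_derivativeI_chart:
  assumes cont: "continuous (at t within I) \<gamma>" and c: "c \<in> atlas N" and \<gamma>t: "\<gamma> t \<in> cdom c" and t: "t \<in> I"
    and a: "((cmap c \<circ> \<gamma>) has_vector_derivative a) (at t within I)"
    and b: "((\<lambda>s. in_chart N c (\<gamma> s) (V s)) has_vector_derivative b) (at t within I)"
    and w: "in_chart N c (\<gamma> t) w = b + christoffel N c (cmap c (\<gamma> t)) a (in_chart N c (\<gamma> t) (V t))"
  shows "has_covariant_derivative N I \<gamma> V t w"
  unfolding has_covariant_derivative_def
proof (intro ballI impI exI conjI)
  fix d assume d: "d \<in> atlas N" and \<gamma>d: "\<gamma> t \<in> cdom d"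
  let ?T = "coord_change c d (\<gamma> t)" and ?u = "cmap c (\<gamma> t)" and ?v = "in_chart N c (\<gamma> t) (V t)"
  show "((cmap d \<circ> \<gamma>) has_vector_derivative ?T a) (at t within I)"
    by (rule chart_derivative_change[OF cont c d \<gamma>t \<gamma>d t a])
  have "((\<lambda>s. frechet_derivative (cmap d \<circ> cinv c) (at ((cmap c \<circ> \<gamma>) s)) (in_chart N c (\<gamma> s) (V s)))
      has_vector_derivative hess c d ?u a ?v + ?T b) (at t within I)"
    by (rule coord_change_along[OF c d \<gamma>t \<gamma>d t _ a b]) simp
  then show "((\<lambda>s. in_chart N d (\<gamma> s) (V s)) has_vector_derivative hess c d ?u a ?v + ?T b) (at t within I)"
  proof (rule has_vector_derivative_cong_ev[THEN iffD1, rotated -1])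
    have *: "frechet_derivative (cmap d \<circ> cinv c) (at ((cmap c \<circ> \<gamma>) s)) (in_chart N c (\<gamma> s) (V s)) = in_chart N d (\<gamma> s) (V s)"
      if "\<gamma> s \<in> cdom c" "\<gamma> s \<in> cdom d" for s
      using in_chart_change[OF c that(1) d that(2)] by (simp add: coord_change_def)
    show "\<forall>\<^sub>F s in nhds t. s \<in> I \<longrightarrow>
        frechet_derivative (cmap d \<circ> cinv c) (at ((cmap c \<circ> \<gamma>) s)) (in_chart N c (\<gamma> s) (V s)) = in_chart N d (\<gamma> s) (V s)"
      using curve_eventually_in_chart[OF cont c \<gamma>t] curve_eventually_in_chart[OF cont d \<gamma>d]
      by eventually_elim (use * in blast)
    show "frechet_derivative (cmap d \<circ> cinv c) (at ((cmap c \<circ> \<gamma>) t)) (in_chart N c (\<gamma> t) (V t)) = in_chart N d (\<gamma> t) (V t)"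
      using \<gamma>t \<gamma>d by (rule *)
  qed
  have "in_chart N d (\<gamma> t) w = ?T (in_chart N c (\<gamma> t) w)"
    by (rule in_chart_change[OF c \<gamma>t d \<gamma>d, symmetric])
  also have "\<dots> = ?T b + ?T (christoffel N c ?u a ?v)"
    unfolding w by (rule linear_add[OF coord_change_linear[OF c d \<gamma>t \<gamma>d]])
  also have "\<dots> = (hess c d ?u a ?v + ?T b) + christoffel N d (cmap d (\<gamma> t)) (?T a) (?T ?v)"
    by (simp add: christoffel_change[OF c d \<gamma>t \<gamma>d])
  also have "?T ?v = in_chart N d (\<gamma> t) (V t)"
    by (rule in_chart_change[OF c \<gamma>t d \<gamma>d])
  finally show "in_chart N d (\<gamma> t) w =
    (hess c d ?u a ?v + ?T b) + christoffel N d (cmap d (\<gamma> t)) (?T a) (in_chart N d (\<gamma> t) (V t))" .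
qed

lemma has_covariant_derivativeD:
  assumes "has_covariant_derivative N I \<gamma> V t w" "c \<in> atlas N" "\<gamma> t \<in> cdom c"
  obtains a b where "((cmap c \<circ> \<gamma>) has_vector_derivative a) (at t within I)"
    "((\<lambda>s. in_chart N c (\<gamma> s) (V s)) has_vector_derivative b) (at t within I)"
    "in_chart N c (\<gamma> t) w = b + christoffel N c (cmap c (\<gamma> t)) a (in_chart N c (\<gamma> t) (V t))"
  using assms unfolding has_covariant_derivative_def by blast

lemma has_covariant_derivative_cong:
  assumes ev: "\<forall>\<^sub>F s in nhds t. s \<in> I \<longrightarrow> \<gamma> s = \<gamma>' s \<and> V s = V' s" and t: "t \<in> I"
    and "has_covariant_derivative N I \<gamma> V t w"
  shows "has_covariant_derivative N I \<gamma>' V' t w"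
  unfolding has_covariant_derivative_def
proof (intro ballI impI)
  have eq: "\<gamma> t = \<gamma>' t" "V t = V' t"
    using eventually_nhds_x_imp_x[OF ev] t by auto
  fix c assume c: "c \<in> atlas N" "\<gamma>' t \<in> cdom c"
  then obtain a b where ab: "((cmap c \<circ> \<gamma>) has_vector_derivative a) (at t within I)"
    "((\<lambda>s. in_chart N c (\<gamma> s) (V s)) has_vector_derivative b) (at t within I)"
    "in_chart N c (\<gamma> t) w = b + christoffel N c (cmap c (\<gamma> t)) a (in_chart N c (\<gamma> t) (V t))"
    using has_covariant_derivativeD[OF assms(3) c(1)] eq by metis
  have 1: "\<forall>\<^sub>F s in nhds t. s \<in> I \<longrightarrow> (cmap c \<circ> \<gamma>) s = (cmap c \<circ> \<gamma>') s"
    using ev by eventually_elim auto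
  then have "((cmap c \<circ> \<gamma>') has_vector_derivative a) (at t within I)"
    using ab(1) eq by (subst has_vector_derivative_cong_ev[symmetric]) auto
  moreover
  have 2: "\<forall>\<^sub>F s in nhds t. s \<in> I \<longrightarrow> in_chart N c (\<gamma> s) (V s) = in_chart N c (\<gamma>' s) (V' s)"
    using ev by eventually_elim auto
  then have "((\<lambda>s. in_chart N c (\<gamma>' s) (V' s)) has_vector_derivative b) (at t within I)"
    using ab(2) eq by (subst has_vector_derivative_cong_ev[symmetric]) auto
  ultimately show "\<exists>a b. ((cmap c \<circ> \<gamma>') has_vector_derivative a) (at t within I) \<and>
      ((\<lambda>s. in_chart N c (\<gamma>' s) (V' s)) has_vector_derivative b) (at t within I) \<and>
      in_chart N c (\<gamma>' t) w = b + christoffel N c (cmap c (\<gamma>' t)) a (in_chart N c (\<gamma>' t) (V' t))"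
    using ab(3) eq by metis
qed

lemma metric_along_derivative:
  assumes cont: "continuous (at t within I) \<gamma>" and t: "t \<in> I" "at t within I \<noteq> bot"
    and V: "has_covariant_derivative N I \<gamma> V t v" and W: "has_covariant_derivative N I \<gamma> W t w"
  shows "((\<lambda>s. metric N (\<gamma> s) (V s) (W s)) has_real_derivative
    metric N (\<gamma> t) v (W t) + metric N (\<gamma> t) (V t) w) (at t within I)"
proof -
  define c where "c = chart_at N (\<gamma> t)"
  have c: "c \<in> atlas N" "\<gamma> t \<in> cdom c"
    by (simp_all add: c_def)
  obtain a b where ab: "((cmap c \<circ> \<gamma>) has_vector_derivative a) (at t within I)"
    "((\<lambda>s. in_chart N c (\<gamma> s) (V s)) has_vector_derivative b) (at t within I)"
    "in_chart N c (\<gamma> t) v = b + christoffel N c (cmap c (\<gamma> t)) a (in_chart N c (\<gamma> t) (V t))"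
    using has_covariant_derivativeD[OF V c] .
  obtain a' b' where ab': "((cmap c \<circ> \<gamma>) has_vector_derivative a') (at t within I)"
    "((\<lambda>s. in_chart N c (\<gamma> s) (W s)) has_vector_derivative b') (at t within I)"
    "in_chart N c (\<gamma> t) w = b' + christoffel N c (cmap c (\<gamma> t)) a' (in_chart N c (\<gamma> t) (W t))"
    using has_covariant_derivativeD[OF W c] .
  \<comment> \<open>The two covariant derivatives come with separately chosen derivatives of the
    curve; at a limit point of \<open>I\<close> these coincide.\<close>
  have "a' = a"
    using vector_derivative_unique_within[OF t(2) ab(1) ab'(1)] by simp
  have "((\<lambda>s. metric_in N c ((cmap c \<circ> \<gamma>) s) (in_chart N c (\<gamma> s) (V s)) (in_chart N c (\<gamma> s) (W s))) has_real_derivative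
    metric_in N c ((cmap c \<circ> \<gamma>) t) (b + christoffel N c ((cmap c \<circ> \<gamma>) t) a (in_chart N c (\<gamma> t) (V t))) (in_chart N c (\<gamma> t) (W t)) +
    metric_in N c ((cmap c \<circ> \<gamma>) t) (in_chart N c (\<gamma> t) (V t)) (b' + christoffel N c ((cmap c \<circ> \<gamma>) t) a (in_chart N c (\<gamma> t) (W t))))
    (at t within I)"
    by (rule metric_in_along[OF c(1) _ t(1) ab(1,2) ab'(2)]) (use c in auto)
  then have "((\<lambda>s. metric_in N c (cmap c (\<gamma> s)) (in_chart N c (\<gamma> s) (V s)) (in_chart N c (\<gamma> s) (W s))) has_vector_derivative
    metric N (\<gamma> t) v (W t) + metric N (\<gamma> t) (V t) w) (at t within I)"
    using ab(3) ab'(3) \<open>a' = a\<close> metric_conv_chart[OF c]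
    by (simp add: has_real_derivative_iff_has_vector_derivative)
  then have "((\<lambda>s. metric N (\<gamma> s) (V s) (W s)) has_vector_derivative
    metric N (\<gamma> t) v (W t) + metric N (\<gamma> t) (V t) w) (at t within I)"
  proof (rule has_vector_derivative_cong_ev[THEN iffD1, rotated -1])
    show "\<forall>\<^sub>F s in nhds t. s \<in> I \<longrightarrow> metric_in N c (cmap c (\<gamma> s)) (in_chart N c (\<gamma> s) (V s)) (in_chart N c (\<gamma> s) (W s)) =
        metric N (\<gamma> s) (V s) (W s)"
      using curve_eventually_in_chart[OF cont c]
      by eventually_elim (simp add: metric_conv_chart[OF c(1)])
  qed (simp add: metric_conv_chart[OF c])
  then show ?thesis
    by (simp add: has_real_derivative_iff_has_vector_derivative)
qed

lemma C1_curve_chart_derivative: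
  assumes \<gamma>: "C1_curve_on N I \<gamma>" and t: "t \<in> I" and c: "c \<in> atlas N" "\<gamma> t \<in> cdom c"
  shows "((cmap c \<circ> \<gamma>) has_vector_derivative in_chart N c (\<gamma> t) (velocity N I \<gamma> t)) (at t within I)"
proof -
  have "((cmap (chart_at N (\<gamma> t)) \<circ> \<gamma>) has_vector_derivative velocity N I \<gamma> t) (at t within I)"
    using \<gamma> t unfolding velocity_def C1_curve_on_def by (simp add: vector_derivative_works)
  then show ?thesis
    unfolding in_chart_def using \<gamma> t c
    by (intro chart_derivative_change) (auto simp: C1_curve_on_def continuous_on_eq_continuous_within)
qed

text \<open>Chain rule in the preferred chart at \<open>\<gamma> t\<close>, where tangent vectors at
  \<open>\<gamma> t\<close> are their own coordinates, so the chart formula is literally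
  \<open>nabla\<close>.\<close>

lemma field_covariant_derivative:
  assumes F: "twice_differentiable_field N F" and \<gamma>: "C1_curve_on N I \<gamma>" and t: "t \<in> I"
  shows "has_covariant_derivative N I \<gamma> (\<lambda>s. F (\<gamma> s)) t (nabla N F (\<gamma> t) (velocity N I \<gamma> t))"
proof -
  define c where "c = chart_at N (\<gamma> t)"
  have c: "c \<in> atlas N" "\<gamma> t \<in> cdom c"
    by (simp_all add: c_def)
  have [simp]: "in_chart N c (\<gamma> t) v = v" for v
    by (simp add: c_def in_chart_at)
  have cont: "continuous (at t within I) \<gamma>"
    using \<gamma> t by (auto simp: C1_curve_on_def continuous_on_eq_continuous_within)
  let ?a = "velocity N I \<gamma> t" and ?u = "cmap c (\<gamma> t)"
  have a: "((cmap c \<circ> \<gamma>) has_vector_derivative ?a) (at t within I)"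
    using C1_curve_chart_derivative[OF \<gamma> t c] by simp
  have "(field_in N c F has_derivative frechet_derivative (field_in N c F) (at ?u)) (at ?u)"
    using F c chart_homeomorphism(2)[OF c(1)] unfolding twice_differentiable_field_def
    by (metis at_within_open differentiable_on_def frechet_derivative_works imageI)
  then have "((\<lambda>s. field_in N c F ((cmap c \<circ> \<gamma>) s)) has_vector_derivative frechet_derivative (field_in N c F) (at ?u) ?a) (at t within I)"
    by (intro has_vector_derivative_compose_derivative[OF a]) simp
  then have b: "((\<lambda>s. in_chart N c (\<gamma> s) (F (\<gamma> s))) has_vector_derivative frechet_derivative (field_in N c F) (at ?u) ?a) (at t within I)"
  proof (rule has_vector_derivative_cong_ev[THEN iffD1, rotated -1])
    show "\<forall>\<^sub>F s in nhds t. s \<in> I \<longrightarrow> field_in N c F ((cmap c \<circ> \<gamma>) s) = in_chart N c (\<gamma> s) (F (\<gamma> s))"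
      using curve_eventually_in_chart[OF cont c]
      by eventually_elim (simp add: field_in_def cinv_cmap[OF c(1)])
    show "field_in N c F ((cmap c \<circ> \<gamma>) t) = in_chart N c (\<gamma> t) (F (\<gamma> t))"
      using c by (simp add: field_in_def cinv_cmap[OF c(1)])
  qed
  show ?thesis
    by (rule has_covariant_derivativeI_chart[OF cont c t a b]) (simp add: nabla_def c_def[symmetric] Let_def)
qed

section \<open>Parallel transport\<close>

text \<open>Stated for a subinterval \<open>J\<close>, with derivatives still relative to the unit
  interval, so that it applies to partial solutions while they are being glued.\<close>

lemma parallel_metric_const:
  assumes cont: "continuous_on {0..1} \<gamma>" and J: "convex J" "J \<subseteq> {0..1}"
    and V: "\<And>t. t \<in> J \<Longrightarrow> has_covariant_derivative N {0..1} \<gamma> V t 0"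
    and W: "\<And>t. t \<in> J \<Longrightarrow> has_covariant_derivative N {0..1} \<gamma> W t 0"
    and t: "t1 \<in> J" "t2 \<in> J"
  shows "metric N (\<gamma> t1) (V t1) (W t1) = metric N (\<gamma> t2) (V t2) (W t2)"
proof -
  have "((\<lambda>s. metric N (\<gamma> s) (V s) (W s)) has_real_derivative 0) (at t within J)" if t: "t \<in> J" for t
  proof -
    have t': "t \<in> {0..1}" using t J by blast
    have "((\<lambda>s. metric N (\<gamma> s) (V s) (W s)) has_real_derivative
        metric N (\<gamma> t) 0 (W t) + metric N (\<gamma> t) (V t) 0) (at t within {0..1})"
      using cont t' by (intro metric_along_derivative at_within_unit_interval V W t)
        (auto simp: continuous_on_eq_continuous_within)
    then show ?thesis
      by (simp add: inner_form_simps[OF inner_form_metric] has_field_derivative_subset[OF _ J(2)])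
  qed
  from has_field_derivative_zero_constant[OF J(1) this] show ?thesis
    using t by auto
qed

text \<open>Metric compatibility takes the place of a uniqueness theorem for differential equations:
  all pairings of \<open>V\<close> and \<open>W\<close> are constant along the curve, hence so is
  the squared norm of the difference.\<close>

lemma parallel_unique:
  assumes cont: "continuous_on {0..1} \<gamma>" and J: "convex J" "J \<subseteq> {0..1}"
    and V: "\<And>t. t \<in> J \<Longrightarrow> has_covariant_derivative N {0..1} \<gamma> V t 0"
    and W: "\<And>t. t \<in> J \<Longrightarrow> has_covariant_derivative N {0..1} \<gamma> W t 0"
    and t: "t1 \<in> J" "t2 \<in> J" and eq: "V t1 = W t1"
  shows "V t2 = W t2"
proof -
  note c = parallel_metric_const[OF cont J _ _ t(2,1)]
  have "metric N (\<gamma> t2) (V t2 - W t2) (V t2 - W t2) = 0"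
    using c[OF V V] c[OF V W] c[OF W V] c[OF W W] eq
    by (simp add: inner_form_simps[OF inner_form_metric])
  then show ?thesis
    by (simp add: inner_form_eq_0[OF inner_form_metric])
qed

text \<open>In a chart a parallel field solves a linear equation. The radius has to serve every
  initial parameter \<open>t1\<close> in the ball, since the continuation argument enters the ball
  at an arbitrary point.\<close>

lemma parallel_local:
  assumes \<gamma>: "C1_curve_on N {0..1} \<gamma>" and t0: "t0 \<in> {0..1}"
  shows "\<exists>\<epsilon>>0. \<forall>t1\<in>{0..1} \<inter> ball t0 \<epsilon>. \<forall>v. \<exists>V. V t1 = v \<and>
    (\<forall>t\<in>{0..1} \<inter> ball t0 \<epsilon>. has_covariant_derivative N {0..1} \<gamma> V t 0)"
proof -
  define c where "c = chart_at N (\<gamma> t0)"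
  have c: "c \<in> atlas N" "\<gamma> t0 \<in> cdom c"
    by (simp_all add: c_def)
  let ?u = "cmap c \<circ> \<gamma>" and ?w = "\<lambda>s. in_chart N c (\<gamma> s) (velocity N {0..1} \<gamma> s)"
  have u0: "?u t0 \<in> img c"
    using c(2) by simp
  obtain r \<mu> K L where b: "r > 0" "K > 0" "cball (?u t0) r \<subseteq> img c"
    and \<Gamma>: "\<And>u a b. u \<in> cball (?u t0) r \<Longrightarrow> norm (christoffel N c u a b) \<le> K * norm a * norm b"
      "\<And>u v a b. u \<in> cball (?u t0) r \<Longrightarrow> v \<in> cball (?u t0) r \<Longrightarrow>
      norm (christoffel N c u a b - christoffel N c v a b) \<le> L * norm (u - v) * norm a * norm b"
    using local_bounds[OF c(1) u0] by metis
  have cont: "continuous_on {0..1} \<gamma>"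
    using \<gamma> by (simp add: C1_curve_on_def)
  then have cont_at: "continuous (at t within {0..1}) \<gamma>" if "t \<in> {0..1}" for t
    using that by (simp add: continuous_on_eq_continuous_within)
  have in_chart: "\<forall>\<^sub>F s in nhds t0. s \<in> {0..1} \<longrightarrow> \<gamma> s \<in> cdom c"
    by (rule curve_eventually_in_chart[OF cont_at[OF t0] c])
  have "continuous (at t0 within {0..1}) ?u"
    using C1_curve_chart_derivative[OF \<gamma> t0 c] by (rule has_vector_derivative_continuous)
  then have near: "\<forall>\<^sub>F s in nhds t0. s \<in> {0..1} \<longrightarrow> ?u s \<in> ball (?u t0) r"
    using b(1) by (intro eventually_nhds_within_preimage) (auto simp: o_def)
  let ?D = "{s \<in> {0..1}. \<gamma> s \<in> cdom c}"
  have w_cont: "continuous_on ?D ?w"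
    using \<gamma> c(1) by (simp add: C1_curve_on_def)
  \<comment> \<open>The 1 makes the bound strict at \<open>t0\<close>, so that it persists
    nearby.\<close>
  define B where "B = norm (?w t0) + 1"
  have "\<forall>\<^sub>F s in nhds t0. s \<in> ?D \<longrightarrow> ?w s \<in> {a. norm a < B}"
    using w_cont t0 c(2)
    by (intro eventually_nhds_within_preimage)
      (auto simp: B_def continuous_on_eq_continuous_within intro!: open_Collect_less continuous_intros)
  with in_chart near have "\<forall>\<^sub>F s in nhds t0. s \<in> {0..1} \<longrightarrow> \<gamma> s \<in> cdom c \<and> ?u s \<in> cball (?u t0) r \<and> norm (?w s) \<le> B"
    by eventually_elim auto
  then obtain \<delta> where \<delta>: "\<delta> > 0"
    and good: "\<And>s. s \<in> {0..1} \<Longrightarrow> dist s t0 < \<delta> \<Longrightarrow> \<gamma> s \<in> cdom c \<and> ?u s \<in> cball (?u t0) r \<and> norm (?w s) \<le> B"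
    unfolding eventually_nhds_metric by blast
  have "B > 0"
    by (simp add: B_def add_nonneg_pos)
  then have KB: "K * B > 0" using b by simp
  \<comment> \<open>The equation will be solved on an interval of length at most
    \<open>2 * \<epsilon>\<close>: the second bound keeps the contraction constant at most 1/2, the
    first keeps the closed interval within the good neighbourhood.\<close>
  define \<epsilon> where "\<epsilon> = min (\<delta> / 2) (1 / (4 * (K * B)))"
  have \<epsilon>: "\<epsilon> > 0" "\<epsilon> < \<delta>" "(K * B) * (2 * \<epsilon>) < 1"
  proof -
    show "\<epsilon> > 0" "\<epsilon> < \<delta>"
      using \<delta> KB by (auto simp: \<epsilon>_def)
    have "(K * B) * (2 * \<epsilon>) \<le> (K * B) * (2 * (1 / (4 * (K * B))))"
      using KB by (intro mult_left_mono) (auto simp: \<epsilon>_def)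
    also have "\<dots> < 1"
      using KB by simp
    finally show "(K * B) * (2 * \<epsilon>) < 1" .
  qed
  define a where "a = max 0 (t0 - \<epsilon>)"
  define e where "e = min 1 (t0 + \<epsilon>)"
  have ae: "a \<le> e" "e - a \<le> 2 * \<epsilon>" "{a..e} \<subseteq> {0..1}" "{0..1} \<inter> ball t0 \<epsilon> \<subseteq> {a..e}"
    using t0 \<epsilon> by (auto simp: a_def e_def dist_real_def)
  have good': "\<gamma> s \<in> cdom c \<and> ?u s \<in> cball (?u t0) r \<and> norm (?w s) \<le> B" if "s \<in> {a..e}" for s
    using that \<epsilon> by (intro good) (auto simp: a_def e_def dist_real_def)
  \<comment> \<open>Vanishing of the covariant derivative reads \<open>X' = A t X\<close> in
    coordinates.\<close>
  define A where "A t v = - christoffel N c (?u t) (?w t) v" for t v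
  show ?thesis
  proof (rule exI[of _ \<epsilon>], intro conjI ballI allI)
    fix t1 v assume t1: "t1 \<in> {0..1} \<inter> ball t0 \<epsilon>"
    have "\<exists>X. X t1 = in_chart N c (\<gamma> t1) v \<and>
      (\<forall>t\<in>{a..e}. (X has_vector_derivative A t (X t)) (at t within {a..e}))"
    proof (rule linear_ode_solution)
      show "t1 \<in> {a..e}" using t1 ae by blast
      fix t assume t: "t \<in> {a..e}"
      have "?u t \<in> img c"
        using good'[OF t] by auto
      then show "linear (A t)"
        unfolding A_def by (intro linear_compose_neg christoffel_linear c)
      show "norm (A t v) \<le> (K * B) * norm v" for v
      proof -
        have "norm (A t v) \<le> K * norm (?w t) * norm v"
          unfolding A_def norm_minus_cancel using good'[OF t] by (intro \<Gamma>) auto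
        also have "\<dots> \<le> K * B * norm v"
          using good'[OF t] b by (intro mult_right_mono mult_left_mono) auto
        finally show ?thesis .
      qed
    next
      fix v
      show "continuous_on {a..e} (\<lambda>t. A t v)"
        unfolding A_def
      proof (intro continuous_on_minus continuous_on_christoffel[OF c(1) _ _ _ b(3) \<Gamma>(2)])
        show "continuous_on {a..e} ?w"
          using good' ae by (intro continuous_on_subset[OF w_cont]) auto
        show "continuous_on {a..e} ?u"
          using good' by (intro continuous_on_compose continuous_on_subset[OF cont ae(3)]
              continuous_on_subset[OF continuous_on_cmap[OF c(1)]]) auto
        show "?u ` {a..e} \<subseteq> cball (?u t0) r"
          using good' by blast
      qed
    next
      have "K * B * (e - a) \<le> K * B * (2 * \<epsilon>)"
        using ae KB by (intro mult_left_mono) auto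
      then show "K * B * (e - a) < 1"
        using \<epsilon> by linarith
    qed (use ae KB in auto)
    then obtain X where X: "X t1 = in_chart N c (\<gamma> t1) v"
      "\<And>t. t \<in> {a..e} \<Longrightarrow> (X has_vector_derivative A t (X t)) (at t within {a..e})"
      by blast
    define V where "V s = from_chart N c (\<gamma> s) (X s)" for s
    have inV: "in_chart N c (\<gamma> s) (V s) = X s" if "s \<in> {a..e}" for s
      unfolding V_def using good'[OF that] by (intro in_from_chart c) auto
    show "\<exists>V. V t1 = v \<and> (\<forall>t\<in>{0..1} \<inter> ball t0 \<epsilon>. has_covariant_derivative N {0..1} \<gamma> V t 0)"
    proof (intro exI conjI ballI)
      show "V t1 = v"
        unfolding V_def X using t1 ae good' by (intro from_in_chart c) auto
      fix t assume t: "t \<in> {0..1} \<inter> ball t0 \<epsilon>"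
      then have t': "t \<in> {a..e}" "t \<in> {0..1}" using ae(4) by blast+
      \<comment> \<open>On the ball the interval \<open>{a..e}\<close> and the unit interval
        coincide, also near the endpoints 0 and 1.\<close>
      have within: "at t within {a..e} = at t within {0..1}"
        using t ae(3,4) by (intro at_within_nhd[of t "ball t0 \<epsilon>"]) (blast | simp)+
      have ev: "\<forall>\<^sub>F s in nhds t. s \<in> ball t0 \<epsilon>"
        using t by (intro eventually_nhds_in_open) auto
      have "((\<lambda>s. in_chart N c (\<gamma> s) (V s)) has_vector_derivative A t (X t)) (at t within {0..1})"
        using X(2)[OF t'(1), unfolded within]
      proof (rule has_vector_derivative_cong_ev[THEN iffD1, rotated -1])
        show "\<forall>\<^sub>F s in nhds t. s \<in> {0..1} \<longrightarrow> X s = in_chart N c (\<gamma> s) (V s)"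
          using ev by eventually_elim (use inV[symmetric] ae(4) in blast)
      qed (use inV t' in auto)
      moreover have "((cmap c \<circ> \<gamma>) has_vector_derivative ?w t) (at t within {0..1})"
        using good'[OF t'(1)] by (intro C1_curve_chart_derivative[OF \<gamma> t'(2) c(1)]) auto
      ultimately show "has_covariant_derivative N {0..1} \<gamma> V t 0"
        using good'[OF t'(1)] linear_0[OF in_chart_linear[OF c(1)]]
        by (intro has_covariant_derivativeI_chart[OF cont_at[OF t'(2)] c(1) _ t'(2)])
          (auto simp: A_def inV[OF t'(1)])
    qed
  qed (rule \<epsilon>)
qed

text \<open>Openness keeps each field parallel in a neighbourhood of every parameter of its part;
  convexity makes the overlap an interval, where uniqueness forces agreement.\<close>

lemma parallel_glue:
  assumes cont: "continuous_on {0..1} \<gamma>" and O: "open A" "convex A" "open B" "convex B"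
    and t: "t \<in> {0..1}" "t \<in> A" "t \<in> B" and eq: "V t = W t"
    and V: "\<And>s. s \<in> {0..1} \<inter> A \<Longrightarrow> has_covariant_derivative N {0..1} \<gamma> V s 0"
    and W: "\<And>s. s \<in> {0..1} \<inter> B \<Longrightarrow> has_covariant_derivative N {0..1} \<gamma> W s 0"
  obtains X where "\<And>s. s \<in> A \<Longrightarrow> X s = V s"
    and "\<And>s. s \<in> {0..1} \<inter> (A \<union> B) \<Longrightarrow> has_covariant_derivative N {0..1} \<gamma> X s 0"
proof
  let ?X = "\<lambda>s. if s \<in> A then V s else W s"
  have VW: "V s = W s" if "s \<in> {0..1}" "s \<in> A" "s \<in> B" for s
    by (rule parallel_unique[OF cont, of "{0..1} \<inter> (A \<inter> B)"])
      (use O V W t eq that in \<open>auto intro!: convex_Int\<close>)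
  show "?X s = V s" if "s \<in> A" for s using that by simp
  fix s assume s: "s \<in> {0..1} \<inter> (A \<union> B)"
  show "has_covariant_derivative N {0..1} \<gamma> ?X s 0"
  proof (cases "s \<in> A")
    case True
    have "\<forall>\<^sub>F x in nhds s. x \<in> A"
      using O True by (intro eventually_nhds_in_open)
    then have "\<forall>\<^sub>F x in nhds s. x \<in> {0..1} \<longrightarrow> \<gamma> x = \<gamma> x \<and> V x = ?X x"
      by eventually_elim auto
    then show ?thesis
      by (rule has_covariant_derivative_cong) (use s True V in auto)
  next
    case False
    with s have "\<forall>\<^sub>F x in nhds s. x \<in> B"
      using O by (intro eventually_nhds_in_open) auto
    then have "\<forall>\<^sub>F x in nhds s. x \<in> {0..1} \<longrightarrow> \<gamma> x = \<gamma> x \<and> W x = ?X x"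
      by eventually_elim (use VW in auto)
    then show ?thesis
      by (rule has_covariant_derivative_cong) (use s False W in auto)
  qed
qed

lemma parallel_exists:
  assumes \<gamma>: "C1_curve_on N {0..1} \<gamma>" and \<alpha>: "\<alpha> \<in> {0..1}"
  shows "\<exists>V. parallel_along N {0..1} \<gamma> V \<and> V \<alpha> = v"
proof -
  let ?I = "{0..1::real}"
  have cont: "continuous_on ?I \<gamma>"
    using \<gamma> by (simp add: C1_curve_on_def)
  \<comment> \<open>A partial solution: a field parallel on an open interval that already contains
    the initial parameter \<alpha>.\<close>
  define Q where "Q A V \<longleftrightarrow> open A \<and> convex A \<and> \<alpha> \<in> A \<and> V \<alpha> = v \<and>
    (\<forall>s\<in>?I \<inter> A. has_covariant_derivative N ?I \<gamma> V s 0)" for A V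
  define P where "P t \<longleftrightarrow> (\<exists>A V. t \<in> A \<and> Q A V)" for t
  have P: "P t" if t: "t \<in> ?I" for t
  proof (rule unit_interval_induction[of P, OF _ \<alpha> t])
    show "P \<alpha>"
    proof -
      obtain \<epsilon> where "\<epsilon> > 0" "\<forall>t1\<in>?I \<inter> ball \<alpha> \<epsilon>. \<forall>v. \<exists>V. V t1 = v \<and>
          (\<forall>t\<in>?I \<inter> ball \<alpha> \<epsilon>. has_covariant_derivative N ?I \<gamma> V t 0)"
        using parallel_local[OF \<gamma> \<alpha>] by blast
      moreover from this obtain V where "V \<alpha> = v" "\<forall>t\<in>?I \<inter> ball \<alpha> \<epsilon>. has_covariant_derivative N ?I \<gamma> V t 0"
        using \<alpha> by (metis Int_iff centre_in_ball)
      ultimately have "\<alpha> \<in> ball \<alpha> \<epsilon>" "Q (ball \<alpha> \<epsilon>) V"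
        by (auto simp: Q_def)
      then show ?thesis
        unfolding P_def by blast
    qed
    fix t0 assume t0: "t0 \<in> ?I"
    obtain \<epsilon> where \<epsilon>: "\<epsilon> > 0" "\<And>t1 v. t1 \<in> ?I \<inter> ball t0 \<epsilon> \<Longrightarrow> \<exists>V. V t1 = v \<and>
        (\<forall>t\<in>?I \<inter> ball t0 \<epsilon>. has_covariant_derivative N ?I \<gamma> V t 0)"
      using parallel_local[OF \<gamma> t0] by blast
    have "P y" if x: "x \<in> ?I \<inter> ball t0 \<epsilon>" and y: "y \<in> ?I \<inter> ball t0 \<epsilon>" and "P x" for x y
    proof -
      obtain A V where A: "x \<in> A" "Q A V"
        using \<open>P x\<close> P_def by blast
      obtain W where W: "W x = V x" "\<forall>t\<in>?I \<inter> ball t0 \<epsilon>. has_covariant_derivative N ?I \<gamma> W t 0"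
        using \<epsilon>(2)[OF x] by blast
      have x': "x \<in> ?I" "x \<in> ball t0 \<epsilon>"
        using x by auto
      obtain X where "\<And>s. s \<in> A \<Longrightarrow> X s = V s"
        "\<And>s. s \<in> ?I \<inter> (A \<union> ball t0 \<epsilon>) \<Longrightarrow> has_covariant_derivative N ?I \<gamma> X s 0"
        using parallel_glue[OF cont, of A "ball t0 \<epsilon>" x V W] A W x' unfolding Q_def
        by (metis convex_ball open_ball)
      then have "Q (A \<union> ball t0 \<epsilon>) X"
        using A x' by (auto simp: Q_def intro!: convex_Un_real)
      then show "P y"
        using y unfolding P_def by blast
    qed
    then show "\<exists>\<epsilon>>0. \<forall>x\<in>?I \<inter> ball t0 \<epsilon>. \<forall>y\<in>?I \<inter> ball t0 \<epsilon>. P x \<longrightarrow> P y"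
      using \<epsilon>(1) by blast
  qed
  \<comment> \<open>The endpoints 0 and 1 may be reached by different partial solutions. They agree
    at \<alpha>, so a last gluing covers the unit interval.\<close>
  obtain A V where A: "0 \<in> A" "Q A V"
    using P[of 0] unfolding P_def by (auto simp del: Int_iff)
  obtain B W where B: "1 \<in> B" "Q B W"
    using P[of 1] unfolding P_def by (auto simp del: Int_iff)
  obtain X where X: "\<And>s. s \<in> A \<Longrightarrow> X s = V s"
      "\<And>s. s \<in> ?I \<inter> (A \<union> B) \<Longrightarrow> has_covariant_derivative N ?I \<gamma> X s 0"
    using parallel_glue[OF cont, of A B \<alpha> V W] A B \<alpha> unfolding Q_def by metis
  have "convex (A \<union> B)"
    using A B by (intro convex_Un_real[of A B \<alpha>]) (auto simp: Q_def)
  then have "?I \<subseteq> A \<union> B"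
    using A(1) B(1) closed_segment_subset[of 0 "A \<union> B" 1] by (simp add: closed_segment_eq_real_ivl)
  then have "parallel_along N ?I \<gamma> X"
    using X(2) cont unfolding parallel_along_def by blast
  moreover have "X \<alpha> = v"
    using X(1) A by (simp add: Q_def)
  ultimately show ?thesis by blast
qed

lemma parallel_transport_eq:
  assumes V: "parallel_along N {0..1} \<gamma> V" and t: "\<alpha> \<in> {0..1}" "\<beta> \<in> {0..1}"
  shows "parallel_transport N \<gamma> \<alpha> \<beta> (V \<alpha>) = V \<beta>"
  unfolding parallel_transport_def
proof (rule the_equality)
  show "\<exists>W. parallel_along N {0..1} \<gamma> W \<and> W \<alpha> = V \<alpha> \<and> W \<beta> = V \<beta>"
    using V by blast
  fix w assume "\<exists>W. parallel_along N {0..1} \<gamma> W \<and> W \<alpha> = V \<alpha> \<and> W \<beta> = w"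
  then obtain W where W: "parallel_along N {0..1} \<gamma> W" "W \<alpha> = V \<alpha>" "W \<beta> = w" by blast
  have "W \<beta> = V \<beta>"
    by (rule parallel_unique[of \<gamma> "{0..1}" W V \<alpha>]) (use V W t in \<open>auto simp: parallel_along_def\<close>)
  then show "w = V \<beta>" using W by simp
qed

text \<open>Isometry in mixed form, with a whole parallel field in one slot and a transported vector
  in the other. It moves transport across the metric.\<close>

lemma parallel_transport_metric:
  assumes \<gamma>: "C1_curve_on N {0..1} \<gamma>" and V: "parallel_along N {0..1} \<gamma> V"
    and t: "\<alpha> \<in> {0..1}" "\<beta> \<in> {0..1}"
  shows "metric N (\<gamma> \<beta>) (V \<beta>) (parallel_transport N \<gamma> \<alpha> \<beta> w) = metric N (\<gamma> \<alpha>) (V \<alpha>) w"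
proof -
  obtain W where W: "parallel_along N {0..1} \<gamma> W" "W \<alpha> = w"
    using parallel_exists[OF \<gamma> t(1)] by blast
  have "metric N (\<gamma> \<beta>) (V \<beta>) (W \<beta>) = metric N (\<gamma> \<alpha>) (V \<alpha>) (W \<alpha>)"
    by (rule parallel_metric_const[of \<gamma> "{0..1}"]) (use V W t in \<open>auto simp: parallel_along_def\<close>)
  then show ?thesis
    using parallel_transport_eq[OF W(1) t] W by simp
qed

text \<open>Pairing with the parallel field that ends in \<open>z\<close> turns the claim into
  additivity of the metric at \<open>\<gamma> \<alpha>\<close>.\<close>

lemma parallel_transport_add:
  assumes \<gamma>: "C1_curve_on N {0..1} \<gamma>" and t: "\<alpha> \<in> {0..1}" "\<beta> \<in> {0..1}"
  shows "parallel_transport N \<gamma> \<alpha> \<beta> (v + w) = parallel_transport N \<gamma> \<alpha> \<beta> v + parallel_transport N \<gamma> \<alpha> \<beta> w"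
proof (rule inner_form_eqI[OF inner_form_metric])
  fix z
  obtain Z where Z: "parallel_along N {0..1} \<gamma> Z" "Z \<beta> = z"
    using parallel_exists[OF \<gamma> t(2)] by blast
  show "metric N (\<gamma> \<beta>) (parallel_transport N \<gamma> \<alpha> \<beta> (v + w)) z =
    metric N (\<gamma> \<beta>) (parallel_transport N \<gamma> \<alpha> \<beta> v + parallel_transport N \<gamma> \<alpha> \<beta> w) z"
    using parallel_transport_metric[OF \<gamma> Z(1) t] unfolding Z(2)
    by (simp add: inner_form_commute[OF inner_form_metric, of _ _ z] inner_form_simps[OF inner_form_metric])
qed

lemma parallel_transport_tnorm:
  assumes \<gamma>: "C1_curve_on N {0..1} \<gamma>" and t: "\<alpha> \<in> {0..1}" "\<beta> \<in> {0..1}"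
  shows "tnorm N (\<gamma> \<beta>) (parallel_transport N \<gamma> \<alpha> \<beta> v) = tnorm N (\<gamma> \<alpha>) v"
proof -
  obtain V where V: "parallel_along N {0..1} \<gamma> V" "V \<alpha> = v"
    using parallel_exists[OF \<gamma> t(1)] by blast
  show ?thesis
    using parallel_transport_metric[OF \<gamma> V(1) t, of v] parallel_transport_eq[OF V(1) t] V(2)
    by (simp add: tnorm_def)
qed

section \<open>Geodesics and the exponential map\<close>

lemma geodesic_imp_C1_curve:
  assumes \<gamma>: "geodesic_on N I \<gamma>"
  shows "C1_curve_on N I \<gamma>"
  unfolding C1_curve_on_def
proof (intro conjI ballI)
  show "continuous_on I \<gamma>"
    using \<gamma> by (simp add: geodesic_on_def parallel_along_def)
  have cov: "has_covariant_derivative N I \<gamma> (velocity N I \<gamma>) t 0" if "t \<in> I" for t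
    using \<gamma> that by (simp add: geodesic_on_def parallel_along_def)
  show "(cmap (chart_at N (\<gamma> t)) \<circ> \<gamma>) differentiable (at t within I)" if t: "t \<in> I" for t
    using has_covariant_derivativeD[OF cov[OF t] chart_at_atlas] by (metis differentiableI_vector)
  fix c assume c: "c \<in> atlas N"
  show "continuous_on {s \<in> I. \<gamma> s \<in> cdom c} (\<lambda>s. in_chart N c (\<gamma> s) (velocity N I \<gamma> s))"
    unfolding continuous_on_eq_continuous_within
  proof
    fix s assume s: "s \<in> {s \<in> I. \<gamma> s \<in> cdom c}"
    then obtain b where "((\<lambda>s. in_chart N c (\<gamma> s) (velocity N I \<gamma> s)) has_vector_derivative b) (at s within I)"
      using has_covariant_derivativeD[OF cov c] by (metis (no_types, lifting) mem_Collect_eq)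
    then have "continuous (at s within I) (\<lambda>s. in_chart N c (\<gamma> s) (velocity N I \<gamma> s))"
      by (rule has_vector_derivative_continuous)
    then show "continuous (at s within {s \<in> I. \<gamma> s \<in> cdom c}) (\<lambda>s. in_chart N c (\<gamma> s) (velocity N I \<gamma> s))"
      by (rule continuous_within_subset) auto
  qed
qed

text \<open>Uniqueness of derivatives identifies the curve derivative inside the covariant
  derivative with the velocity. This gives the geodesic equation as a first-order system for
  position and velocity.\<close>

lemma geodesic_chart:
  assumes \<gamma>: "geodesic_on N I \<gamma>" and t: "t \<in> I" "at t within I \<noteq> bot" and c: "c \<in> atlas N" "\<gamma> t \<in> cdom c"
  defines "w \<equiv> \<lambda>s. in_chart N c (\<gamma> s) (velocity N I \<gamma> s)"
  shows "((cmap c \<circ> \<gamma>) has_vector_derivative w t) (at t within I)"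
    and "(w has_vector_derivative - christoffel N c (cmap c (\<gamma> t)) (w t) (w t)) (at t within I)"
proof -
  show 1: "((cmap c \<circ> \<gamma>) has_vector_derivative w t) (at t within I)"
    unfolding w_def by (rule C1_curve_chart_derivative[OF geodesic_imp_C1_curve[OF \<gamma>] t(1) c])
  have cov: "has_covariant_derivative N I \<gamma> (velocity N I \<gamma>) t 0"
    using \<gamma> t by (simp add: geodesic_on_def parallel_along_def)
  obtain a b where ab: "((cmap c \<circ> \<gamma>) has_vector_derivative a) (at t within I)"
    "(w has_vector_derivative b) (at t within I)"
    "in_chart N c (\<gamma> t) 0 = b + christoffel N c (cmap c (\<gamma> t)) a (w t)"
    using has_covariant_derivativeD[OF cov c] unfolding w_def .
  have "a = w t"
    by (rule vector_derivative_unique_within[OF t(2) ab(1) 1])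
  with ab show "(w has_vector_derivative - christoffel N c (cmap c (\<gamma> t)) (w t) (w t)) (at t within I)"
    by (simp add: linear_0[OF in_chart_linear[OF c]] add_eq_0_iff2)
qed

text \<open>
  The symmetric form in \<open>s\<close> and \<open>t\<close> is the one that \<open>unit_interval_induction\<close> needs.
\<close>

lemma geodesic_unique_local:
  assumes \<gamma>: "geodesic_on N {0..1} \<gamma>" and \<sigma>: "geodesic_on N {0..1} \<sigma>" and t0: "t0 \<in> {0..1}"
    and eq: "\<gamma> t0 = \<sigma> t0"
  shows "\<exists>\<epsilon>>0. \<forall>s\<in>{0..1} \<inter> ball t0 \<epsilon>. \<forall>t\<in>{0..1} \<inter> ball t0 \<epsilon>.
    \<gamma> s = \<sigma> s \<and> velocity N {0..1} \<gamma> s = velocity N {0..1} \<sigma> s \<longrightarrow>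
    \<gamma> t = \<sigma> t \<and> velocity N {0..1} \<gamma> t = velocity N {0..1} \<sigma> t"
proof -
  define c where "c = chart_at N (\<gamma> t0)"
  have c: "c \<in> atlas N" "\<gamma> t0 \<in> cdom c"
    by (simp_all add: c_def)
  let ?o = "cmap c (\<gamma> t0)"
  let ?w = "\<lambda>\<gamma> s. in_chart N c (\<gamma> s) (velocity N {0..1} \<gamma> s)"
  obtain r \<mu> K L where b: "r > 0" "K > 0" "L \<ge> 0" "cball ?o r \<subseteq> img c"
    and \<Gamma>: "\<And>u a b. u \<in> cball ?o r \<Longrightarrow> norm (christoffel N c u a b) \<le> K * norm a * norm b"
      "\<And>u v a b. u \<in> cball ?o r \<Longrightarrow> v \<in> cball ?o r \<Longrightarrow>
      norm (christoffel N c u a b - christoffel N c v a b) \<le> L * norm (u - v) * norm a * norm b"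
    using local_bounds[OF c(1) imageI[OF c(2)]] by metis
  define B where "B = norm (?w \<gamma> t0) + norm (?w \<sigma> t0) + 1"
  have near: "\<forall>\<^sub>F s in nhds t0. s \<in> {0..1} \<longrightarrow> \<gamma> s \<in> cdom c \<and> cmap c (\<gamma> s) \<in> cball ?o r \<and> norm (?w \<gamma> s) \<le> B"
    if \<gamma>: "geodesic_on N {0..1} \<gamma>" and \<gamma>t0: "\<gamma> t0 \<in> cdom c" "cmap c (\<gamma> t0) = ?o" and B: "norm (?w \<gamma> t0) < B" for \<gamma>
  proof -
    note g = geodesic_chart[OF \<gamma> t0 at_within_unit_interval[OF t0] c(1) \<gamma>t0(1)]
    have "continuous (at t0 within {0..1}) \<gamma>"
      using \<gamma> t0 by (auto simp: geodesic_on_def parallel_along_def continuous_on_eq_continuous_within)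
    then have 1: "\<forall>\<^sub>F s in nhds t0. s \<in> {0..1} \<longrightarrow> \<gamma> s \<in> cdom c"
      using c(1) \<gamma>t0(1) by (rule curve_eventually_in_chart)
    have 2: "\<forall>\<^sub>F s in nhds t0. s \<in> {0..1} \<longrightarrow> (cmap c \<circ> \<gamma>) s \<in> ball ?o r"
      using has_vector_derivative_continuous[OF g(1)] b(1) \<gamma>t0 by (intro eventually_nhds_within_preimage) (auto simp: o_def)
    have 3: "\<forall>\<^sub>F s in nhds t0. s \<in> {0..1} \<longrightarrow> ?w \<gamma> s \<in> {a. norm a < B}"
      using has_vector_derivative_continuous[OF g(2)] B
      by (intro eventually_nhds_within_preimage) (auto intro!: open_Collect_less continuous_intros)
    from 1 2 3 show ?thesis
      by eventually_elim auto
  qed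
  have "\<forall>\<^sub>F s in nhds t0. s \<in> {0..1} \<longrightarrow> \<gamma> s \<in> cdom c \<and> cmap c (\<gamma> s) \<in> cball ?o r \<and> norm (?w \<gamma> s) \<le> B"
    by (rule near[OF \<gamma>]) (use c in \<open>auto simp: B_def add_nonneg_pos\<close>)
  moreover have "\<forall>\<^sub>F s in nhds t0. s \<in> {0..1} \<longrightarrow> \<sigma> s \<in> cdom c \<and> cmap c (\<sigma> s) \<in> cball ?o r \<and> norm (?w \<sigma> s) \<le> B"
    by (rule near[OF \<sigma>]) (use c eq in \<open>auto simp: B_def add_nonneg_pos\<close>)
  ultimately have "\<forall>\<^sub>F s in nhds t0. s \<in> {0..1} \<longrightarrow>
      (\<gamma> s \<in> cdom c \<and> cmap c (\<gamma> s) \<in> cball ?o r \<and> norm (?w \<gamma> s) \<le> B) \<and>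
      (\<sigma> s \<in> cdom c \<and> cmap c (\<sigma> s) \<in> cball ?o r \<and> norm (?w \<sigma> s) \<le> B)"
    by eventually_elim blast
  then obtain \<epsilon> where \<epsilon>: "\<epsilon> > 0" and good: "\<And>s. s \<in> {0..1} \<inter> ball t0 \<epsilon> \<Longrightarrow>
      (\<gamma> s \<in> cdom c \<and> cmap c (\<gamma> s) \<in> cball ?o r \<and> norm (?w \<gamma> s) \<le> B) \<and>
      (\<sigma> s \<in> cdom c \<and> cmap c (\<sigma> s) \<in> cball ?o r \<and> norm (?w \<sigma> s) \<le> B)"
    unfolding eventually_nhds_metric by (auto simp: dist_commute)
  let ?J = "{0..1} \<inter> ball t0 \<epsilon>"
  let ?\<Gamma> = "\<lambda>\<gamma> s. christoffel N c (cmap c (\<gamma> s)) (?w \<gamma> s) (?w \<gamma> s)"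
  define du where "du s = cmap c (\<gamma> s) - cmap c (\<sigma> s)" for s
  define dw where "dw s = ?w \<gamma> s - ?w \<sigma> s" for s
  \<comment> \<open>Squared distance in position and velocity. The geodesic equation is quadratic in
    the velocity, hence Lipschitz only as long as the velocities are bounded by
    \<open>B\<close>.\<close>
  define \<phi> where "\<phi> s = du s \<bullet> du s + dw s \<bullet> dw s" for s
  define M where "M = L * B\<^sup>2 + 2 * (K * B)"
  have B: "B \<ge> 0" by (simp add: B_def)
  have M: "M \<ge> 0" using b B by (simp add: M_def)
  have \<Gamma>bound: "norm (?\<Gamma> \<gamma> s - ?\<Gamma> \<sigma> s) \<le> M * (norm (du s) + norm (dw s))" if s: "s \<in> ?J" for s
  proof -
    note g = good[OF s]
    let ?u = "cmap c (\<gamma> s)" and ?v = "cmap c (\<sigma> s)" and ?a = "?w \<gamma> s" and ?b = "?w \<sigma> s"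
    have uv: "?u \<in> cball ?o r" "?v \<in> cball ?o r" and ab: "norm ?a \<le> B" "norm ?b \<le> B"
      using g by simp_all
    have v: "?v \<in> img c" using b(4) uv(2) by blast
    have lin: "christoffel N c ?v (?a - ?b) ?a = christoffel N c ?v ?a ?a - christoffel N c ?v ?b ?a"
      "christoffel N c ?v ?b (?a - ?b) = christoffel N c ?v ?b ?a - christoffel N c ?v ?b ?b"
      using linear_diff[OF christoffel_linear(2)[OF c(1) v]] linear_diff[OF christoffel_linear(1)[OF c(1) v]] by auto
    \<comment> \<open>Exchanges the base point first, then the two velocity arguments one at a
      time.\<close>
    have eq: "?\<Gamma> \<gamma> s - ?\<Gamma> \<sigma> s = (christoffel N c ?u ?a ?a - christoffel N c ?v ?a ?a)
        + (christoffel N c ?v (?a - ?b) ?a + christoffel N c ?v ?b (?a - ?b))"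
      unfolding lin by simp
    have "norm (?\<Gamma> \<gamma> s - ?\<Gamma> \<sigma> s) \<le> norm (christoffel N c ?u ?a ?a - christoffel N c ?v ?a ?a)
        + (norm (christoffel N c ?v (?a - ?b) ?a) + norm (christoffel N c ?v ?b (?a - ?b)))"
      unfolding eq by (intro order_trans[OF norm_triangle_ineq] add_left_mono norm_triangle_ineq)
    also have "\<dots> \<le> L * norm (du s) * B * B + (K * norm (dw s) * B + K * B * norm (dw s))"
    proof (intro add_mono)
      have "norm (christoffel N c ?u ?a ?a - christoffel N c ?v ?a ?a) \<le> L * norm (du s) * norm ?a * norm ?a"
        unfolding du_def by (rule \<Gamma>(2)[OF uv])
      also have "\<dots> \<le> L * norm (du s) * B * B"
        using b(3) B by (intro mult_mono mult_nonneg_nonneg norm_ge_zero order_refl ab) auto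
      finally show "norm (christoffel N c ?u ?a ?a - christoffel N c ?v ?a ?a) \<le> L * norm (du s) * B * B" .
      have "norm (christoffel N c ?v (?a - ?b) ?a) \<le> K * norm (dw s) * norm ?a"
        unfolding dw_def by (rule \<Gamma>(1)[OF uv(2)])
      also have "\<dots> \<le> K * norm (dw s) * B"
        using b(2) by (intro mult_left_mono mult_nonneg_nonneg norm_ge_zero ab) simp
      finally show "norm (christoffel N c ?v (?a - ?b) ?a) \<le> K * norm (dw s) * B" .
      have "norm (christoffel N c ?v ?b (?a - ?b)) \<le> K * norm ?b * norm (dw s)"
        unfolding dw_def by (rule \<Gamma>(1)[OF uv(2)])
      also have "\<dots> \<le> K * B * norm (dw s)"
        using b(2) by (intro mult_right_mono mult_left_mono norm_ge_zero ab) simp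
      finally show "norm (christoffel N c ?v ?b (?a - ?b)) \<le> K * B * norm (dw s)" .
    qed
    also have "\<dots> = (L * B\<^sup>2) * norm (du s) + (2 * (K * B)) * norm (dw s)"
      by (simp add: power2_eq_square)
    also have "\<dots> \<le> M * norm (du s) + M * norm (dw s)"
      using b B by (intro add_mono mult_right_mono) (auto simp: M_def)
    finally show ?thesis
      by (simp add: distrib_left)
  qed
  define \<phi>' where "\<phi>' s = 2 * (du s \<bullet> dw s) + 2 * (dw s \<bullet> (?\<Gamma> \<sigma> s - ?\<Gamma> \<gamma> s))" for s
  have \<phi>: "(\<phi> has_real_derivative \<phi>' s) (at s within ?J)" if s: "s \<in> ?J" for s
  proof -
    have s': "s \<in> {0..1}" using s by blast
    note g = geodesic_chart[OF \<gamma> s' at_within_unit_interval[OF s'] c(1), THEN has_vector_derivative_within_subset[of _ _ _ _ ?J]]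
    note h = geodesic_chart[OF \<sigma> s' at_within_unit_interval[OF s'] c(1), THEN has_vector_derivative_within_subset[of _ _ _ _ ?J]]
    have "(du has_vector_derivative dw s) (at s within ?J)"
      using has_vector_derivative_diff[OF g(1) h(1)] good[OF s] by (simp add: du_def[abs_def] dw_def o_def)
    moreover have "(dw has_vector_derivative ?\<Gamma> \<sigma> s - ?\<Gamma> \<gamma> s) (at s within ?J)"
      using has_vector_derivative_diff[OF g(2) h(2)] good[OF s] by (simp add: dw_def[abs_def])
    ultimately show ?thesis
      unfolding \<phi>_def[abs_def] \<phi>'_def has_vector_derivative_def has_field_derivative_def
      by (auto intro!: derivative_eq_intros simp: inner_commute algebra_simps fun_eq_iff)
  qed
  have bnd: "\<bar>\<phi>' s\<bar> \<le> (1 + 3 * M) * \<phi> s" if s: "s \<in> ?J" for s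
  proof -
    let ?x = "norm (du s)" and ?y = "norm (dw s)"
    have "\<bar>\<phi>' s\<bar> \<le> 2 * \<bar>du s \<bullet> dw s\<bar> + 2 * \<bar>dw s \<bullet> (?\<Gamma> \<sigma> s - ?\<Gamma> \<gamma> s)\<bar>"
      unfolding \<phi>'_def by linarith
    also have "\<dots> \<le> 2 * (?x * ?y) + 2 * (?y * (M * (?x + ?y)))"
    proof (intro add_mono mult_left_mono)
      show "\<bar>du s \<bullet> dw s\<bar> \<le> ?x * ?y"
        by (rule Cauchy_Schwarz_ineq2)
      have "\<bar>dw s \<bullet> (?\<Gamma> \<sigma> s - ?\<Gamma> \<gamma> s)\<bar> \<le> ?y * norm (?\<Gamma> \<sigma> s - ?\<Gamma> \<gamma> s)"
        by (rule Cauchy_Schwarz_ineq2)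
      also have "\<dots> \<le> ?y * (M * (?x + ?y))"
        using \<Gamma>bound[OF s] by (intro mult_left_mono) (auto simp: norm_minus_commute)
      finally show "\<bar>dw s \<bullet> (?\<Gamma> \<sigma> s - ?\<Gamma> \<gamma> s)\<bar> \<le> ?y * (M * (?x + ?y))" .
    qed auto
    also have "\<dots> = (1 + M) * (2 * ?x * ?y) + 2 * M * ?y\<^sup>2"
      by (simp add: algebra_simps power2_eq_square)
    also have "\<dots> \<le> (1 + M) * (?x\<^sup>2 + ?y\<^sup>2) + 2 * M * (?x\<^sup>2 + ?y\<^sup>2)"
      using M sum_squares_bound[of ?x ?y] by (intro add_mono mult_left_mono) auto
    also have "\<dots> = (1 + 3 * M) * \<phi> s"
      by (simp add: \<phi>_def power2_norm_eq_inner algebra_simps)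
    finally show ?thesis .
  qed
  show ?thesis
  proof (intro exI conjI ballI impI)
    fix s t assume s: "s \<in> ?J" and t: "t \<in> ?J"
      and H: "\<gamma> s = \<sigma> s \<and> velocity N {0..1} \<gamma> s = velocity N {0..1} \<sigma> s"
    have "\<phi> t = 0"
      by (rule gronwall_zero[OF _ s t \<phi> bnd]) (use H in \<open>auto simp: \<phi>_def du_def dw_def intro!: convex_Int\<close>)
    then have "du t = 0 \<and> dw t = 0"
      by (simp add: \<phi>_def add_nonneg_eq_0_iff)
    then have uw: "cmap c (\<gamma> t) = cmap c (\<sigma> t)" "?w \<gamma> t = ?w \<sigma> t"
      by (auto simp: du_def dw_def)
    have dom: "\<gamma> t \<in> cdom c" "\<sigma> t \<in> cdom c"
      using good[OF t] by blast+
    show pos: "\<gamma> t = \<sigma> t"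
      using cinv_cmap[OF c(1) dom(1)] unfolding uw(1) cinv_cmap[OF c(1) dom(2)] ..
    show "velocity N {0..1} \<gamma> t = velocity N {0..1} \<sigma> t"
      using from_in_chart[OF c(1) dom(1), of "velocity N {0..1} \<gamma> t"]
      unfolding uw(2) unfolding pos from_in_chart[OF c(1) dom(2)] ..
  qed (rule \<epsilon>)
qed

lemma geodesic_unique:
  assumes \<gamma>: "geodesic_on N {0..1} \<gamma>" and \<sigma>: "geodesic_on N {0..1} \<sigma>"
    and eq: "\<gamma> 0 = \<sigma> 0" "velocity N {0..1} \<gamma> 0 = velocity N {0..1} \<sigma> 0" and t: "t \<in> {0..1}"
  shows "\<gamma> t = \<sigma> t"
proof -
  let ?I = "{0..1::real}"
  let ?P = "\<lambda>t. \<gamma> t = \<sigma> t \<and> velocity N ?I \<gamma> t = velocity N ?I \<sigma> t"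
  have cont: "continuous (at t within ?I) \<gamma>" "continuous (at t within ?I) \<sigma>" if "t \<in> ?I" for t
    using \<gamma> \<sigma> that by (auto simp: geodesic_on_def parallel_along_def continuous_on_eq_continuous_within)
  have "?P t"
  proof (rule unit_interval_induction[of ?P 0])
    fix t0 assume t0: "t0 \<in> ?I"
    show "\<exists>\<epsilon>>0. \<forall>s\<in>?I \<inter> ball t0 \<epsilon>. \<forall>t\<in>?I \<inter> ball t0 \<epsilon>. ?P s \<longrightarrow> ?P t"
    \<comment> \<open>If the curves differ at \<open>t0\<close>, the Hausdorff property separates
      them nearby, so \<open>?P\<close> fails on a whole neighbourhood and the local condition holds
      vacuously.\<close>
    proof (cases "\<gamma> t0 = \<sigma> t0")
      case True
      then show ?thesis
        using geodesic_unique_local[OF \<gamma> \<sigma> t0] by blast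
    next
      case False
      then obtain U V where UV: "open U" "open V" "\<gamma> t0 \<in> U" "\<sigma> t0 \<in> V" "U \<inter> V = {}"
        by (metis hausdorff)
      have "\<forall>\<^sub>F s in nhds t0. s \<in> ?I \<longrightarrow> \<gamma> s \<noteq> \<sigma> s"
        using eventually_nhds_within_preimage[OF cont(1)[OF t0] UV(1,3)]
          eventually_nhds_within_preimage[OF cont(2)[OF t0] UV(2,4)]
        by eventually_elim (use UV in auto)
      then show ?thesis
        unfolding eventually_nhds_metric by (auto simp: dist_commute)
    qed
  qed (use eq t in auto)
  then show ?thesis by blast
qed

lemma riemannian_exp_eq:
  assumes "geodesic_on N {0..1} \<gamma>" "\<gamma> 0 = p" "velocity N {0..1} \<gamma> 0 = v"
  shows "riemannian_exp N p v = \<gamma> 1"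
  unfolding riemannian_exp_def
proof (rule the_equality)
  show "\<exists>\<sigma>. geodesic_on N {0..1} \<sigma> \<and> \<sigma> 0 = p \<and> velocity N {0..1} \<sigma> 0 = v \<and> \<sigma> 1 = \<gamma> 1"
    using assms by blast
  fix q assume "\<exists>\<sigma>. geodesic_on N {0..1} \<sigma> \<and> \<sigma> 0 = p \<and> velocity N {0..1} \<sigma> 0 = v \<and> \<sigma> 1 = q"
  then obtain \<sigma> where \<sigma>: "geodesic_on N {0..1} \<sigma>" "\<sigma> 0 = p" "velocity N {0..1} \<sigma> 0 = v" "\<sigma> 1 = q"
    by blast
  have "\<sigma> 1 = \<gamma> 1"
    by (rule geodesic_unique[OF \<sigma>(1) assms(1)]) (simp_all add: \<sigma> assms)
  then show "q = \<gamma> 1"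
    using \<sigma>(4) by simp
qed

text \<open>By the chain rule the velocity scales with \<open>r\<close> and, the connection being
  bilinear, both terms of the acceleration scale with the square of \<open>r\<close>.\<close>

lemma geodesic_rescale:
  assumes \<sigma>: "geodesic_on N UNIV \<sigma>"
  shows "s \<in> {0..1} \<Longrightarrow> velocity N {0..1} (\<lambda>s. \<sigma> (r * s)) s = r *\<^sub>R velocity N UNIV \<sigma> (r * s)"
    and "geodesic_on N {0..1} (\<lambda>s. \<sigma> (r * s))"
proof -
  let ?I = "{0..1::real}" and ?\<gamma> = "\<lambda>s. \<sigma> (r * s)"
  have lin: "((*) r has_vector_derivative r) (at s within S)" for s S
    by (auto intro!: derivative_eq_intros)
  have der: "((cmap c \<circ> ?\<gamma>) has_vector_derivative r *\<^sub>R in_chart N c (\<sigma> (r * s)) (velocity N UNIV \<sigma> (r * s))) (at s within ?I)"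
    if "c \<in> atlas N" "\<sigma> (r * s) \<in> cdom c" for c s
    using vector_diff_chain_within[OF lin has_vector_derivative_at_within[OF geodesic_chart(1)[OF \<sigma> UNIV_I _ that]]]
    by (simp add: o_def)
  have vel: "velocity N ?I ?\<gamma> s = r *\<^sub>R velocity N UNIV \<sigma> (r * s)" if s: "s \<in> ?I" for s
    unfolding velocity_def[of N ?I]
    using vector_derivative_within[OF at_within_unit_interval[OF s] der[OF chart_at_atlas]]
    by (simp add: in_chart_at)
  then show "s \<in> {0..1} \<Longrightarrow> velocity N {0..1} (\<lambda>s. \<sigma> (r * s)) s = r *\<^sub>R velocity N UNIV \<sigma> (r * s)" .
  have "continuous_on UNIV \<sigma>"
    using \<sigma> by (simp add: geodesic_on_def parallel_along_def)
  then have cont: "continuous_on ?I ?\<gamma>"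
    by (rule continuous_on_compose2) (auto intro!: continuous_intros)
  show "geodesic_on N ?I ?\<gamma>"
    unfolding geodesic_on_def parallel_along_def
  proof (intro conjI ballI)
    fix s assume s: "s \<in> ?I"
    define c where "c = chart_at N (\<sigma> (r * s))"
    have c: "c \<in> atlas N" "\<sigma> (r * s) \<in> cdom c"
      by (simp_all add: c_def)
    let ?w = "\<lambda>t. in_chart N c (\<sigma> t) (velocity N UNIV \<sigma> t)"
    let ?u = "cmap c (\<sigma> (r * s))"
    have cont_s: "continuous (at s within ?I) ?\<gamma>"
      using cont s by (simp add: continuous_on_eq_continuous_within)
    have "((\<lambda>s. r *\<^sub>R ?w (r * s)) has_vector_derivative r *\<^sub>R (r *\<^sub>R - christoffel N c ?u (?w (r * s)) (?w (r * s)))) (at s within ?I)"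
      using bounded_linear.has_vector_derivative[OF bounded_linear_scaleR_right
          vector_diff_chain_within[OF lin has_vector_derivative_at_within[OF geodesic_chart(2)[OF \<sigma> UNIV_I _ c]]]]
      by (simp add: o_def)
    then have "((\<lambda>s. in_chart N c (?\<gamma> s) (velocity N ?I ?\<gamma> s)) has_vector_derivative
        r *\<^sub>R (r *\<^sub>R - christoffel N c ?u (?w (r * s)) (?w (r * s)))) (at s within ?I)"
    proof (rule has_vector_derivative_cong_ev[THEN iffD1, rotated -1])
      have *: "r *\<^sub>R ?w (r * t) = in_chart N c (?\<gamma> t) (velocity N ?I ?\<gamma> t)" if "t \<in> ?I" "\<sigma> (r * t) \<in> cdom c" for t
        using that by (simp add: vel linear_scale[OF in_chart_linear[OF c(1)]])
      show "\<forall>\<^sub>F t in nhds s. t \<in> ?I \<longrightarrow> r *\<^sub>R ?w (r * t) = in_chart N c (?\<gamma> t) (velocity N ?I ?\<gamma> t)"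
        using curve_eventually_in_chart[OF cont_s c] by eventually_elim (use * in blast)
      show "r *\<^sub>R ?w (r * s) = in_chart N c (?\<gamma> s) (velocity N ?I ?\<gamma> s)"
        using s c(2) by (rule *)
    qed
    then show "has_covariant_derivative N ?I ?\<gamma> (velocity N ?I ?\<gamma>) s 0"
    proof (rule has_covariant_derivativeI_chart[OF cont_s c s der[OF c]])
      have u: "?u \<in> img c" using c by blast
      show "in_chart N c (?\<gamma> s) 0 = r *\<^sub>R (r *\<^sub>R - christoffel N c ?u (?w (r * s)) (?w (r * s))) +
          christoffel N c (cmap c (?\<gamma> s)) (r *\<^sub>R ?w (r * s)) (in_chart N c (?\<gamma> s) (velocity N ?I ?\<gamma> s))"
        using s linear_scale[OF christoffel_linear(1)[OF c(1) u]] linear_scale[OF christoffel_linear(2)[OF c(1) u]]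
        by (simp add: vel linear_scale[OF in_chart_linear[OF c]] linear_0[OF in_chart_linear[OF c]])
    qed
  qed (rule cont)
qed

text \<open>The definition of \<gamma> evaluates the exponential map afresh for each
  \<open>t\<close>. Each value is the endpoint of a rescaled piece of one global geodesic, so
  \<gamma> is that geodesic.\<close>

lemma riemannian_exp_curve:
  fixes p :: 'm and v :: 'e
  assumes "geodesically_complete N"
  defines "\<gamma> \<equiv> \<lambda>t. riemannian_exp N p (t *\<^sub>R v)"
  shows "geodesic_on N {0..1} \<gamma>" "\<gamma> 0 = p" "velocity N {0..1} \<gamma> 0 = v"
proof -
  obtain \<sigma> where \<sigma>: "geodesic_on N UNIV \<sigma>" "\<sigma> 0 = p" "velocity N UNIV \<sigma> 0 = v"
    using assms(1) by (auto simp: geodesically_complete_def)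
  have "\<gamma> t = \<sigma> t" for t
    using riemannian_exp_eq[OF geodesic_rescale(2)[OF \<sigma>(1), of t], of p "t *\<^sub>R v"]
      geodesic_rescale(1)[OF \<sigma>(1), of 0 t] \<sigma> by (simp add: \<gamma>_def)
  then have "\<gamma> = (\<lambda>s. \<sigma> (1 * s))"
    by auto
  then show "geodesic_on N {0..1} \<gamma>" "\<gamma> 0 = p" "velocity N {0..1} \<gamma> 0 = v"
    using geodesic_rescale(1)[OF \<sigma>(1), of 0 1] geodesic_rescale(2)[OF \<sigma>(1), of 1] \<sigma>(2,3) by simp_all
qed

lemma geodesic_speed:
  assumes \<gamma>: "geodesic_on N {0..1} \<gamma>" and t: "t \<in> {0..1}"
  shows "tnorm N (\<gamma> t) (velocity N {0..1} \<gamma> t) = tnorm N (\<gamma> 0) (velocity N {0..1} \<gamma> 0)"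
proof -
  have "metric N (\<gamma> t) (velocity N {0..1} \<gamma> t) (velocity N {0..1} \<gamma> t) =
    metric N (\<gamma> 0) (velocity N {0..1} \<gamma> 0) (velocity N {0..1} \<gamma> 0)"
    by (rule parallel_metric_const[of \<gamma> "{0..1}"]) (use \<gamma> t in \<open>auto simp: geodesic_on_def parallel_along_def\<close>)
  then show ?thesis
    by (simp add: tnorm_def)
qed

section \<open>The tangent norm and the remainder of a Newton step\<close>

lemma tnorm_nonneg [simp]: "tnorm N p v \<ge> 0"
  by (simp add: tnorm_def inner_form_nonneg[OF inner_form_metric])

lemma tnorm_eq_0_iff: "tnorm N p v = 0 \<longleftrightarrow> v = 0"
  by (simp add: tnorm_def inner_form_nonneg[OF inner_form_metric] inner_form_eq_0[OF inner_form_metric])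

lemma tnorm_minus: "tnorm N p (- v) = tnorm N p v"
  by (simp add: tnorm_def inner_form_simps[OF inner_form_metric])

lemma tnorm_triangle: "tnorm N p (v + w) \<le> tnorm N p v + tnorm N p w"
  unfolding tnorm_def by (rule inner_form_triangle[OF inner_form_metric])

text \<open>
  Instead of integrating the transported derivative, the vector \<open>z\<close> to be estimated is paired
  with itself: moving \<open>A\<close> to the other side by its adjoint and transporting the resulting vector
  parallel along \<open>\<gamma>\<close> turns the claim into a scalar mean value estimate.
\<close>

lemma newton_remainder:
  assumes F: "twice_differentiable_field N F" and \<gamma>: "geodesic_on N {0..1} \<gamma>" and A: "linear A"
    and v: "velocity N {0..1} \<gamma> 0 = v"
  defines "P \<equiv> parallel_transport N \<gamma>"
  assumes le: "\<And>t. t \<in> {0..1} \<Longrightarrow>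
    tnorm N (\<gamma> 1) (A (P t 1 (nabla N F (\<gamma> t) (P 0 t v)) - P 0 1 (nabla N F (\<gamma> 0) v))) \<le> k * t"
  shows "tnorm N (\<gamma> 1) (A (F (\<gamma> 1) - P 0 1 (F (\<gamma> 0) + nabla N F (\<gamma> 0) v))) \<le> k / 2"
proof -
  let ?I = "{0..1::real}" and ?y = "\<gamma> 1" and ?p = "\<gamma> 0"
  let ?J = "nabla N F" and ?vel = "velocity N {0..1} \<gamma>"
  define z where "z = A (F ?y - P 0 1 (F ?p + ?J ?p v))"
  note C1 = geodesic_imp_C1_curve[OF \<gamma>]
  note g = inner_form_metric[of ?y]
  have par: "parallel_along N ?I \<gamma> ?vel"
    using \<gamma> by (simp add: geodesic_on_def)
  have cont: "continuous (at t within ?I) \<gamma>" if "t \<in> ?I" for t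
    using par that by (auto simp: parallel_along_def continuous_on_eq_continuous_within)
  have Pvel: "P 0 t v = ?vel t" if "t \<in> ?I" for t
    using parallel_transport_eq[OF par, of 0 t] that v by (simp add: P_def)
  have "linear (\<lambda>w. metric N ?y z (A w))"
    using linear_compose[OF A inner_form_linear(1)[OF g]] by (simp add: o_def)
  then obtain z' where z': "\<And>w. metric N ?y z' w = metric N ?y z (A w)"
    using inner_form_riesz[OF g] by metis
  obtain Z where Z: "parallel_along N ?I \<gamma> Z" "Z 1 = z'"
    using parallel_exists[OF C1, of 1] by auto
  have ZP: "metric N (\<gamma> t) (Z t) w = metric N ?y z (A (P t 1 w))" if "t \<in> ?I" for t w
    using parallel_transport_metric[OF C1 Z(1) that, of 1 w] by (simp add: Z z' P_def)
  define q where "q = metric N ?y z (A (P 0 1 (?J ?p v)))"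
  \<comment> \<open>The corrections are the first-order term and the integrated bound, so that the
    derivative is nonpositive and \<open>h 1 \<le> h 0\<close> is the claim multiplied by the norm
    of \<open>z\<close>.\<close>
  define h where "h t = metric N (\<gamma> t) (Z t) (F (\<gamma> t)) - t * q - tnorm N ?y z * k * t\<^sup>2 / 2" for t
  define h' where "h' t = metric N ?y z (A (P t 1 (?J (\<gamma> t) (P 0 t v)) - P 0 1 (?J ?p v))) - tnorm N ?y z * (k * t)" for t
  have "\<exists>t\<in>{0<..<1}. h 1 - h 0 = h' t * (1 - 0)"
  proof (rule mvt_simple)
    fix t :: real assume "0 \<le> t" "t \<le> 1"
    then have t: "t \<in> ?I" by simp
    have "((\<lambda>s. metric N (\<gamma> s) (Z s) (F (\<gamma> s))) has_real_derivative
        metric N (\<gamma> t) 0 (F (\<gamma> t)) + metric N (\<gamma> t) (Z t) (?J (\<gamma> t) (?vel t))) (at t within ?I)"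
      using Z(1) t
      by (intro metric_along_derivative[OF cont[OF t] t at_within_unit_interval[OF t]] field_covariant_derivative[OF F C1 t])
        (auto simp: parallel_along_def)
    then have "((\<lambda>s. metric N (\<gamma> s) (Z s) (F (\<gamma> s))) has_real_derivative
        metric N ?y z (A (P t 1 (?J (\<gamma> t) (P 0 t v))))) (at t within ?I)"
      by (simp add: inner_form_simps[OF inner_form_metric] ZP[OF t] Pvel[OF t])
    then have "(h has_real_derivative h' t) (at t within ?I)"
      unfolding h_def[abs_def] h'_def q_def linear_diff[OF A] inner_form_simps(4)[OF g]
      by (auto intro!: derivative_eq_intros)
    then show "(h has_derivative (*) (h' t)) (at t within ?I)"
      by (simp add: has_field_derivative_def)
  qed simp
  then obtain t where "t \<in> {0<..<1}" "h 1 - h 0 = h' t * (1 - 0)"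
    by blast
  then have t: "t \<in> ?I" "h 1 - h 0 = h' t"
    by simp_all
  have "h' t \<le> tnorm N ?y z * tnorm N ?y (A (P t 1 (?J (\<gamma> t) (P 0 t v)) - P 0 1 (?J ?p v))) - tnorm N ?y z * (k * t)"
    unfolding h'_def using inner_form_cauchy_schwarz[OF g] by (simp add: tnorm_def)
  also have "\<dots> \<le> 0"
    using mult_left_mono[OF le[OF t(1)] tnorm_nonneg[of ?y z]] by simp
  finally have "h 1 \<le> h 0"
    using t by simp
  moreover have "h 1 - h 0 = metric N ?y z z - tnorm N ?y z * k / 2"
  proof -
    have "P 0 1 (F ?p + ?J ?p v) = P 0 1 (F ?p) + P 0 1 (?J ?p v)"
      unfolding P_def by (rule parallel_transport_add[OF C1]) auto
    then have "z = A (F ?y) - A (P 0 1 (F ?p)) - A (P 0 1 (?J ?p v))"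
      unfolding z_def by (simp add: linear_diff[OF A] linear_add[OF A])
    then have "metric N ?y z z = metric N ?y z (A (F ?y)) - metric N ?y z (A (P 0 1 (F ?p))) - q"
      unfolding q_def by (metis inner_form_simps(4)[OF g])
    then show ?thesis
      using ZP[of 0 "F ?p"] by (simp add: h_def Z(2) z')
  qed
  moreover have "metric N ?y z z = tnorm N ?y z * tnorm N ?y z"
    by (simp add: tnorm_def inner_form_nonneg[OF g])
  ultimately have "tnorm N ?y z * tnorm N ?y z \<le> tnorm N ?y z * (k / 2)"
    by simp
  \<comment> \<open>Covers the case that \<open>z\<close> vanishes, where its norm cannot be
    cancelled.\<close>
  moreover have "k \<ge> 0"
    using order_trans[OF tnorm_nonneg le[of 1]] by simp
  ultimately have "tnorm N ?y z \<le> k / 2"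
    using tnorm_nonneg[of ?y z] by (cases "tnorm N ?y z = 0") (auto simp: mult_le_cancel_left)
  then show ?thesis
    by (simp add: z_def)
qed

section \<open>Length and distance in a chart\<close>

lemma metric_in_continuous_on:
  assumes c: "c \<in> atlas N" and u: "continuous_on D u" "\<And>s. s \<in> D \<Longrightarrow> u s \<in> img c"
    and V: "continuous_on D V" and W: "continuous_on D W"
  shows "continuous_on D (\<lambda>s. metric_in N c (u s) (V s) (W s))"
proof -
  note g = inner_form_metric_in[OF c u(2)]
  have base: "continuous_on D (\<lambda>s. metric_in N c (u s) a b)" for a b
    using u by (intro continuous_on_compose2[OF Ck_on_imp_continuous[OF metric_in_smooth[OF c, of 0]]]) auto
  have 1: "continuous_on D (\<lambda>s. metric_in N c (u s) a (W s))" for a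
    by (rule continuous_on_linear_family[OF inner_form_linear(1)[OF g] base W])
  show ?thesis
    by (rule continuous_on_linear_family[OF inner_form_linear(2)[OF g] 1 V])
qed

lemma tnorm_chart:
  "c \<in> atlas N \<Longrightarrow> p \<in> cdom c \<Longrightarrow>
    tnorm N p v = sqrt (metric_in N c (cmap c p) (in_chart N c p v) (in_chart N c p v))"
  by (simp add: tnorm_def metric_conv_chart)

text \<open>Continuity of the velocity is given chart by chart, whereas the norm does not depend on
  the chart; near each parameter one chart is enough.\<close>

lemma speed_continuous:
  assumes \<gamma>: "C1_curve_on N I \<gamma>"
  shows "continuous_on I (\<lambda>t. tnorm N (\<gamma> t) (velocity N I \<gamma> t))"
  unfolding continuous_on_eq_continuous_within
proof
  fix t assume t: "t \<in> I"
  define c where "c = chart_at N (\<gamma> t)"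
  have c: "c \<in> atlas N" "\<gamma> t \<in> cdom c"
    by (simp_all add: c_def)
  have cont: "continuous_on I \<gamma>"
    using \<gamma> by (simp add: C1_curve_on_def)
  obtain T where T: "open T" "I \<inter> \<gamma> -` cdom c = I \<inter> T"
    using continuous_openin_preimage_gen[OF cont chart_homeomorphism(1)[OF c(1)]] by (auto simp: openin_open)
  let ?D = "{s \<in> I. \<gamma> s \<in> cdom c}"
  let ?w = "\<lambda>s. in_chart N c (\<gamma> s) (velocity N I \<gamma> s)"
  have D: "?D = I \<inter> T"
    using T(2) by blast
  have w: "continuous_on ?D ?w"
    using \<gamma> c(1) by (simp add: C1_curve_on_def)
  have u: "continuous_on ?D (\<lambda>s. cmap c (\<gamma> s))"
    by (rule continuous_on_compose2[OF continuous_on_cmap[OF c(1)] continuous_on_subset[OF cont]]) auto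
  have "continuous_on ?D (\<lambda>s. sqrt (metric_in N c (cmap c (\<gamma> s)) (?w s) (?w s)))"
    by (intro continuous_on_real_sqrt metric_in_continuous_on[OF c(1) u _ w w]) auto
  then have "continuous_on ?D (\<lambda>t. tnorm N (\<gamma> t) (velocity N I \<gamma> t))"
    by (rule continuous_on_eq) (simp add: tnorm_chart[OF c(1)])
  then have "continuous (at t within ?D) (\<lambda>t. tnorm N (\<gamma> t) (velocity N I \<gamma> t))"
    using t c(2) by (simp add: continuous_on_eq_continuous_within)
  moreover have "t \<in> T"
    using t c(2) D by blast
  then have "at t within ?D = at t within I"
    unfolding D using T(1) by (intro at_within_nhd) auto
  ultimately show "continuous (at t within I) (\<lambda>t. tnorm N (\<gamma> t) (velocity N I \<gamma> t))"
    by simp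
qed

text \<open>Induction over the break points. Velocities relative to a piece and to the unit interval
  agree inside the piece, and finitely many break points affect neither integrability nor the
  fundamental theorem of calculus.\<close>

lemma piecewise_C1_curve_facts:
  assumes \<gamma>: "piecewise_C1_curve N \<gamma>"
  shows "continuous_on {0..1} \<gamma>"
    and "(\<lambda>t. tnorm N (\<gamma> t) (velocity N {0..1} \<gamma> t)) integrable_on {0..1}"
    and "\<exists>S. finite S \<and> (\<forall>t\<in>{0..1} - S. \<forall>c\<in>atlas N. \<gamma> t \<in> cdom c \<longrightarrow>
      ((cmap c \<circ> \<gamma>) has_vector_derivative in_chart N c (\<gamma> t) (velocity N {0..1} \<gamma> t)) (at t))"
proof -
  let ?f = "\<lambda>t. tnorm N (\<gamma> t) (velocity N {0..1} \<gamma> t)"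
  obtain n \<tau> where \<tau>: "\<tau> 0 = 0" "\<tau> n = 1"
    "\<And>i. i < n \<Longrightarrow> \<tau> i < \<tau> (Suc i) \<and> C1_curve_on N {\<tau> i..\<tau> (Suc i)} \<gamma>"
    using \<gamma> unfolding piecewise_C1_curve_def by blast
  have le1: "\<tau> i \<le> 1" if "i \<le> n" for i
    using that
  proof (induction rule: inc_induct)
    case (step i)
    then show ?case using \<tau>(3)[of i] by simp
  qed (simp add: \<tau>)
  let ?Q = "\<lambda>b. continuous_on {0..b} \<gamma> \<and> ?f integrable_on {0..b} \<and>
      (\<exists>S. finite S \<and> (\<forall>t\<in>{0..b} - S. \<forall>c\<in>atlas N. \<gamma> t \<in> cdom c \<longrightarrow>
      ((cmap c \<circ> \<gamma>) has_vector_derivative in_chart N c (\<gamma> t) (velocity N {0..1} \<gamma> t)) (at t)))"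
  have "i \<le> n \<Longrightarrow> 0 \<le> \<tau> i \<and> ?Q (\<tau> i)" for i
  proof (induction i)
    case 0
    show ?case
      unfolding \<tau>(1)
    proof (intro conjI exI)
      show "?f integrable_on {0..0}"
        by (rule integrable_on_refl[of ?f "0::real", unfolded box_real])
      show "finite {0::real}" by simp
    qed auto
  next
    case (Suc i)
    let ?a = "\<tau> i" and ?b = "\<tau> (Suc i)"
    have i: "i < n"
      using Suc.prems by simp
    have IH: "0 \<le> ?a" "?Q ?a"
      using Suc.IH[OF less_imp_le[OF i]] by blast+
    have ab: "?a < ?b" "?b \<le> 1" and C1: "C1_curve_on N {?a..?b} \<gamma>"
      using \<tau>(3)[OF i] le1[OF Suc.prems] by auto
    have un: "{0..?b} = {0..?a} \<union> {?a..?b}"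
      using ab IH(1) by auto
    have inner: "at t within {?a..?b} = at t" "at t within {0..1} = at t" if "t \<in> {?a<..<?b}" for t
      using that ab IH(1) by (auto intro!: at_within_interior)
    have vel: "velocity N {?a..?b} \<gamma> t = velocity N {0..1} \<gamma> t" if "t \<in> {?a<..<?b}" for t
      using inner[OF that] by (simp add: velocity_def)
    have "(\<lambda>t. tnorm N (\<gamma> t) (velocity N {?a..?b} \<gamma> t)) integrable_on {?a..?b}"
      by (rule integrable_continuous_real[OF speed_continuous[OF C1]])
    then have fb: "?f integrable_on {?a..?b}"
      by (rule integrable_spike_finite[of "{?a, ?b}", rotated 2]) (auto simp: vel)
    have fa: "?f integrable_on {0..?a}" and \<gamma>a: "continuous_on {0..?a} \<gamma>"
      using IH(2) by blast+
    have int: "?f integrable_on {0..?b}"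
      by (rule Henstock_Kurzweil_Integration.integrable_combine[OF IH(1) less_imp_le[OF ab(1)] fa fb])
    have cont: "continuous_on {0..?b} \<gamma>"
      unfolding un using \<gamma>a C1 by (intro continuous_on_closed_Un) (simp_all add: C1_curve_on_def)
    obtain S where S: "finite S" "\<And>t c. t \<in> {0..?a} - S \<Longrightarrow> c \<in> atlas N \<Longrightarrow> \<gamma> t \<in> cdom c \<Longrightarrow>
      ((cmap c \<circ> \<gamma>) has_vector_derivative in_chart N c (\<gamma> t) (velocity N {0..1} \<gamma> t)) (at t)"
      using IH(2) by blast
    have "((cmap c \<circ> \<gamma>) has_vector_derivative in_chart N c (\<gamma> t) (velocity N {0..1} \<gamma> t)) (at t)"
      if t: "t \<in> {0..?b} - (S \<union> {?a, ?b})" and c: "c \<in> atlas N" "\<gamma> t \<in> cdom c" for t c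
    proof (cases "t < ?a")
      case True
      then show ?thesis using S(2)[of t c] t c by simp
    next
      case False
      then have t': "t \<in> {?a<..<?b}" "t \<in> {?a..?b}" using t by auto
      show ?thesis
        using C1_curve_chart_derivative[OF C1 t'(2) c] by (simp add: inner(1)[OF t'(1)] vel[OF t'(1)])
    qed
    then have "\<exists>S. finite S \<and> (\<forall>t\<in>{0..?b} - S. \<forall>c\<in>atlas N. \<gamma> t \<in> cdom c \<longrightarrow>
      ((cmap c \<circ> \<gamma>) has_vector_derivative in_chart N c (\<gamma> t) (velocity N {0..1} \<gamma> t)) (at t))"
      using S(1) by (intro exI[of _ "S \<union> {?a, ?b}"]) blast
    moreover have "0 \<le> ?b"
      using IH(1) ab by linarith
    ultimately show ?case
      using int cont by blast
  qed
  from this[of n] have "?Q 1"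
    by (simp only: \<tau>(2) order_refl simp_thms)
  then show "continuous_on {0..1} \<gamma>" "?f integrable_on {0..1}"
    "\<exists>S. finite S \<and> (\<forall>t\<in>{0..1} - S. \<forall>c\<in>atlas N. \<gamma> t \<in> cdom c \<longrightarrow>
      ((cmap c \<circ> \<gamma>) has_vector_derivative in_chart N c (\<gamma> t) (velocity N {0..1} \<gamma> t)) (at t))"
    by blast+
qed

text \<open>An integral that does not exist has the default value 0.\<close>

lemma curve_length_nonneg: "curve_length N \<gamma> \<ge> 0"
  unfolding curve_length_def by (cases "(\<lambda>t. tnorm N (\<gamma> t) (velocity N {0..1} \<gamma> t)) integrable_on {0..1}")
    (auto intro: integral_nonneg simp: not_integrable_integral)

lemma C1_imp_piecewise_C1_curve:
  assumes "C1_curve_on N {0..1} \<gamma>"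
  shows "piecewise_C1_curve N \<gamma>"
  unfolding piecewise_C1_curve_def
  by (rule exI[of _ "Suc 0"], rule exI[of _ real]) (use assms in simp)

context
  fixes c \<mu> B
  assumes c: "c \<in> atlas N" and \<mu>: "\<mu> > 0" and B: "B \<subseteq> img c"
    and low: "\<And>u a. u \<in> B \<Longrightarrow> \<mu> * (norm a)\<^sup>2 \<le> metric_in N c u a a"
begin

lemma in_chart_norm_le:
  assumes "p \<in> cdom c" "cmap c p \<in> B"
  shows "sqrt \<mu> * norm (in_chart N c p v) \<le> tnorm N p v"
proof -
  have "sqrt (\<mu> * (norm (in_chart N c p v))\<^sup>2) \<le> tnorm N p v"
    unfolding tnorm_chart[OF c assms(1)] by (intro real_sqrt_le_mono low assms(2))
  then show ?thesis
    by (simp add: real_sqrt_mult)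
qed

text \<open>Stated for a parameter interval spent in \<open>B\<close>; outside it the curve may
  leave the chart, which can only add to the length.\<close>

lemma chart_displacement_le_length:
  assumes \<gamma>: "piecewise_C1_curve N \<gamma>" and ab: "0 \<le> a" "a \<le> b" "b \<le> 1"
    and inB: "\<And>s. s \<in> {a..b} \<Longrightarrow> \<gamma> s \<in> cdom c \<and> cmap c (\<gamma> s) \<in> B"
  shows "sqrt \<mu> * norm (cmap c (\<gamma> b) - cmap c (\<gamma> a)) \<le> curve_length N \<gamma>"
proof -
  let ?f = "\<lambda>t. tnorm N (\<gamma> t) (velocity N {0..1} \<gamma> t)"
  let ?w = "\<lambda>s. in_chart N c (\<gamma> s) (velocity N {0..1} \<gamma> s)"
  note facts = piecewise_C1_curve_facts[OF \<gamma>]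
  have sub: "{a..b} \<subseteq> {0..1}" using ab by auto
  obtain S where S: "finite S" "\<And>t. t \<in> {0..1} - S \<Longrightarrow> \<gamma> t \<in> cdom c \<Longrightarrow>
      ((cmap c \<circ> \<gamma>) has_vector_derivative ?w t) (at t)"
    using facts(3) c by blast
  have "(?w has_integral ((cmap c \<circ> \<gamma>) b - (cmap c \<circ> \<gamma>) a)) {a..b}"
  proof (rule fundamental_theorem_of_calculus_strong[OF S(1) ab(2)])
    show "((cmap c \<circ> \<gamma>) has_vector_derivative ?w t) (at t)" if "t \<in> {a..b} - S" for t
      using that sub inB by (intro S(2)) auto
    show "continuous_on {a..b} (cmap c \<circ> \<gamma>)"
      using inB by (intro continuous_on_compose continuous_on_subset[OF facts(1) sub]
          continuous_on_subset[OF continuous_on_cmap[OF c]]) auto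
  qed
  then have w: "?w integrable_on {a..b}" "integral {a..b} ?w = cmap c (\<gamma> b) - cmap c (\<gamma> a)"
    by (auto simp: integral_unique)
  have f: "?f integrable_on {a..b}"
    using facts(2) sub by (rule integrable_on_subinterval)
  have "norm (integral {a..b} (\<lambda>s. sqrt \<mu> *\<^sub>R ?w s)) \<le> integral {a..b} ?f"
    using inB in_chart_norm_le \<mu> by (intro integral_norm_bound_integral integrable_cmul w f) auto
  also have "\<dots> \<le> integral {0..1} ?f"
    using sub f facts(2) by (intro integral_subset_le) auto
  finally show ?thesis
    using \<mu> w(2) by (simp add: curve_length_def)
qed

text \<open>
  The points of the curve stay in the image \<open>K\<close> of a
  smaller closed ball, which is compact and hence closed in the manifold, so the set of
  parameters reached inside the ball is open and closed in the unit interval.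
\<close>

lemma short_curve_stays:
  assumes \<gamma>: "piecewise_C1_curve N \<gamma>" and t0: "t0 \<in> {0..1}" "\<gamma> t0 \<in> cdom c"
    and \<rho>: "\<rho> > 0" "cball (cmap c (\<gamma> t0)) \<rho> \<subseteq> B" and short: "curve_length N \<gamma> < sqrt \<mu> * \<rho>"
    and t: "t \<in> {0..1}"
  shows "\<gamma> t \<in> cdom c" "cmap c (\<gamma> t) \<in> B" "sqrt \<mu> * norm (cmap c (\<gamma> t) - cmap c (\<gamma> t0)) \<le> curve_length N \<gamma>"
proof -
  let ?I = "{0..1::real}" and ?o = "cmap c (\<gamma> t0)" and ?l = "curve_length N \<gamma>"
  have cont: "continuous_on ?I \<gamma>"
    by (rule piecewise_C1_curve_facts(1)[OF \<gamma>])
  define U where "U = {p \<in> cdom c. cmap c p \<in> ball ?o \<rho>}"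
  \<comment> \<open>The radius is the largest displacement that the length allows; it is below
    \<rho>, so \<open>K\<close> lies inside \<open>U\<close>.\<close>
  define K where "K = cinv c ` cball ?o (?l / sqrt \<mu>)"
  have l: "?l / sqrt \<mu> < \<rho>"
    using short \<mu> by (simp add: field_simps)
  have U: "open U"
    using continuous_open_preimage[OF continuous_on_cmap[OF c] chart_homeomorphism(1)[OF c], of "ball ?o \<rho>"]
    by (simp add: U_def vimage_def Int_def)
  have ball_B: "ball ?o \<rho> \<subseteq> B"
    using \<rho>(2) ball_subset_cball by blast
  have "cball ?o (?l / sqrt \<mu>) \<subseteq> img c"
    using l \<rho>(2) B by (meson subset_cball less_imp_le order_trans)
  then have K: "closed K"
    unfolding K_def
    by (intro compact_imp_closed compact_continuous_image continuous_on_subset[OF continuous_on_cinv[OF c]]) auto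
  \<comment> \<open>The whole segment of parameters is included, since the displacement estimate
    needs the curve to be in the chart all the way from \<open>t0\<close>.\<close>
  define P where "P t \<longleftrightarrow> \<gamma> ` closed_segment t0 t \<subseteq> U" for t
  have disp: "sqrt \<mu> * norm (cmap c (\<gamma> t) - ?o) \<le> ?l" if "t \<in> ?I" "P t" for t
  proof (cases "t0 \<le> t")
    case True
    have "\<gamma> s \<in> cdom c \<and> cmap c (\<gamma> s) \<in> B" if "s \<in> {t0..t}" for s
    proof -
      have "\<gamma> s \<in> U"
        using \<open>P t\<close> True that unfolding P_def by (auto simp: closed_segment_eq_real_ivl)
      then show ?thesis
        using ball_B unfolding U_def by blast
    qed
    then show ?thesis
      using t0 that True by (intro chart_displacement_le_length[OF \<gamma>]) auto
  next
    case False
    have "\<gamma> s \<in> cdom c \<and> cmap c (\<gamma> s) \<in> B" if "s \<in> {t..t0}" for s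
    proof -
      have "\<gamma> s \<in> U"
        using \<open>P t\<close> False that unfolding P_def by (auto simp: closed_segment_eq_real_ivl)
      then show ?thesis
        using ball_B unfolding U_def by blast
    qed
    then have "sqrt \<mu> * norm (?o - cmap c (\<gamma> t)) \<le> ?l"
      using t0 that False by (intro chart_displacement_le_length[OF \<gamma>]) auto
    then show ?thesis by (simp add: norm_minus_commute)
  qed
  have inK: "\<gamma> t \<in> K" if "t \<in> ?I" "P t" for t
  proof -
    have "norm (cmap c (\<gamma> t) - ?o) \<le> ?l / sqrt \<mu>"
      using disp[OF that] \<mu> by (simp add: field_simps)
    moreover have "\<gamma> t \<in> cdom c"
      using that(2) by (auto simp: P_def U_def)
    ultimately show ?thesis
      unfolding K_def by (intro image_eqI[of _ _ "cmap c (\<gamma> t)"])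
        (auto simp: cinv_cmap[OF c] dist_norm norm_minus_commute)
  qed
  have "P t"
  proof (rule unit_interval_induction[of P, OF _ t0(1) t])
    show "P t0"
      using t0 \<rho> by (simp add: P_def U_def)
    fix s assume s: "s \<in> ?I"
    have cont_s: "continuous (at s within ?I) \<gamma>"
      using cont s by (simp add: continuous_on_eq_continuous_within)
    show "\<exists>\<epsilon>>0. \<forall>x\<in>?I \<inter> ball s \<epsilon>. \<forall>y\<in>?I \<inter> ball s \<epsilon>. P x \<longrightarrow> P y"
    proof (cases "\<gamma> s \<in> U")
      case True
      then have "\<forall>\<^sub>F x in nhds s. x \<in> ?I \<longrightarrow> \<gamma> x \<in> U"
        by (rule eventually_nhds_within_preimage[OF cont_s U])
      then obtain \<epsilon> where \<epsilon>: "\<epsilon> > 0" "\<And>x. dist x s < \<epsilon> \<Longrightarrow> x \<in> ?I \<Longrightarrow> \<gamma> x \<in> U"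
        unfolding eventually_nhds_metric by blast
      have "P y" if x: "x \<in> ?I \<inter> ball s \<epsilon>" and y: "y \<in> ?I \<inter> ball s \<epsilon>" and "P x" for x y
        unfolding P_def
      proof clarify
        fix z assume z: "z \<in> closed_segment t0 y"
        show "\<gamma> z \<in> U"
        proof (cases "z \<in> closed_segment t0 x")
          case True
          then show ?thesis using \<open>P x\<close> by (auto simp: P_def)
        next
          case False
          then have "z \<in> closed_segment x y"
            using z by (auto simp: closed_segment_eq_real_ivl split: if_splits)
          moreover have "closed_segment x y \<subseteq> ?I \<inter> ball s \<epsilon>"
            using x y by (intro closed_segment_subset convex_Int) auto
          ultimately have "z \<in> ?I \<inter> ball s \<epsilon>"
            by blast
          then show ?thesis
            using \<epsilon>(2)[of z] by (simp add: dist_commute)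
        qed
      qed
      then show ?thesis
        using \<epsilon>(1) by blast
    next
      \<comment> \<open>Outside \<open>U\<close> the curve is also outside the closed set
        \<open>K\<close>, and remains so nearby; there \<open>P\<close> fails because of
        \<open>inK\<close>.\<close>
      case False
      have "K \<subseteq> U"
      proof
        fix p assume "p \<in> K"
        then obtain v where v: "v \<in> cball ?o (?l / sqrt \<mu>)" "p = cinv c v"
          by (auto simp: K_def)
        then have "v \<in> ball ?o \<rho>"
          using l by simp
        moreover have "v \<in> img c"
          using calculation ball_B B by blast
        ultimately show "p \<in> U"
          using v(2) by (simp add: U_def cinv_in[OF c] cmap_cinv[OF c])
      qed
      then have "\<gamma> s \<in> - K"
        using False by blast
      then have "\<forall>\<^sub>F x in nhds s. x \<in> ?I \<longrightarrow> \<gamma> x \<in> - K"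
        using K by (intro eventually_nhds_within_preimage[OF cont_s]) auto
      then obtain \<epsilon> where \<epsilon>: "\<epsilon> > 0" "\<And>x. dist x s < \<epsilon> \<Longrightarrow> x \<in> ?I \<Longrightarrow> \<gamma> x \<notin> K"
        unfolding eventually_nhds_metric by blast
      have "P y" if x: "x \<in> ?I \<inter> ball s \<epsilon>" and "P x" for x y
        using inK[of x] \<epsilon>(2)[of x] that by (simp add: dist_commute)
      then show ?thesis
        using \<epsilon>(1) by blast
    qed
  qed
  then show "sqrt \<mu> * norm (cmap c (\<gamma> t) - cmap c (\<gamma> t0)) \<le> curve_length N \<gamma>"
    using t by (rule disp[rotated])
  have "\<gamma> t \<in> U"
    using \<open>P t\<close> by (auto simp: P_def)
  then show "\<gamma> t \<in> cdom c" "cmap c (\<gamma> t) \<in> B"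
    using ball_B by (auto simp: U_def)
qed

text \<open>Curves that are short compared with the ball around \<open>q\<close> stay in it and are
  estimated in the chart. The others are longer than some short competitor, which exists by
  \<open>close\<close> and already satisfies the bound.\<close>

lemma geodesic_dist_lower_bound:
  assumes q: "q \<in> cdom c" and r: "r > 0" "cball (cmap c q) r \<subseteq> B"
    and close: "geodesic_dist N p q < ennreal (sqrt \<mu> * r)"
  shows "p \<in> cdom c" "ennreal (sqrt \<mu> * norm (cmap c p - cmap c q)) \<le> geodesic_dist N p q"
proof -
  have short: "p \<in> cdom c \<and> sqrt \<mu> * norm (cmap c p - cmap c q) \<le> curve_length N \<gamma>"
    if "piecewise_C1_curve N \<gamma>" "\<gamma> 0 = p" "\<gamma> 1 = q" "curve_length N \<gamma> < sqrt \<mu> * r" for \<gamma>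
    using short_curve_stays[OF that(1), of 1 r 0] that q r by simp
  obtain \<gamma> where \<gamma>: "piecewise_C1_curve N \<gamma>" "\<gamma> 0 = p" "\<gamma> 1 = q" "ennreal (curve_length N \<gamma>) < ennreal (sqrt \<mu> * r)"
    using close unfolding geodesic_dist_def INF_less_iff by blast
  then have *: "curve_length N \<gamma> < sqrt \<mu> * r"
    by (simp add: ennreal_less_iff curve_length_nonneg)
  show "p \<in> cdom c"
    using short[OF \<gamma>(1-3) *] by blast
  show "ennreal (sqrt \<mu> * norm (cmap c p - cmap c q)) \<le> geodesic_dist N p q"
    unfolding geodesic_dist_def
  proof (rule INF_greatest, clarify)
    fix \<sigma> assume \<sigma>: "piecewise_C1_curve N \<sigma>" "p = \<sigma> 0" "q = \<sigma> 1"
    show "ennreal (sqrt \<mu> * norm (cmap c (\<sigma> 0) - cmap c (\<sigma> 1))) \<le> ennreal (curve_length N \<sigma>)"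
    proof (rule ennreal_leI, cases "curve_length N \<sigma> < sqrt \<mu> * r")
      case True
      then show "sqrt \<mu> * norm (cmap c (\<sigma> 0) - cmap c (\<sigma> 1)) \<le> curve_length N \<sigma>"
        using short[of \<sigma>] \<sigma> by simp
    next
      case False
      then show "sqrt \<mu> * norm (cmap c (\<sigma> 0) - cmap c (\<sigma> 1)) \<le> curve_length N \<sigma>"
        using short[OF \<gamma>(1-3) *] * \<sigma> by simp
    qed
  qed
qed

text \<open>Constant speed makes \<open>d\<close> the length, so the geodesic stays in the chart.
  The geodesic equation then bounds the coordinate acceleration by
  \<open>K * (d / sqrt \<mu>)\<^sup>2\<close>, and the mean value inequality compares the
  displacement with the initial velocity, whose coordinate norm is at least
  \<open>d / sqrt K\<close>.\<close>

lemma geodesic_chart_displacement: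
  assumes \<gamma>: "geodesic_on N {0..1} \<gamma>" and p: "\<gamma> 0 \<in> cdom c"
    and \<rho>: "\<rho> > 0" "cball (cmap c (\<gamma> 0)) \<rho> \<subseteq> B"
    and up: "\<And>u a. u \<in> B \<Longrightarrow> metric_in N c u a a \<le> K * (norm a)\<^sup>2" and K: "K > 0"
    and \<Gamma>: "\<And>u a b. u \<in> B \<Longrightarrow> norm (christoffel N c u a b) \<le> K * norm a * norm b"
  defines "d \<equiv> tnorm N (\<gamma> 0) (velocity N {0..1} \<gamma> 0)"
  assumes small: "d < sqrt \<mu> * \<rho>"
  shows "sqrt \<mu> * norm (cmap c (\<gamma> 1) - cmap c (\<gamma> 0)) \<le> d"
    and "d / sqrt K - K * (d / sqrt \<mu>)\<^sup>2 \<le> norm (cmap c (\<gamma> 1) - cmap c (\<gamma> 0))"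
proof -
  let ?I = "{0..1::real}"
  let ?u = "cmap c \<circ> \<gamma>" and ?w = "\<lambda>s. in_chart N c (\<gamma> s) (velocity N ?I \<gamma> s)"
  note C1 = geodesic_imp_C1_curve[OF \<gamma>]
  note pw = C1_imp_piecewise_C1_curve[OF C1]
  have speed: "tnorm N (\<gamma> t) (velocity N ?I \<gamma> t) = d" if "t \<in> ?I" for t
    unfolding d_def by (rule geodesic_speed[OF \<gamma> that])
  have len: "curve_length N \<gamma> = d"
  proof -
    have "integral ?I (\<lambda>t. tnorm N (\<gamma> t) (velocity N ?I \<gamma> t)) = integral ?I (\<lambda>t. d)"
      by (rule integral_cong) (rule speed)
    then show ?thesis by (simp add: curve_length_def)
  qed
  note stay = short_curve_stays[OF pw _ p \<rho>, unfolded len, OF _ small]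
  show "sqrt \<mu> * norm (cmap c (\<gamma> 1) - cmap c (\<gamma> 0)) \<le> d"
    by (rule stay(3)) auto
  have inB: "\<gamma> t \<in> cdom c" "cmap c (\<gamma> t) \<in> B" if "t \<in> ?I" for t
    using stay(1,2)[of t] that by auto
  have w_le: "norm (?w t) \<le> d / sqrt \<mu>" if "t \<in> ?I" for t
    using in_chart_norm_le[OF inB[OF that], of "velocity N ?I \<gamma> t"] speed[OF that] \<mu>
    by (simp add: pos_le_divide_eq mult.commute)
  have d: "d \<ge> 0" by (simp add: d_def)
  define E where "E = K * (d / sqrt \<mu>)\<^sup>2"
  have du: "(?u has_vector_derivative ?w t) (at t within ?I)"
    and dw: "(?w has_vector_derivative - christoffel N c (?u t) (?w t) (?w t)) (at t within ?I)" if "t \<in> ?I" for t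
    using geodesic_chart[OF \<gamma> that at_within_unit_interval[OF that] c inB(1)[OF that]] by simp_all
  have dw_le: "norm (christoffel N c (?u t) (?w t) (?w t)) \<le> E" if "t \<in> ?I" for t
  proof -
    have "norm (christoffel N c (?u t) (?w t) (?w t)) \<le> K * norm (?w t) * norm (?w t)"
      using inB(2)[OF that] by (intro \<Gamma>) simp
    also have "\<dots> \<le> K * (d / sqrt \<mu>) * (d / sqrt \<mu>)"
      using w_le[OF that] K d \<mu> by (intro mult_mono mult_nonneg_nonneg order_refl) auto
    finally show ?thesis
      by (simp add: E_def power2_eq_square)
  qed
  have w_diff: "norm (?w t - ?w 0) \<le> E" if t: "t \<in> ?I" for t
  proof -
    have "norm (?w t - ?w 0) \<le> E * norm (t - 0)"
    proof (rule differentiable_bound[of ?I])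
      fix s assume s: "s \<in> ?I"
      show "(?w has_derivative (\<lambda>h. h *\<^sub>R - christoffel N c (?u s) (?w s) (?w s))) (at s within ?I)"
        using dw[OF s] by (simp add: has_vector_derivative_def)
      show "onorm (\<lambda>h. h *\<^sub>R - christoffel N c (?u s) (?w s) (?w s)) \<le> E"
        using mult_left_mono[OF dw_le[OF s] abs_ge_zero] by (intro onorm_le) (simp add: mult.commute)
    qed (use t in auto)
    also have "\<dots> \<le> E * 1"
      using t K by (intro mult_left_mono) (auto simp: E_def)
    finally show ?thesis by simp
  qed
  have "norm (?u 1 - ?u 0 - (1 - 0) *\<^sub>R ?w 0) \<le> norm (1 - 0 :: real) * E"
    by (rule vector_differentiable_bound_linearization[where S = ?I and f' = ?w and ?x0.0 = 0])
      (use du w_diff in \<open>auto simp: closed_segment_eq_real_ivl o_def\<close>)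
  then have "norm (?w 0) \<le> norm (?u 1 - ?u 0) + E"
    using norm_triangle_ineq2[of "?w 0" "?u 1 - ?u 0"] by (simp add: norm_minus_commute)
  moreover have "d / sqrt K \<le> norm (?w 0)"
  proof -
    have "d \<le> sqrt (K * (norm (?w 0))\<^sup>2)"
      unfolding d_def tnorm_chart[OF c p] using inB(2)[of 0] by (intro real_sqrt_le_mono up) simp
    then show ?thesis
      using K by (simp add: real_sqrt_mult field_simps)
  qed
  ultimately show "d / sqrt K - K * (d / sqrt \<mu>)\<^sup>2 \<le> norm (cmap c (\<gamma> 1) - cmap c (\<gamma> 0))"
    by (simp add: E_def)
qed

end

text \<open>The competitor is the coordinate segment, which stays in \<open>B\<close> by convexity.
  Its velocity is the constant vector \<open>a\<close>, but regularity has to be checked in every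
  chart.\<close>

lemma geodesic_dist_upper_bound:
  assumes c: "c \<in> atlas N" and B: "B \<subseteq> img c" "convex B"
    and up: "\<And>u a. u \<in> B \<Longrightarrow> metric_in N c u a a \<le> K * (norm a)\<^sup>2"
    and p: "p \<in> cdom c" "cmap c p \<in> B" and q: "q \<in> cdom c" "cmap c q \<in> B"
  shows "geodesic_dist N p q \<le> ennreal (sqrt K * norm (cmap c p - cmap c q))"
proof -
  let ?I = "{0..1::real}"
  define a where "a = cmap c q - cmap c p"
  define l where "l s = cmap c p + s *\<^sub>R a" for s
  define \<gamma> where "\<gamma> s = cinv c (l s)" for s
  have l: "l s \<in> B" if "s \<in> ?I" for s
  proof -
    have "l s = (1 - s) *\<^sub>R cmap c p + s *\<^sub>R cmap c q"
      by (simp add: l_def a_def algebra_simps)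
    then show ?thesis
      using that p(2) q(2) B(2) by (simp add: convexD)
  qed
  then have l_img: "l s \<in> img c" if "s \<in> ?I" for s
    using that B(1) by blast
  have dom: "\<gamma> s \<in> cdom c" and u: "cmap c (\<gamma> s) = l s" if "s \<in> ?I" for s
    using l_img[OF that] by (simp_all add: \<gamma>_def cinv_in[OF c] cmap_cinv[OF c])
  have ends: "\<gamma> 0 = p" "\<gamma> 1 = q"
    using p q by (simp_all add: \<gamma>_def l_def a_def cinv_cmap[OF c])
  have l_cont: "continuous_on S l" for S
    unfolding l_def by (intro continuous_intros)
  have cont: "continuous_on ?I \<gamma>"
    unfolding \<gamma>_def[abs_def] using l_img by (intro continuous_on_compose2[OF continuous_on_cinv[OF c] l_cont]) auto
  have der_c: "((cmap c \<circ> \<gamma>) has_vector_derivative a) (at s within ?I)" if s: "s \<in> ?I" for s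
  proof -
    have "(l has_vector_derivative a) (at s within ?I)"
      unfolding l_def by (auto intro!: derivative_eq_intros)
    then show ?thesis
      by (rule has_vector_derivative_transform[OF s, rotated]) (simp add: u)
  qed
  have der: "((cmap d \<circ> \<gamma>) has_vector_derivative coord_change c d (\<gamma> s) a) (at s within ?I)"
    if "s \<in> ?I" "d \<in> atlas N" "\<gamma> s \<in> cdom d" for s d
    using cont that dom by (intro chart_derivative_change[OF _ c that(2) _ that(3,1) der_c])
      (auto simp: continuous_on_eq_continuous_within)
  have vel: "velocity N ?I \<gamma> s = from_chart N c (\<gamma> s) a" if s: "s \<in> ?I" for s
    unfolding velocity_def from_chart_def
    by (rule vector_derivative_within[OF at_within_unit_interval[OF s] der[OF s]]) auto
  have C1: "C1_curve_on N ?I \<gamma>"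
    unfolding C1_curve_on_def
  proof (intro conjI ballI cont)
    show "(cmap (chart_at N (\<gamma> t)) \<circ> \<gamma>) differentiable at t within ?I" if "t \<in> ?I" for t
      using der[OF that chart_at_atlas] by (rule differentiableI_vector)
    fix d assume d: "d \<in> atlas N"
    let ?D = "{s \<in> ?I. \<gamma> s \<in> cdom d}"
    have "continuous_on (cmap c ` (cdom c \<inter> cdom d)) (\<lambda>w. frechet_derivative (cmap d \<circ> cinv c) (at w) a)"
      using transition_smooth[OF c d, of "Suc 0"] by simp
    then have "continuous_on ?D (\<lambda>s. frechet_derivative (cmap d \<circ> cinv c) (at (l s)) a)"
      by (rule continuous_on_compose2[OF _ l_cont]) (use dom u in \<open>force simp: image_iff\<close>)
    then show "continuous_on ?D (\<lambda>s. in_chart N d (\<gamma> s) (velocity N ?I \<gamma> s))"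
    proof (rule continuous_on_eq)
      fix s assume s: "s \<in> ?D"
      have "in_chart N d (\<gamma> s) (velocity N ?I \<gamma> s) = coord_change c d (\<gamma> s) (in_chart N c (\<gamma> s) (velocity N ?I \<gamma> s))"
        using s dom by (intro in_chart_change[OF c _ d, symmetric]) auto
      then show "frechet_derivative (cmap d \<circ> cinv c) (at (l s)) a = in_chart N d (\<gamma> s) (velocity N ?I \<gamma> s)"
        using s dom u vel by (simp add: in_from_chart[OF c] coord_change_def)
    qed
  qed
  have "curve_length N \<gamma> \<le> sqrt K * norm a"
  proof -
    have "tnorm N (\<gamma> s) (velocity N ?I \<gamma> s) \<le> sqrt K * norm a" if s: "s \<in> ?I" for s
    proof -
      have "tnorm N (\<gamma> s) (velocity N ?I \<gamma> s) = sqrt (metric_in N c (l s) a a)"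
        using s dom u vel by (simp add: tnorm_chart[OF c] in_from_chart[OF c])
      also have "\<dots> \<le> sqrt (K * (norm a)\<^sup>2)"
        by (intro real_sqrt_le_mono up l s)
      finally show ?thesis by (simp add: real_sqrt_mult)
    qed
    then have "curve_length N \<gamma> \<le> integral ?I (\<lambda>s. sqrt K * norm a)"
      unfolding curve_length_def
      by (intro integral_le integrable_continuous_real[OF speed_continuous[OF C1]] integrable_const_ivl) auto
    then show ?thesis by simp
  qed
  then have "ennreal (curve_length N \<gamma>) \<le> ennreal (sqrt K * norm (cmap c p - cmap c q))"
    by (intro ennreal_leI) (simp add: a_def norm_minus_commute)
  then show ?thesis
    unfolding geodesic_dist_def using ends C1_imp_piecewise_C1_curve[OF C1]
    by (intro INF_lower2[of \<gamma>]) auto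
qed

text \<open>A supremum of reals says something only for a set bounded above. Boundedness follows by
  comparing the tangent norm with the Euclidean one; the quotient at 0 has the value 0.\<close>

lemma topnorm_bound:
  assumes A: "linear A"
  shows "tnorm N p (A v) \<le> topnorm N p A * tnorm N p v"
proof (cases "v = 0")
  case True
  then show ?thesis
    using linear_0[OF A] by (simp add: tnorm_eq_0_iff[THEN iffD2])
next
  case False
  define c where "c = chart_at N p"
  have c: "c \<in> atlas N" "p \<in> cdom c"
    by (simp_all add: c_def)
  obtain r \<mu> K L where b: "r > 0" "\<mu> > 0" "K > 0"
    "\<And>u a. u \<in> cball (cmap c p) r \<Longrightarrow> \<mu> * (norm a)\<^sup>2 \<le> metric_in N c u a a"
    "\<And>u a. u \<in> cball (cmap c p) r \<Longrightarrow> metric_in N c u a a \<le> K * (norm a)\<^sup>2"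
    using local_bounds[OF c(1) imageI[OF c(2)]] by metis
  have [simp]: "in_chart N c p w = w" for w
    by (simp add: c_def in_chart_at)
  have low: "sqrt \<mu> * norm w \<le> tnorm N p w" for w
    using real_sqrt_le_mono[OF b(4)[of "cmap c p" w]] b(1) by (simp add: tnorm_chart[OF c] real_sqrt_mult)
  have up: "tnorm N p w \<le> sqrt K * norm w" for w
    using real_sqrt_le_mono[OF b(5)[of "cmap c p" w]] b(1) by (simp add: tnorm_chart[OF c] real_sqrt_mult)
  have bl: "bounded_linear A"
    using A by (simp add: linear_conv_bounded_linear)
  have "tnorm N p (A w) / tnorm N p w \<le> sqrt K * onorm A / sqrt \<mu>" for w
  proof (cases "w = 0")
    case False
    have "tnorm N p (A w) \<le> sqrt K * (onorm A * norm w)"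
      using up[of "A w"] onorm[OF bl, of w] b(3)
      by (meson mult_left_mono order_trans real_sqrt_ge_zero less_imp_le)
    also have "\<dots> \<le> sqrt K * (onorm A * (tnorm N p w / sqrt \<mu>))"
      using low[of w] b(2,3) onorm_pos_le[OF bl] by (intro mult_left_mono) (auto simp: field_simps)
    finally have "tnorm N p (A w) \<le> (sqrt K * onorm A / sqrt \<mu>) * tnorm N p w"
      by simp
    moreover have "tnorm N p w > 0"
      using False tnorm_nonneg[of p w] tnorm_eq_0_iff[of p w] by linarith
    ultimately show ?thesis
      by (simp only: pos_divide_le_eq)
  qed (use b onorm_pos_le[OF bl] in \<open>simp add: tnorm_eq_0_iff[THEN iffD2]\<close>)
  then have "bdd_above (range (\<lambda>w. tnorm N p (A w) / tnorm N p w))"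
    by (intro bdd_aboveI2)
  then have "tnorm N p (A v) / tnorm N p v \<le> topnorm N p A"
    unfolding topnorm_def by (rule cSUP_upper2[of _ _ v]) auto
  moreover have "tnorm N p v > 0"
    using False tnorm_nonneg[of p v] tnorm_eq_0_iff[of p v] by linarith
  ultimately show ?thesis
    by (simp only: pos_divide_le_eq)
qed

end

section \<open>Superlinear convergence\<close>

text \<open>As \<open>d\<close> never exceeds \<open>d 0\<close>, the factor never exceeds its
  initial value. The maximum with 0 allows for a negative factor.\<close>

lemma contraction_tendsto_zero:
  fixes d :: "nat \<Rightarrow> real"
  assumes nonneg: "\<And>k. d k \<ge> 0" and step: "\<And>k. d (Suc k) \<le> (\<kappa> + \<omega> / 2 * d k) * d k"
    and start: "\<kappa> + \<omega> / 2 * d 0 < 1" and \<omega>: "\<omega> \<ge> 0"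
  shows "d \<longlonglongrightarrow> 0"
proof -
  define \<delta> where "\<delta> = max 0 (\<kappa> + \<omega> / 2 * d 0)"
  have \<delta>: "0 \<le> \<delta>" "\<delta> < 1"
    using start by (auto simp: \<delta>_def)
  have "d k \<le> \<delta> ^ k * d 0" for k
  proof (induction k)
    case (Suc k)
    have "\<delta> ^ k * d 0 \<le> d 0"
      using \<delta> nonneg[of 0] by (simp add: mult_left_le_one_le power_le_one)
    then have "\<omega> / 2 * d k \<le> \<omega> / 2 * d 0"
      using Suc \<omega> by (intro mult_left_mono) auto
    then have "\<kappa> + \<omega> / 2 * d k \<le> \<delta>"
      unfolding \<delta>_def by linarith
    then have "d (Suc k) \<le> \<delta> * d k"
      using step[of k] nonneg[of k] mult_right_mono order_trans by blast
    also have "\<dots> \<le> \<delta> * (\<delta> ^ k * d 0)"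
      using Suc \<delta> by (intro mult_left_mono) auto
    finally show ?case by (simp add: mult.assoc)
  qed simp
  moreover have "(\<lambda>k. \<delta> ^ k * d 0) \<longlonglongrightarrow> 0"
    using \<delta> by (intro tendsto_mult_left_zero LIMSEQ_realpow_zero)
  ultimately show ?thesis
    using nonneg by (intro tendsto_sandwich[of "\<lambda>_. 0" d sequentially "\<lambda>k. \<delta> ^ k * d 0"]) auto
qed

text \<open>
  Since \<open>d\<close> eventually halves in each step, the error at \<open>Suc k\<close> is bounded by a multiple of
  \<open>d (Suc k)\<close>, while the error at \<open>k\<close> is bounded below by a multiple of \<open>d k\<close>.
\<close>

lemma superlinear_steps:
  fixes u :: "nat \<Rightarrow> 'a::real_normed_vector" and d \<theta> :: "nat \<Rightarrow> real"
  assumes lim: "u \<longlonglongrightarrow> l" and \<theta>: "\<theta> \<longlonglongrightarrow> 0" and ab: "a > 0" "b > 0" and d0: "\<And>k. d k \<ge> 0"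
    and ev: "\<forall>\<^sub>F k in sequentially. norm (u (Suc k) - u k) \<le> b * d k \<and> a * d k \<le> norm (u (Suc k) - u k) \<and>
      d (Suc k) \<le> \<theta> k * d k"
  shows "\<forall>\<^sub>F k in sequentially. norm (u (Suc k) - l) \<le> 4 * b / a * \<theta> k * norm (u k - l)"
proof -
  \<comment> \<open>The bound 1/2 makes \<open>d\<close> halve; \<open>a / (4 * b)\<close> makes the
    error after the step at most \<open>a * d k / 2\<close>, half of the lower bound for the
    step.\<close>
  have "\<forall>\<^sub>F k in sequentially. \<theta> k < min (1 / 2) (a / (4 * b))"
    using \<theta> ab by (intro order_tendstoD(2)) auto
  with ev have "\<forall>\<^sub>F k in sequentially. norm (u (Suc k) - u k) \<le> b * d k \<and> a * d k \<le> norm (u (Suc k) - u k) \<and>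
      d (Suc k) \<le> \<theta> k * d k \<and> \<theta> k < min (1 / 2) (a / (4 * b))"
    by eventually_elim blast
  then obtain K where K: "\<And>k. k \<ge> K \<Longrightarrow> norm (u (Suc k) - u k) \<le> b * d k"
    "\<And>k. k \<ge> K \<Longrightarrow> a * d k \<le> norm (u (Suc k) - u k)"
    "\<And>k. k \<ge> K \<Longrightarrow> d (Suc k) \<le> \<theta> k * d k" "\<And>k. k \<ge> K \<Longrightarrow> \<theta> k < 1 / 2" "\<And>k. k \<ge> K \<Longrightarrow> \<theta> k < a / (4 * b)"
    unfolding eventually_sequentially by auto
  have half: "d (Suc k) \<le> d k / 2" if "k \<ge> K" for k
    using K(3)[OF that] mult_right_mono[OF less_imp_le[OF K(4)[OF that]] d0[of k]] by linarith
  \<comment> \<open>Subtracting \<open>d (k + j)\<close> makes the estimate telescope, since halving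
    gives \<open>d k \<le> 2 * (d k - d (Suc k))\<close>.\<close>
  have tail: "norm (u (k + j) - u k) \<le> 2 * b * (d k - d (k + j))" if "k \<ge> K" for k j
  proof (induction j)
    case (Suc j)
    have "norm (u (k + Suc j) - u k) \<le> norm (u (Suc (k + j)) - u (k + j)) + norm (u (k + j) - u k)"
      using norm_triangle_ineq[of "u (Suc (k + j)) - u (k + j)" "u (k + j) - u k"] by simp
    also have "\<dots> \<le> b * d (k + j) + 2 * b * (d k - d (k + j))"
      using K(1)[of "k + j"] that Suc by simp
    also have "b * d (k + j) \<le> b * (2 * (d (k + j) - d (Suc (k + j))))"
      using half[of "k + j"] that ab by (intro mult_left_mono) auto
    finally show ?case
      by (simp add: algebra_simps)
  qed simp
  have err: "norm (u k - l) \<le> 2 * b * d k" if "k \<ge> K" for k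
  proof (rule tendsto_upperbound)
    have "(\<lambda>j. u (j + k)) \<longlonglongrightarrow> l"
      using lim by (rule LIMSEQ_ignore_initial_segment)
    then show "(\<lambda>j. norm (u k - u (k + j))) \<longlonglongrightarrow> norm (u k - l)"
      by (intro tendsto_intros) (simp add: add.commute)
    have "norm (u k - u (k + j)) \<le> 2 * b * d k" for j
    proof -
      have "2 * b * (d k - d (k + j)) \<le> 2 * b * d k"
        using ab d0[of "k + j"] by (intro mult_left_mono) auto
      then show ?thesis
        using tail[OF that, of j] by (simp add: norm_minus_commute)
    qed
    then show "\<forall>\<^sub>F j in sequentially. norm (u k - u (k + j)) \<le> 2 * b * d k"
      by simp
  qed simp
  have "norm (u (Suc k) - l) \<le> 4 * b / a * \<theta> k * norm (u k - l)" if k: "k \<ge> K" for k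
  proof (cases "d k = 0")
    case True
    then have "u (Suc k) = l" "u k = l"
      using err[OF k] err[of "Suc k"] K(3)[OF k] d0[of "Suc k"] k by auto
    then show ?thesis by simp
  next
    case False
    then have dk: "d k > 0" using d0[of k] by simp
    have \<theta>0: "\<theta> k \<ge> 0"
      using order_trans[OF d0 K(3)[OF k]] dk by (simp add: zero_le_mult_iff)
    have 1: "norm (u (Suc k) - l) \<le> 2 * b * (\<theta> k * d k)"
      using ab k by (intro order_trans[OF err[of "Suc k"] mult_left_mono[OF K(3)[OF k]]]) auto
    have "2 * b * (\<theta> k * d k) \<le> 2 * b * (a / (4 * b) * d k)"
      using K(5)[OF k] ab dk by (intro mult_left_mono mult_right_mono) auto
    also have "\<dots> = a * d k / 2"
      using ab by simp
    \<comment> \<open>The step is at most the error before it plus the error after it, and the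
      latter is absorbed.\<close>
    finally have "a * d k \<le> norm (u k - l) + a * d k / 2"
      using K(2)[OF k] norm_triangle_ineq4[of "u (Suc k) - l" "u k - l"] 1 by simp
    then have 2: "d k \<le> 2 / a * norm (u k - l)"
      using ab by (simp add: field_simps)
    have "2 * b * (\<theta> k * d k) \<le> 2 * b * (\<theta> k * (2 / a * norm (u k - l)))"
      using 2 \<theta>0 ab by (intro mult_left_mono) auto
    with 1 show ?thesis by simp
  qed
  then show ?thesis
    unfolding eventually_sequentially by blast
qed

theorem corollary3p3:
  fixes N :: "('m::{t2_space, second_countable_topology}, 'e::euclidean_space) riemannian"
    and D :: "'m set"
    and F :: "'m \<Rightarrow> 'e"
    and J M :: "'m \<Rightarrow> 'e \<Rightarrow> 'e"
    and \<Delta> :: "'m \<Rightarrow> 'e"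
    and \<gamma> :: "'m \<Rightarrow> real \<Rightarrow> 'm"
    and P :: "'m \<Rightarrow> real \<Rightarrow> real \<Rightarrow> 'e \<Rightarrow> 'e"
    and \<kappa>' :: "'m \<Rightarrow> real"
    and \<omega> \<kappa> \<delta>\<^sub>0 C :: real
    and x :: "nat \<Rightarrow> 'm"
    and xhat :: 'm
  assumes manifold: "riemannian_manifold N"
    and complete: "geodesically_complete N"
    and D: "open D" "simply_connected D"
    and F: "twice_differentiable_field N F"
    and J: "\<And>p v. J p v = nabla N F p v"
    and M: "\<And>p. p \<in> D \<Longrightarrow> linear (M p) \<and> bij (M p)"
    and \<Delta>: "\<And>p. \<Delta> p = - M p (F p)"
    and \<gamma>: "\<And>p t. \<gamma> p t = riemannian_exp N p (- t *\<^sub>R M p (F p))"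
    and P: "\<And>p \<alpha> \<beta>. P p \<alpha> \<beta> = parallel_transport N (\<gamma> p) \<alpha> \<beta>"
    and cond_i: "\<And>p y t. p \<in> D \<Longrightarrow> y \<in> D \<Longrightarrow> y = riemannian_exp N p (\<Delta> p) \<Longrightarrow> t \<in> {0..1} \<Longrightarrow>
      tnorm N y (M y (P p t 1 (J (\<gamma> p t) (P p 0 t (\<Delta> p))) - P p 0 1 (J p (\<Delta> p))))
        \<le> \<omega> * t * (tnorm N p (\<Delta> p))\<^sup>2"
    and \<kappa>: "\<kappa> < 1"
    and cond_ii: "\<And>p y. p \<in> D \<Longrightarrow> y \<in> D \<Longrightarrow> y = riemannian_exp N p (\<Delta> p) \<Longrightarrow>
      tnorm N y (M y (P p 0 1 (F p + J p (\<Delta> p)))) = \<kappa>' p * tnorm N p (\<Delta> p) \<and> \<kappa>' p \<le> \<kappa>"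
    and \<delta>\<^sub>0: "\<delta>\<^sub>0 = \<kappa> + \<omega> / 2 * tnorm N (x 0) (M (x 0) (F (x 0)))" "\<delta>\<^sub>0 < 1"
    and iterates_in_D: "\<And>k. x k \<in> D"
    and iteration: "\<And>k. x (Suc k) = riemannian_exp N (x k) (- M (x k) (F (x k)))"
    and limit: "(\<lambda>k. geodesic_dist N (x k) xhat) \<longlonglongrightarrow> 0"
    and approx: "(\<lambda>k. tnorm N (x k) (inv (M (x k)) (\<Delta> (x k)) - J (x k) (\<Delta> (x k)))
                       / tnorm N (x k) (\<Delta> (x k))) \<longlonglongrightarrow> 0"
    and bound: "\<And>k. topnorm N (x k) (M (x k)) \<le> C"
  shows "superlinear_convergence N x xhat"
proof -
  interpret riemannian_mfd N
    by unfold_locales (rule manifold)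
  define d where "d k = tnorm N (x k) (\<Delta> (x k))" for k
  define \<rho> where "\<rho> k = tnorm N (x k) (inv (M (x k)) (\<Delta> (x k)) - J (x k) (\<Delta> (x k))) / d k" for k
  have d_nonneg: "d k \<ge> 0" and \<rho>_nonneg: "\<rho> k \<ge> 0" for k
    by (simp_all add: d_def \<rho>_def)
  \<comment> \<open>A nonzero vector shows that the operator norm, and with it \<open>C\<close>, is
    nonnegative. This makes \<epsilon> nonnegative, so that products split in
    \<open>ennreal\<close>.\<close>
  have C: "C \<ge> 0"
  proof -
    have "0 \<le> topnorm N (x 0) (M (x 0)) * tnorm N (x 0) v" for v
      using topnorm_bound[of "M (x 0)" "x 0" v] M[OF iterates_in_D[of 0]] tnorm_nonneg[of "x 0"]
      by (meson order_trans)
    moreover obtain v :: 'e where "v \<noteq> 0"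
      using nonzero_Basis nonempty_Basis by blast
    ultimately have "0 \<le> topnorm N (x 0) (M (x 0))"
      using tnorm_nonneg[of "x 0" v] tnorm_eq_0_iff[of "x 0" v] by (metis order_le_less zero_le_mult_iff not_le)
    then show ?thesis
      using bound[of 0] by linarith
  qed
  have \<gamma>_eq: "\<gamma> p = (\<lambda>t. riemannian_exp N p (t *\<^sub>R \<Delta> p))" for p
    by (intro ext) (simp add: \<gamma> \<Delta>)
  have geo: "geodesic_on N {0..1} (\<gamma> p)" "\<gamma> p 0 = p" "velocity N {0..1} (\<gamma> p) 0 = \<Delta> p" for p
    unfolding \<gamma>_eq by (rule riemannian_exp_curve[OF complete])+
  have x_Suc: "riemannian_exp N (x k) (\<Delta> (x k)) = x (Suc k)" for k
    by (simp add: iteration \<Delta>)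
  have \<gamma>1: "\<gamma> (x k) 1 = x (Suc k)" for k
    by (simp add: \<gamma>_eq x_Suc)
  have J_eq: "J p = nabla N F p" for p
    by (intro ext) (rule J)

  \<comment> \<open>Recursion for the step lengths\<close>
  define Q where "Q k = P (x k) 0 1 (F (x k) + J (x k) (\<Delta> (x k)))" for k
  \<comment> \<open>Up to sign the next step is \<open>M\<close> applied to the field at the new
    point; splitting off \<open>Q k\<close> leaves the part controlled by condition (i).\<close>
  have remainder: "d (Suc k) \<le> tnorm N (x (Suc k)) (M (x (Suc k)) (Q k)) + \<omega> / 2 * (d k)\<^sup>2" for k
  proof -
    let ?y = "x (Suc k)"
    have lin: "linear (M ?y)"
      using M[OF iterates_in_D] by blast
    have "tnorm N (\<gamma> (x k) 1) (M ?y (F (\<gamma> (x k) 1) -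
        parallel_transport N (\<gamma> (x k)) 0 1 (F (\<gamma> (x k) 0) + nabla N F (\<gamma> (x k) 0) (\<Delta> (x k))))) \<le> (\<omega> * (d k)\<^sup>2) / 2"
    proof (rule newton_remainder[OF F geo(1) lin geo(3)])
      fix t :: real assume t: "t \<in> {0..1}"
      show "tnorm N (\<gamma> (x k) 1) (M ?y (parallel_transport N (\<gamma> (x k)) t 1
          (nabla N F (\<gamma> (x k) t) (parallel_transport N (\<gamma> (x k)) 0 t (\<Delta> (x k)))) -
          parallel_transport N (\<gamma> (x k)) 0 1 (nabla N F (\<gamma> (x k) 0) (\<Delta> (x k))))) \<le> \<omega> * (d k)\<^sup>2 * t"
        using cond_i[OF iterates_in_D[of k] iterates_in_D[of "Suc k"] x_Suc[symmetric] t]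
        by (simp only: P J_eq \<gamma>1 geo(2) d_def mult_ac)
    qed
    then have *: "tnorm N ?y (M ?y (F ?y - Q k)) \<le> \<omega> / 2 * (d k)\<^sup>2"
      by (simp add: \<gamma>1 geo(2) Q_def P J_eq)
    have "d (Suc k) = tnorm N ?y (M ?y (F ?y))"
      by (simp add: d_def \<Delta> tnorm_minus)
    also have "M ?y (F ?y) = M ?y (Q k) + M ?y (F ?y - Q k)"
      by (simp add: linear_diff[OF lin])
    also have "tnorm N ?y \<dots> \<le> tnorm N ?y (M ?y (Q k)) + tnorm N ?y (M ?y (F ?y - Q k))"
      by (rule tnorm_triangle)
    finally show ?thesis
      using * by linarith
  qed
  have Q_\<kappa>: "tnorm N (x (Suc k)) (M (x (Suc k)) (Q k)) = \<kappa>' (x k) * d k" "\<kappa>' (x k) \<le> \<kappa>" for k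
    using cond_ii[OF iterates_in_D[of k] iterates_in_D[of "Suc k"] x_Suc[symmetric]] by (simp_all add: Q_def d_def)
  have Q_\<rho>: "tnorm N (x (Suc k)) (M (x (Suc k)) (Q k)) \<le> C * \<rho> k * d k" for k
  \<comment> \<open>For a zero step the quotient \<rho> has the default value 0 and carries no
    information; condition (ii) makes the left-hand side vanish there.\<close>
  proof (cases "d k = 0")
    case True
    then show ?thesis using Q_\<kappa>(1)[of k] by simp
  next
    case False
    let ?p = "x k" and ?y = "x (Suc k)"
    have Mp: "linear (M ?p)" "inj (M ?p)" and My: "linear (M ?y)"
      using M[OF iterates_in_D] by (auto simp: bij_def)
    \<comment> \<open>Thus the approximation hypothesis speaks about the negative of the linearised
      residual.\<close>
    have "inv (M ?p) (\<Delta> ?p) = - F ?p"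
      using inv_f_f[OF Mp(2), of "- F ?p"] by (simp add: \<Delta> linear_neg[OF Mp(1)])
    then have "tnorm N ?p (F ?p + J ?p (\<Delta> ?p)) = \<rho> k * d k"
      using False tnorm_minus[of ?p "F ?p + J ?p (\<Delta> ?p)"] by (simp add: \<rho>_def)
    moreover have "tnorm N ?y (Q k) = tnorm N ?p (F ?p + J ?p (\<Delta> ?p))"
      using parallel_transport_tnorm[OF geodesic_imp_C1_curve[OF geo(1)], of 0 1 ?p]
      by (simp add: Q_def P \<gamma>1 geo(2))
    moreover have "tnorm N ?y (M ?y (Q k)) \<le> topnorm N ?y (M ?y) * tnorm N ?y (Q k)"
      by (rule topnorm_bound[OF My])
    moreover have "\<dots> \<le> C * tnorm N ?y (Q k)"
      by (intro mult_right_mono bound tnorm_nonneg)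
    ultimately show ?thesis
      by (simp add: mult.assoc)
  qed
  define \<theta> where "\<theta> k = C * \<rho> k + \<bar>\<omega>\<bar> / 2 * d k" for k
  have step: "d (Suc k) \<le> \<theta> k * d k" for k
  proof -
    have "\<omega> / 2 * (d k)\<^sup>2 \<le> \<bar>\<omega>\<bar> / 2 * (d k)\<^sup>2"
      by (intro mult_right_mono) auto
    then show ?thesis
      using remainder[of k] Q_\<rho>[of k] by (simp add: \<theta>_def distrib_right power2_eq_square)
  qed
  have d_lim: "d \<longlonglongrightarrow> 0"
  proof (cases "\<omega> \<ge> 0")
    case True
    show ?thesis
    proof (rule contraction_tendsto_zero[OF d_nonneg _ _ True])
      show "\<kappa> + \<omega> / 2 * d 0 < 1"
        using \<delta>\<^sub>0 by (simp add: d_def \<Delta> tnorm_minus)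
      show "d (Suc k) \<le> (\<kappa> + \<omega> / 2 * d k) * d k" for k
        using remainder[of k] Q_\<kappa>[of k] mult_right_mono[OF Q_\<kappa>(2)[of k] d_nonneg[of k]]
        by (simp add: distrib_right power2_eq_square)
    qed
  next
    \<comment> \<open>For negative \<omega>, condition (i) at \<open>t = 1\<close> bounds a norm by
      a nonpositive number, so all steps vanish.\<close>
    case False
    have "d k = 0" for k
    proof -
      have "0 \<le> \<omega> * 1 * (d k)\<^sup>2"
        unfolding d_def
        by (rule order_trans[OF tnorm_nonneg cond_i[OF iterates_in_D[of k] iterates_in_D[of "Suc k"] x_Suc[symmetric], of 1]]) simp
      then show ?thesis
        using False by (simp add: zero_le_mult_iff)
    qed
    then have "d = (\<lambda>_. 0)"
      by auto
    then show ?thesis by simp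
  qed
  have \<theta>_lim: "\<theta> \<longlonglongrightarrow> 0"
  proof -
    have "\<rho> \<longlonglongrightarrow> 0"
      using approx by (simp add: \<rho>_def[abs_def] d_def)
    then have "\<theta> \<longlonglongrightarrow> C * 0 + \<bar>\<omega>\<bar> / 2 * 0"
      unfolding \<theta>_def[abs_def] by (intro tendsto_intros d_lim)
    then show ?thesis by simp
  qed
  have \<theta>_nonneg: "\<theta> k \<ge> 0" for k
    using C \<rho>_nonneg d_nonneg by (simp add: \<theta>_def)

  \<comment> \<open>A chart around the limit\<close>
  define c where "c = chart_at N xhat"
  have c: "c \<in> atlas N" "xhat \<in> cdom c"
    by (simp_all add: c_def)
  obtain r \<mu> K L where r: "r > 0" "cball (cmap c xhat) r \<subseteq> img c" and \<mu>: "\<mu> > 0" and K: "K > 0"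
    and low: "\<And>u a. u \<in> cball (cmap c xhat) r \<Longrightarrow> \<mu> * (norm a)\<^sup>2 \<le> metric_in N c u a a"
    and up: "\<And>u a. u \<in> cball (cmap c xhat) r \<Longrightarrow> metric_in N c u a a \<le> K * (norm a)\<^sup>2"
    and \<Gamma>: "\<And>u a b. u \<in> cball (cmap c xhat) r \<Longrightarrow> norm (christoffel N c u a b) \<le> K * norm a * norm b"
    by (rule local_bounds[OF c(1) imageI[OF c(2)]]) blast
  define u where "u k = cmap c (x k)" for k
  define l where "l = cmap c xhat"
  let ?B = "cball l r"
  note local_facts = r(2) low up \<Gamma>
  note local_facts = local_facts[folded l_def]
  note lower = geodesic_dist_lower_bound[OF c(1) \<mu> local_facts(1,2) c(2) r(1), folded l_def, OF _ order_refl]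

  \<comment> \<open>Eventually the iterates lie in the chart; only then do their coordinates
    \<open>u k\<close> have a meaning.\<close>
  have near: "\<forall>\<^sub>F k in sequentially. x k \<in> cdom c \<and> ennreal (sqrt \<mu> * norm (u k - l)) \<le> geodesic_dist N (x k) xhat \<and>
      norm (u k - l) < e" if e: "0 < e" "e \<le> r" for e
  proof -
    have "\<forall>\<^sub>F k in sequentially. geodesic_dist N (x k) xhat < ennreal (sqrt \<mu> * e)"
      using e \<mu> by (intro order_tendstoD(2)[OF limit]) (simp add: ennreal_less_zero_iff)
    then show ?thesis
    proof eventually_elim
      case (elim k)
      have "ennreal (sqrt \<mu> * e) \<le> ennreal (sqrt \<mu> * r)"
        using e \<mu> by (intro ennreal_leI mult_left_mono) auto
      then have "geodesic_dist N (x k) xhat < ennreal (sqrt \<mu> * r)"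
        using elim by order
      note lb = lower[OF _ this]
      have *: "x k \<in> cdom c" "ennreal (sqrt \<mu> * norm (u k - l)) \<le> geodesic_dist N (x k) xhat"
        using lb by (simp_all add: u_def l_def)
      then have "ennreal (sqrt \<mu> * norm (u k - l)) < ennreal (sqrt \<mu> * e)"
        using elim by order
      then have "norm (u k - l) < e"
        using \<mu> by (simp add: ennreal_less_iff)
      with * show ?case by blast
    qed
  qed
  have u_lim: "u \<longlonglongrightarrow> l"
  proof (rule tendstoI)
    fix e :: real assume "e > 0"
    then have "\<forall>\<^sub>F k in sequentially. norm (u k - l) < min e r"
      using near[of "min e r"] r(1) by (auto elim: eventually_mono)
    then show "\<forall>\<^sub>F k in sequentially. dist (u k) l < e"
      by eventually_elim (simp add: dist_norm)
  qed

  \<comment> \<open>Steps measured in coordinates\<close>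
  define a where "a = 1 / (2 * sqrt K)"
  define b where "b = 1 / sqrt \<mu>"
  have ab: "a > 0" "b > 0"
    using K \<mu> by (simp_all add: a_def b_def)
  \<comment> \<open>The first threshold keeps the geodesic in the ball of radius
    \<open>r / 2\<close> around its start, which lies in \<open>?B\<close>; the second makes the
    quadratic deviation at most \<open>a * d k\<close>, half of the linear term
    \<open>d k / sqrt K\<close>.\<close>
  have "\<forall>\<^sub>F k in sequentially. d k < min (sqrt \<mu> * (r / 2)) (a * \<mu> / K)"
    using r(1) \<mu> K ab by (intro order_tendstoD(2)[OF d_lim]) simp
  with near[of "r / 2"] r(1) have small: "\<forall>\<^sub>F k in sequentially. x k \<in> cdom c \<and> norm (u k - l) < r / 2 \<and>
      d k < min (sqrt \<mu> * (r / 2)) (a * \<mu> / K)"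
    by (auto elim: eventually_elim2)
  have "\<forall>\<^sub>F k in sequentially. norm (u (Suc k) - u k) \<le> b * d k \<and> a * d k \<le> norm (u (Suc k) - u k) \<and>
      d (Suc k) \<le> \<theta> k * d k"
    using small
  proof eventually_elim
    case (elim k)
    have sub: "cball (cmap c (\<gamma> (x k) 0)) (r / 2) \<subseteq> ?B"
      using elim r(1) by (simp add: geo(2) u_def[symmetric] cball_subset_cball_iff dist_norm)
    have d_eq: "tnorm N (\<gamma> (x k) 0) (velocity N {0..1} (\<gamma> (x k)) 0) = d k"
      by (simp add: geo d_def)
    note disp = geodesic_chart_displacement[OF c(1) \<mu> local_facts(1,2) geo(1) _ _ sub local_facts(3) K local_facts(4),
        unfolded d_eq]
    have disp: "sqrt \<mu> * norm (u (Suc k) - u k) \<le> d k"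
      "d k / sqrt K - K * (d k / sqrt \<mu>)\<^sup>2 \<le> norm (u (Suc k) - u k)"
      using disp elim r(1) by (simp_all add: geo(2) \<gamma>1 u_def)
    have "K * (d k / sqrt \<mu>)\<^sup>2 = (K / \<mu> * d k) * d k"
      using \<mu> by (simp add: power_divide power2_eq_square)
    also have "\<dots> \<le> a * d k"
      using elim \<mu> K d_nonneg[of k] by (intro mult_right_mono) (auto simp: field_simps)
    finally have "d k / sqrt K - a * d k \<le> norm (u (Suc k) - u k)"
      using disp(2) by linarith
    moreover have "d k / sqrt K - a * d k = a * d k"
      using K by (simp add: a_def field_simps)
    moreover have "norm (u (Suc k) - u k) \<le> b * d k"
      using disp(1) \<mu> by (simp add: b_def field_simps)
    ultimately show ?case
      using step by simp
  qed
  from superlinear_steps[OF u_lim \<theta>_lim ab d_nonneg this]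
  have super: "\<forall>\<^sub>F k in sequentially. norm (u (Suc k) - l) \<le> 4 * b / a * \<theta> k * norm (u k - l)" .

  \<comment> \<open>\<open>sqrt K\<close> comes from the upper comparison of distances, division by
    \<open>sqrt \<mu>\<close> from the lower one, the factor in between from
    \<open>superlinear_steps\<close>.\<close>
  define \<epsilon> where "\<epsilon> k = sqrt K * (4 * b / a) / sqrt \<mu> * \<theta> k" for k
  have "\<epsilon> \<longlonglongrightarrow> 0"
    unfolding \<epsilon>_def[abs_def] by (intro tendsto_mult_right_zero \<theta>_lim)
  moreover have "\<forall>\<^sub>F k in sequentially.
      geodesic_dist N (x (Suc k)) xhat \<le> ennreal (\<epsilon> k) * geodesic_dist N (x k) xhat"
    \<comment> \<open>The upper comparison needs \<open>x (Suc k)\<close> in the chart, hence the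
      shifted copy of \<open>near\<close>.\<close>
    using super near[OF r(1) order_refl] near[OF r(1) order_refl, THEN eventually_sequentially_Suc[THEN iffD2]]
  proof eventually_elim
    case (elim k)
    have "geodesic_dist N (x (Suc k)) xhat \<le> ennreal (sqrt K * norm (u (Suc k) - l))"
      unfolding u_def l_def
      by (rule geodesic_dist_upper_bound[OF c(1) local_facts(1) convex_cball local_facts(3)])
        (use elim c(2) r(1) in \<open>auto simp: u_def l_def dist_norm norm_minus_commute\<close>)
    also have "\<dots> \<le> ennreal (sqrt K * (4 * b / a * \<theta> k * norm (u k - l)))"
      using elim(1) K by (intro ennreal_leI mult_left_mono) auto
    also have "sqrt K * (4 * b / a * \<theta> k * norm (u k - l)) = \<epsilon> k * (sqrt \<mu> * norm (u k - l))"
      using \<mu> by (simp add: \<epsilon>_def)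
    also have "ennreal \<dots> = ennreal (\<epsilon> k) * ennreal (sqrt \<mu> * norm (u k - l))"
      using \<theta>_nonneg[of k] K \<mu> ab by (intro ennreal_mult) (auto simp: \<epsilon>_def)
    also have "\<dots> \<le> ennreal (\<epsilon> k) * geodesic_dist N (x k) xhat"
      using elim(2) by (intro mult_left_mono) auto
    finally show ?case .
  qed
  ultimately show ?thesis
    unfolding superlinear_convergence_def by blast
qed

end
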